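(* Let $\Gamma$ be a hyperbolic group. The class of all quasi-isometrically embeddable rational subsets of $\Gamma$ is a Boolean algebra (it is closed under finite union, finite intersection, and complementation in $\Gamma$). Moreover, this can be algorithmically computed: given automata accepting quasi-isometrically embedded regular languages representing $\mathcal R_1,\mathcal R_2\subset\Gamma$, one can compute automata accepting quasi-isometrically embedded regular languages representing $\mathcal R_1\cup\mathcal R_2$, $\mathcal R_1\cap\mathcal R_2$ and $\Gamma\setminus\mathcal R_1$.
   Context: Let $S$ be a finite generating set of $\Gamma$, $\overline S$ a disjoint copy, $S_\pm=S\sqcup\overline S$, $S_\pm^*$ the free monoid on $S_\pm$, and $\pi:S_\pm^*\to\Gamma$ the natural surjective morphism sending $\bar s$ to $s^{-1}$. A regular language of $S_\pm^*$ is a language accepted by a finite automaton over $S_\pm$. A regular language $\tilde{\mathcal R}\subset S_\pm^*$ is quasi-isometrically embedded in $\Gamma$ if there exist $\lambda\ge1,\mu\ge0$ such that $|\pi(w)|_\Gamma\ge\frac1\lambda|w|-\mu$ for every $w\in\tilde{\mathcal R}$, where $|w|$ is word length and $|\cdot|_\Gamma$ is a word metric on $\Gamma$. It represents $\mathcal R\subset \Gamma$ if $\pi(\tilde{\mathcal R})=\mathcal R$. A subset $\mathcal R\subset\Gamma$ is a quasi-isometrically embeddable rational subset if it is represented by some quasi-isometrically embedded regular language. *)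

theory Defs
  imports
    "HOL-Algebra.Generated_Groups"
    "HOL-Analysis.Sigma_Algebra"
    "HOL-Library.Nat_Bijection"
begin

text \<open>
  The alphabet \<open>S \<squnion> S'\<close> (with \<open>S'\<close> a disjoint copy of \<open>S\<close>) is the disjoint sum \<open>S <+> S\<close>: the letter
  \<open>Inl s\<close> is \<open>s\<close> itself and \<open>Inr s\<close> is its formal inverse. The free monoid on it is
  \<open>lists (S <+> S)\<close>.
\<close>

fun letter_val :: "('a, 'b) monoid_scheme \<Rightarrow> 'a + 'a \<Rightarrow> 'a" where
  "letter_val G (Inl s) = s"
| "letter_val G (Inr s) = inv\<^bsub>G\<^esub> s"

primrec word_val :: "('a, 'b) monoid_scheme \<Rightarrow> ('a + 'a) list \<Rightarrow> 'a" where
  "word_val G [] = \<one>\<^bsub>G\<^esub>"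
| "word_val G (x # w) = letter_val G x \<otimes>\<^bsub>G\<^esub> word_val G w"

definition finite_generating_set :: "('a, 'b) monoid_scheme \<Rightarrow> 'a set \<Rightarrow> bool" where
  "finite_generating_set G S \<longleftrightarrow> finite S \<and> S \<subseteq> carrier G \<and> generate G S = carrier G"

definition word_length :: "('a, 'b) monoid_scheme \<Rightarrow> 'a set \<Rightarrow> 'a \<Rightarrow> nat" where
  "word_length G S g = (LEAST n. \<exists>w \<in> lists (S <+> S). length w = n \<and> word_val G w = g)"

definition word_dist :: "('a, 'b) monoid_scheme \<Rightarrow> 'a set \<Rightarrow> 'a \<Rightarrow> 'a \<Rightarrow> real" where
  "word_dist G S g h = real (word_length G S (inv\<^bsub>G\<^esub> g \<otimes>\<^bsub>G\<^esub> h))"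

text \<open>
  Hyperbolicity in Gromov's sense, by the four-point condition on the group itself; up to the value
  of \<open>\<delta>\<close> this agrees with thinness of geodesic triangles in the Cayley graph.
\<close>

definition gromov_product :: "('a \<Rightarrow> 'a \<Rightarrow> real) \<Rightarrow> 'a \<Rightarrow> 'a \<Rightarrow> 'a \<Rightarrow> real" where
  "gromov_product d p x y = (d p x + d p y - d x y) / 2"

definition gromov_hyperbolic :: "'a set \<Rightarrow> ('a \<Rightarrow> 'a \<Rightarrow> real) \<Rightarrow> bool" where
  "gromov_hyperbolic X d \<longleftrightarrow> (\<exists>\<delta>\<ge>0. \<forall>p\<in>X. \<forall>x\<in>X. \<forall>y\<in>X. \<forall>z\<in>X.
     gromov_product d p x z \<ge> min (gromov_product d p x y) (gromov_product d p y z) - \<delta>)"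

definition hyperbolic_group :: "('a, 'b) monoid_scheme \<Rightarrow> bool" where
  "hyperbolic_group G \<longleftrightarrow> group G \<and>
     (\<exists>S. finite_generating_set G S \<and> gromov_hyperbolic (carrier G) (word_dist G S))"

text \<open>
  Nondeterministic automata, without empty moves. States are natural numbers so that automata can
  be the input and output of an algorithm.
\<close>

record 'l automaton =
  states :: "nat set"
  initial :: "nat set"
  accepting :: "nat set"
  transitions :: "(nat \<times> 'l \<times> nat) set"

definition finite_automaton :: "'l set \<Rightarrow> 'l automaton \<Rightarrow> bool" where
  "finite_automaton A M \<longleftrightarrow> finite (states M) \<and> initial M \<subseteq> states M \<and> accepting M \<subseteq> states M \<and>
     transitions M \<subseteq> states M \<times> A \<times> states M"

primrec run :: "'l automaton \<Rightarrow> nat \<Rightarrow> 'l list \<Rightarrow> nat \<Rightarrow> bool" where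
  "run M p [] q \<longleftrightarrow> p = q"
| "run M p (x # w) q \<longleftrightarrow> (\<exists>r. (p, x, r) \<in> transitions M \<and> run M r w q)"

definition language :: "'l automaton \<Rightarrow> 'l list set" where
  "language M = {w. \<exists>p\<in>initial M. \<exists>q\<in>accepting M. run M p w q}"

definition regular_language :: "'l set \<Rightarrow> 'l list set \<Rightarrow> bool" where
  "regular_language A L \<longleftrightarrow> (\<exists>M. finite_automaton A M \<and> language M = L)"

text \<open>The set \<open>T\<close> is the generating set that defines the word metric on the group.\<close>

definition qi_embedded :: "('a, 'b) monoid_scheme \<Rightarrow> 'a set \<Rightarrow> ('a + 'a) list set \<Rightarrow> bool" where
  "qi_embedded G T L \<longleftrightarrow> (\<exists>l m :: real. l \<ge> 1 \<and> m \<ge> 0 \<and>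
     (\<forall>w\<in>L. real (word_length G T (word_val G w)) \<ge> 1 / l * real (length w) - m))"

definition represents :: "('a, 'b) monoid_scheme \<Rightarrow> ('a + 'a) list set \<Rightarrow> 'a set \<Rightarrow> bool" where
  "represents G L R \<longleftrightarrow> word_val G ` L = R"

definition qi_embeddable_rational ::
    "('a, 'b) monoid_scheme \<Rightarrow> 'a set \<Rightarrow> 'a set \<Rightarrow> 'a set \<Rightarrow> bool" where
  "qi_embeddable_rational G S T R \<longleftrightarrow>
     (\<exists>L. regular_language (S <+> S) L \<and> qi_embedded G T L \<and> represents G L R)"

text \<open>
  Partial recursive functions, as programs with a relational semantics: \<open>computes f xs y\<close> means
  that \<open>f\<close> halts on the argument list \<open>xs\<close> with value \<open>y\<close>. Programs have no fixed arity.
\<close>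

datatype recf = Zero | Succ | Proj nat | Comp recf "recf list" | PrimRec recf recf | Mu recf

inductive computes :: "recf \<Rightarrow> nat list \<Rightarrow> nat \<Rightarrow> bool" where
  zero: "computes Zero xs 0"
| succ: "computes Succ [x] (Suc x)"
| proj: "i < length xs \<Longrightarrow> computes (Proj i) xs (xs ! i)"
| comp: "list_all2 (\<lambda>g y. computes g xs y) gs ys \<Longrightarrow> computes f ys z \<Longrightarrow> computes (Comp f gs) xs z"
| prim_0: "computes f xs y \<Longrightarrow> computes (PrimRec f g) (0 # xs) y"
| prim_Suc: "computes (PrimRec f g) (n # xs) y \<Longrightarrow> computes g (n # y # xs) z \<Longrightarrow>
    computes (PrimRec f g) (Suc n # xs) z"
| mu: "computes f (n # xs) 0 \<Longrightarrow> (\<forall>m<n. \<exists>k. computes f (m # xs) (Suc k)) \<Longrightarrow> computes (Mu f) xs n"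

inductive_cases computes_ZeroE: "computes Zero xs y"
inductive_cases computes_SuccE: "computes Succ xs y"
inductive_cases computes_ProjE: "computes (Proj i) xs y"
inductive_cases computes_CompE: "computes (Comp f gs) xs y"
inductive_cases computes_PrimRec_0E: "computes (PrimRec f g) (0 # xs) y"
inductive_cases computes_PrimRec_SucE: "computes (PrimRec f g) (Suc n # xs) y"
inductive_cases computes_MuE: "computes (Mu f) xs y"

lemma computes_deterministic: "computes f xs y \<Longrightarrow> computes f xs z \<Longrightarrow> y = z"
proof (induction arbitrary: z rule: computes.induct)
  case (zero xs)
  then show ?case by (auto elim: computes_ZeroE)
next
  case (succ x)
  then show ?case by (auto elim: computes_SuccE)
next
  case (proj i xs)
  from proj.prems show ?case by (rule computes_ProjE) simp
next
  case (comp xs gs ys f z')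
  from comp.prems obtain ys' where ys': "list_all2 (\<lambda>g y. computes g xs y) gs ys'" "computes f ys' z"
    by (rule computes_CompE)
  have "ys = ys'"
  proof (rule nth_equalityI)
    show "length ys = length ys'"
      using comp.IH(1) ys'(1) by (simp add: list_all2_conv_all_nth)
    show "ys ! i = ys' ! i" if "i < length ys" for i
    proof -
      have i: "i < length gs"
        using that comp.IH(1) by (simp add: list_all2_conv_all_nth)
      then have "\<forall>z. computes (gs ! i) xs z \<longrightarrow> ys ! i = z"
        using list_all2_nthD[OF comp.IH(1)] by blast
      then show ?thesis
        using list_all2_nthD[OF ys'(1) i] by blast
    qed
  qed
  then show ?case using comp.IH(2) ys'(2) by blast
next
  case (prim_0 f xs y g)
  from prim_0.prems show ?case by (rule computes_PrimRec_0E) (rule prim_0.IH)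
next
  case (prim_Suc f g n xs y z')
  from prim_Suc.prems obtain y' where "computes (PrimRec f g) (n # xs) y'" "computes g (n # y' # xs) z"
    by (rule computes_PrimRec_SucE)
  then show ?case using prim_Suc.IH by blast
next
  case (mu f n xs)
  from mu.prems have *: "computes f (z # xs) 0" "\<forall>m<z. \<exists>k. computes f (m # xs) (Suc k)"
    by (rule computes_MuE; blast)+
  show ?case
  proof (rule linorder_cases[of n z])
    assume "n < z"
    then obtain k where "computes f (n # xs) (Suc k)" using *(2) by blast
    then have "0 = Suc k" by (rule mu.IH(1))
    then show ?thesis by simp
  next
    assume "z < n"
    then obtain k where "\<forall>y. computes f (z # xs) y \<longrightarrow> Suc k = y" using mu.IH(2) by blast
    then have "Suc k = 0" using *(1) by blast
    then show ?thesis by simp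
  qed
qed

text \<open>
  To give an automaton over \<open>S <+> S\<close> to an algorithm, the elements of \<open>S\<close> are numbered by an
  injection \<open>c\<close>, and the automaton is written as a single number.
\<close>

definition letter_code :: "('a \<Rightarrow> nat) \<Rightarrow> 'a + 'a \<Rightarrow> nat" where
  "letter_code c x = sum_encode (map_sum c c x)"

definition automaton_code :: "('a \<Rightarrow> nat) \<Rightarrow> ('a + 'a) automaton \<Rightarrow> nat" where
  "automaton_code c M = list_encode [set_encode (states M), set_encode (initial M),
     set_encode (accepting M),
     set_encode ((\<lambda>(p, x, q). list_encode [p, letter_code c x, q]) ` transitions M)]"

lemma automaton_code_inject:
  fixes M N :: "('a + 'a) automaton"
  assumes "finite S" "inj_on c S"
    and M: "finite_automaton (S <+> S) M" and N: "finite_automaton (S <+> S) N"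
    and eq: "automaton_code c M = automaton_code c N"
  shows "M = N"
proof -
  let ?t = "\<lambda>(p, x, q). list_encode [p, letter_code c x, q]"
  have fin: "finite (states K)" "finite (initial K)" "finite (accepting K)" "finite (transitions K)"
    if K: "finite_automaton (S <+> S) K" for K :: "('a + 'a) automaton"
  proof -
    show "finite (states K)"
      using K by (simp add: finite_automaton_def)
    then have "finite (states K \<times> (S <+> S) \<times> states K)"
      using \<open>finite S\<close> by simp
    then show "finite (transitions K)"
      using K finite_subset unfolding finite_automaton_def by blast
    show "finite (initial K)" "finite (accepting K)"
      using K finite_subset unfolding finite_automaton_def by blast+
  qed
  have sub: "transitions K \<subseteq> UNIV \<times> (S <+> S) \<times> UNIV"
    if "finite_automaton (S <+> S) K" for K :: "('a + 'a) automaton"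
    using that unfolding finite_automaton_def by blast
  have "inj_on (letter_code c) (S <+> S)"
    using \<open>inj_on c S\<close> by (auto simp: letter_code_def sum_encode_eq intro!: inj_onI dest: inj_onD)
  then have inj: "inj_on ?t (UNIV \<times> (S <+> S) \<times> UNIV)"
    by (auto simp del: list_encode.simps simp: list_encode_eq intro!: inj_onI dest: inj_onD)
  have codes: "set_encode (states M) = set_encode (states N)"
    "set_encode (initial M) = set_encode (initial N)"
    "set_encode (accepting M) = set_encode (accepting N)"
    "set_encode (?t ` transitions M) = set_encode (?t ` transitions N)"
    using eq unfolding automaton_code_def list_encode_eq by blast+
  have "?t ` transitions M = ?t ` transitions N"
    using codes(4) set_encode_eq[OF finite_imageI[OF fin(4)[OF M]] finite_imageI[OF fin(4)[OF N]]]
    by (rule iffD1[rotated])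
  then have "transitions M = transitions N"
    using inj_on_image_eq_iff[OF inj sub[OF M] sub[OF N]] by blast
  moreover have "states M = states N" "initial M = initial N" "accepting M = accepting N"
    using codes(1-3) fin(1-3)[OF M] fin(1-3)[OF N] by (simp_all add: set_encode_eq)
  ultimately show ?thesis
    by simp
qed

end

theory Submission
  imports Defs "HOL-Real_Asymp.Real_Asymp"
begin

text \<open>
  In a hyperbolic group geodesic words with nearby ends fellow travel, and a quasi-geodesic word stays
  close to a geodesic one (the Morse lemma, proved here by bisecting a path with the four-point
  condition). By Cannon's argument there are finitely many cone types, so the geodesic words form a
  regular language, and reading a geodesic word \<open>v\<close> one can keep track of all pairs \<open>(q, x)\<close> with \<open>x\<close>
  in a fixed ball such that the given automaton reaches \<open>q\<close> at the element \<open>v x\<close>. If the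
  ball is large enough, this decides for geodesic words whether they represent an element of \<open>R\<close>, so the
  geodesic words representing elements outside \<open>R\<close> form a regular language.

  No bound on the radius of the ball has to be computed. That the resulting automaton is correct is witnessed by a
  finite certificate, whose validity is a decidable arithmetical relation, and an unbounded search
  finds an automaton together with a certificate. Arithmetic in the ball is replaced by rewriting of
  windows of bounded length, which is possible because fellow travelling makes the group finitely presented.
  Unions are disjoint unions of automata, and intersections follow by De Morgan.
\<close>

section \<open>Computable functions and decidable relations\<close>

text \<open>The complement program depends on the group and its generators only, while the constants
  of the quasi-isometric embedding of an input are unknown to it. So validity of a certificate has
  to imply correctness without reference to a radius. The two directions are checked differently.
  That every fact is true follows from a well-founded derivation by automaton steps and window
  rewriting. That no fact about the identity displacement is missing follows from a closure
  condition between geodesic words whose values differ by one letter, by induction over the word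
  read by the input; fellow travelling of geodesic words, whose constant belongs to the group, makes
  these pairs visible to finite data. The embedding enters only in the proof that some certificate
  exists, so that the search halts. Whatever the check consults about the group (transitions between
  cone types, products in a fixed ball, equality of short words) is a finite table, hence a constant
  of the program. As the output reads geodesic words only, its language is quasi-isometrically
  embedded whatever the input was.\<close>

definition computable :: "nat \<Rightarrow> (nat list \<Rightarrow> nat) \<Rightarrow> bool" where
  "computable k F \<longleftrightarrow> (\<exists>f. \<forall>xs. length xs = k \<longrightarrow> computes f xs (F xs))"

text \<open>Truth is the value 0 because \<open>Mu\<close> searches for a zero.\<close>

definition decidable :: "nat \<Rightarrow> (nat list \<Rightarrow> bool) \<Rightarrow> bool" where
  "decidable k P \<longleftrightarrow> computable k (\<lambda>xs. if P xs then 0 else Suc 0)"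

lemma computable_cong: "(\<And>xs. length xs = k \<Longrightarrow> F xs = G xs) \<Longrightarrow> computable k F \<Longrightarrow> computable k G"
  unfolding computable_def by metis

lemma decidable_cong: "(\<And>xs. length xs = k \<Longrightarrow> P xs = Q xs) \<Longrightarrow> decidable k P \<Longrightarrow> decidable k Q"
  unfolding decidable_def using computable_cong[of k "\<lambda>xs. if P xs then 0 else Suc 0" "\<lambda>xs. if Q xs then 0 else Suc 0"] by auto

lemma computable_nth: "i < k \<Longrightarrow> computable k (\<lambda>xs. xs ! i)"
  unfolding computable_def using computes.proj by blast

lemma computable_hd: "computable (Suc k) hd"
  using computable_nth[of 0 "Suc k"] by (rule computable_cong[rotated]) (simp, metis hd_conv_nth length_0_conv nat.distinct(1))

lemma computable_const: "computable k (\<lambda>xs. n)"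
proof (induction n)
  case 0
  then show ?case unfolding computable_def using computes.zero by blast
next
  case (Suc n)
  then obtain f where "\<forall>xs. length xs = k \<longrightarrow> computes f xs n" unfolding computable_def by blast
  then have "\<forall>xs. length xs = k \<longrightarrow> computes (Comp Succ [f]) xs (Suc n)"
    by (auto intro!: computes.comp[of _ _ "[n]"] computes.succ)
  then show ?case unfolding computable_def by blast
qed

lemma list_all2_choice:
  "(\<forall>F\<in>set Fs. computable k F) \<Longrightarrow> \<exists>fs. \<forall>xs. length xs = k \<longrightarrow> list_all2 (\<lambda>g y. computes g xs y) fs (map (\<lambda>F. F xs) Fs)"
proof (induction Fs)
  case Nil
  then show ?case by (auto intro: exI[of _ "[]"])
next
  case (Cons F Fs)
  then obtain fs f where "\<forall>xs. length xs = k \<longrightarrow> list_all2 (\<lambda>g y. computes g xs y) fs (map (\<lambda>F. F xs) Fs)"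
    "\<forall>xs. length xs = k \<longrightarrow> computes f xs (F xs)"
    unfolding computable_def by auto
  then show ?case by (intro exI[of _ "f # fs"]) auto
qed

lemma computable_comp:
  assumes "computable (length Fs) H" "\<forall>F\<in>set Fs. computable k F"
  shows "computable k (\<lambda>xs. H (map (\<lambda>F. F xs) Fs))"
proof -
  obtain h where h: "\<forall>xs. length xs = length Fs \<longrightarrow> computes h xs (H xs)"
    using assms(1) unfolding computable_def by blast
  obtain fs where fs: "\<forall>xs. length xs = k \<longrightarrow> list_all2 (\<lambda>g y. computes g xs y) fs (map (\<lambda>F. F xs) Fs)"
    using list_all2_choice[OF assms(2)] by blast
  have "computes (Comp h fs) xs (H (map (\<lambda>F. F xs) Fs))" if "length xs = k" for xs
    using that h fs by (intro computes.comp[of _ _ "map (\<lambda>F. F xs) Fs"]) auto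
  then show ?thesis unfolding computable_def by blast
qed

lemma computable_comp1: "computable 1 (\<lambda>xs. H (xs ! 0)) \<Longrightarrow> computable k F \<Longrightarrow> computable k (\<lambda>xs. H (F xs))"
  using computable_comp[of "[F]" "\<lambda>xs. H (xs ! 0)" k] by simp

lemma map_nth_shift: "length ys = Suc k \<Longrightarrow> map (\<lambda>F. F ys) (map (\<lambda>i ys. ys ! Suc i) [0..<k]) = tl ys"
  by (intro nth_equalityI) (auto simp: nth_tl)

text \<open>A program cannot discard an argument by itself; it is composed with the projections to
  the remaining ones. Bound variables are always pushed in front of the argument list, so this shift
  occurs under every quantifier.\<close>

lemma computable_tl:
  assumes "computable k F"
  shows "computable (Suc k) (\<lambda>ys. F (tl ys))"
proof -
  have "computable (Suc k) (\<lambda>ys. F (map (\<lambda>F. F ys) (map (\<lambda>i ys. ys ! Suc i) [0..<k])))"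
    using assms by (intro computable_comp) (auto intro: computable_nth)
  then show ?thesis
    by (rule computable_cong[rotated]) (metis map_nth_shift)
qed

lemma computable_Cons:
  assumes "computable (Suc k) F" "computable k G"
  shows "computable k (\<lambda>xs. F (G xs # xs))"
proof -
  have "computable k (\<lambda>xs. F (map (\<lambda>F. F xs) (G # map (\<lambda>i xs. xs ! i) [0..<k])))"
    using assms by (intro computable_comp) (auto intro: computable_nth)
  moreover have "map (\<lambda>F. F xs) (G # map (\<lambda>i xs. xs ! i) [0..<k]) = G xs # xs" if "length xs = k" for xs
    using that by (auto intro: nth_equalityI)
  ultimately show ?thesis
    by (auto intro: computable_cong[rotated])
qed

lemma computable_Suc:
  assumes "computable k F"
  shows "computable k (\<lambda>xs. Suc (F xs))"
proof (rule computable_comp1[OF _ assms])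
  have "computes Succ xs (Suc (xs ! 0))" if "length xs = 1" for xs
    using that computes.succ by (cases xs) auto
  then show "computable 1 (\<lambda>xs. Suc (xs ! 0))" unfolding computable_def by blast
qed

lemma computable_prim_rec:
  assumes "computable k F" "computable (Suc (Suc k)) (\<lambda>ys. H (hd ys) (hd (tl ys)) (tl (tl ys)))" "computable k N"
  shows "computable k (\<lambda>xs. rec_nat (F xs) (\<lambda>n y. H n y xs) (N xs))"
proof -
  obtain f where f: "\<forall>xs. length xs = k \<longrightarrow> computes f xs (F xs)"
    using assms(1) unfolding computable_def by blast
  obtain h where h: "\<forall>xs. length xs = Suc (Suc k) \<longrightarrow> computes h xs (H (hd xs) (hd (tl xs)) (tl (tl xs)))"
    using assms(2) unfolding computable_def by blast
  have "computes (PrimRec f h) (n # xs) (rec_nat (F xs) (\<lambda>n y. H n y xs) n)" if xs: "length xs = k" for xs n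
  proof (induction n)
    case 0
    then show ?case using f xs by (auto intro: computes.prim_0)
  next
    case (Suc n)
    have "computes h (n # rec_nat (F xs) (\<lambda>n y. H n y xs) n # xs) (H n (rec_nat (F xs) (\<lambda>n y. H n y xs) n) xs)"
      using h[rule_format, of "n # rec_nat (F xs) (\<lambda>n y. H n y xs) n # xs"] xs by simp
    then show ?case using Suc computes.prim_Suc by fastforce
  qed
  then have "computable (Suc k) (\<lambda>ys. rec_nat (F (tl ys)) (\<lambda>n y. H n y (tl ys)) (hd ys))"
    unfolding computable_def by (intro exI[of _ "PrimRec f h"]) (auto simp: length_Suc_conv)
  from computable_Cons[OF this assms(3)] show ?thesis by simp
qed

lemma computable_add: "computable k F \<Longrightarrow> computable k G \<Longrightarrow> computable k (\<lambda>xs. F xs + G xs)"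
proof -
  have eq: "rec_nat a (\<lambda>n y. Suc y) b = a + b" for a b :: nat
    by (induction b) auto
  assume "computable k F" "computable k G"
  then have "computable k (\<lambda>xs. rec_nat (F xs) (\<lambda>n y. Suc y) (G xs))"
    by (intro computable_prim_rec[where H = "\<lambda>n y xs. Suc y"] computable_Suc computable_tl[OF computable_hd])
  then show ?thesis unfolding eq .
qed

lemma computable_mult: "computable k F \<Longrightarrow> computable k G \<Longrightarrow> computable k (\<lambda>xs. F xs * G xs)"
proof -
  have eq: "rec_nat 0 (\<lambda>n y. y + a) b = a * b" for a b :: nat
    by (induction b) auto
  assume "computable k F" "computable k G"
  then have "computable k (\<lambda>xs. rec_nat 0 (\<lambda>n y. y + F xs) (G xs))"
    by (intro computable_prim_rec[where H = "\<lambda>n y xs. y + F xs"] computable_add computable_const computable_tl[OF computable_hd] computable_tl[OF computable_tl])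
  then show ?thesis unfolding eq .
qed

lemma computable_power: "computable k F \<Longrightarrow> computable k G \<Longrightarrow> computable k (\<lambda>xs. F xs ^ G xs)"
proof -
  have eq: "rec_nat 1 (\<lambda>n y. y * a) b = a ^ b" for a b :: nat
    by (induction b) (auto simp: mult.commute)
  assume "computable k F" "computable k G"
  then have "computable k (\<lambda>xs. rec_nat 1 (\<lambda>n y. y * F xs) (G xs))"
    by (intro computable_prim_rec[where H = "\<lambda>n y xs. y * F xs"] computable_mult computable_const computable_tl[OF computable_hd] computable_tl[OF computable_tl])
  then show ?thesis unfolding eq .
qed

lemma computable_triangle: "computable k F \<Longrightarrow> computable k (\<lambda>xs. triangle (F xs))"
proof -
  have eq: "rec_nat 0 (\<lambda>n y. y + Suc n) b = triangle b" for b :: nat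
    by (induction b) auto
  assume "computable k F"
  then have "computable k (\<lambda>xs. rec_nat 0 (\<lambda>n y. y + Suc n) (F xs))"
    by (intro computable_prim_rec[where H = "\<lambda>n y xs. y + Suc n"] computable_add computable_Suc computable_const computable_hd computable_tl[OF computable_hd])
  then show ?thesis unfolding eq .
qed

lemma computable_prod_encode: "computable k F \<Longrightarrow> computable k G \<Longrightarrow> computable k (\<lambda>xs. prod_encode (F xs, G xs))"
  unfolding prod_encode_def by (simp add: computable_add computable_triangle)

lemma computable_list_encode_Nil: "computable k (\<lambda>xs. list_encode [])"
  by (rule computable_const)

lemma computable_list_encode_Cons: "computable k F \<Longrightarrow> computable k (\<lambda>xs. list_encode (L xs)) \<Longrightarrow> computable k (\<lambda>xs. list_encode (F xs # L xs))"
  by (simp add: computable_Suc computable_prod_encode)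

lemmas computable_intros = computable_const computable_Suc computable_add computable_mult computable_power computable_list_encode_Nil computable_list_encode_Cons
  computable_prod_encode computable_hd computable_tl computable_nth

lemma computable_if_zero:
  assumes "computable k F" "computable k G" "computable k H"
  shows "computable k (\<lambda>xs. if F xs = 0 then G xs else H xs)"
proof -
  have "computable k (\<lambda>xs. rec_nat (G xs) (\<lambda>n y. H xs) (F xs))"
    using assms(1,2) computable_tl[OF computable_tl[OF assms(3)]] by (intro computable_prim_rec[where H = "\<lambda>n y xs. H xs"])
  moreover have "rec_nat a (\<lambda>n y. b) c = (if c = 0 then a else b)" for a b c :: nat
    by (cases c) auto
  ultimately show ?thesis by simp
qed

lemma decidable_if: "decidable k P \<Longrightarrow> computable k F \<Longrightarrow> computable k G \<Longrightarrow> computable k (\<lambda>xs. if P xs then F xs else G xs)"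
proof -
  have eq: "(if (if p then 0 else Suc 0) = 0 then a else b) = (if p then a else b)" for p and a b :: nat
    by simp
  assume "decidable k P" "computable k F" "computable k G"
  then show ?thesis
    using computable_if_zero[of k "\<lambda>xs. if P xs then 0 else Suc 0" F G] unfolding decidable_def eq by simp
qed

lemma if_not: "(if \<not> p then a else b) = (if p then b else a)"
  by simp

lemma decidable_not: "decidable k P \<Longrightarrow> decidable k (\<lambda>xs. \<not> P xs)"
  using decidable_if[of k P, OF _ computable_const[of k "Suc 0"] computable_const[of k 0]]
  unfolding decidable_def by (simp only: if_not)

lemma decidable_conj:
  assumes "decidable k P" "decidable k Q"
  shows "decidable k (\<lambda>xs. P xs \<and> Q xs)"
proof -
  have "computable k (\<lambda>xs. if P xs then if Q xs then 0 else Suc 0 else Suc 0)"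
    using assms(2) unfolding decidable_def by (rule decidable_if[OF assms(1) _ computable_const])
  then show ?thesis
    unfolding decidable_def by (rule computable_cong[rotated]) simp
qed

lemma decidable_disj:
  assumes "decidable k P" "decidable k Q"
  shows "decidable k (\<lambda>xs. P xs \<or> Q xs)"
  using decidable_not[OF decidable_conj[OF decidable_not[OF assms(1)] decidable_not[OF assms(2)]]]
  by (rule decidable_cong[rotated]) simp

lemma decidable_imp:
  assumes "decidable k P" "decidable k Q"
  shows "decidable k (\<lambda>xs. P xs \<longrightarrow> Q xs)"
  using decidable_disj[OF decidable_not[OF assms(1)] assms(2)] by (rule decidable_cong[rotated]) simp

lemma decidable_iff:
  assumes "decidable k P" "decidable k Q"
  shows "decidable k (\<lambda>xs. P xs \<longleftrightarrow> Q xs)"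
  using decidable_conj[OF decidable_imp[OF assms] decidable_imp[OF assms(2,1)]] by (rule decidable_cong[rotated]) blast

text \<open>Primitive recursion over the bound: the accumulated value drops to 0 at the first true
  instance and stays there.\<close>

lemma decidable_ex:
  assumes "decidable (Suc k) (\<lambda>ys. P (hd ys) (tl ys))" "computable k N"
  shows "decidable k (\<lambda>xs. \<exists>y<N xs. P y xs)"
proof -
  have eq: "rec_nat (Suc 0) (\<lambda>n b. if Q n then 0 else b) N = (if \<exists>y<N. Q y then 0 else Suc 0)" for Q and N :: nat
    by (induction N) (auto simp: less_Suc_eq)
  have "computable k (\<lambda>xs. rec_nat (Suc 0) (\<lambda>n b. if P n xs then 0 else b) (N xs))"
  proof (rule computable_prim_rec[where H = "\<lambda>n b xs. if P n xs then 0 else b"])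
    obtain f where f: "\<forall>xs. length xs = Suc k \<longrightarrow> computes f xs (if P (hd xs) (tl xs) then 0 else Suc 0)"
      using assms(1) unfolding decidable_def computable_def by blast
    \<comment> \<open>Inside the recursion the list consists of the counter, the accumulated value
      and the parameters; \<open>P\<close> has to skip the second entry.\<close>
    have "computable (Suc (Suc k)) (\<lambda>ys. (\<lambda>zs. if P (hd zs) (tl zs) then 0 else Suc 0)
      (map (\<lambda>F. F ys) (hd # map (\<lambda>i ys. ys ! (Suc (Suc i))) [0..<k])))"
      using assms(1) unfolding decidable_def by (intro computable_comp) (auto intro: computable_nth computable_hd)
    moreover have "map (\<lambda>F. F ys) (map (\<lambda>i ys. ys ! Suc (Suc i)) [0..<k]) = tl (tl ys)"
      if "length ys = Suc (Suc k)" for ys :: "nat list"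
      using that by (intro nth_equalityI) (auto simp: nth_tl)
    ultimately have "decidable (Suc (Suc k)) (\<lambda>ys. P (hd ys) (tl (tl ys)))"
      unfolding decidable_def by (auto elim!: computable_cong[rotated])
    then show "computable (Suc (Suc k)) (\<lambda>ys. if P (hd ys) (tl (tl ys)) then 0 else hd (tl ys))"
      by (intro decidable_if computable_const computable_tl computable_hd)
  qed (auto intro: computable_const assms)
  then show ?thesis unfolding decidable_def eq .
qed

lemma decidable_all:
  assumes "decidable (Suc k) (\<lambda>ys. P (hd ys) (tl ys))" "computable k N"
  shows "decidable k (\<lambda>xs. \<forall>y<N xs. P y xs)"
  using decidable_not[OF decidable_ex[OF decidable_not[OF assms(1)] assms(2)]] by simp

text \<open>Truncated subtraction is iterated predecessor, and the predecessor is the recursion that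
  returns its own counter.\<close>

lemma decidable_le: "computable k F \<Longrightarrow> computable k G \<Longrightarrow> decidable k (\<lambda>xs. F xs \<le> G xs)"
proof -
  assume "computable k F" "computable k G"
  moreover have "rec_nat a (\<lambda>n y. rec_nat 0 (\<lambda>m z. m) y) b = a - b" for a b
  proof (induction b)
    case (Suc b)
    moreover have "rec_nat 0 (\<lambda>m z. m) c = c - 1" for c by (cases c) auto
    ultimately show ?case by simp
  qed simp
  moreover have "computable (Suc (Suc k)) (\<lambda>ys. rec_nat 0 (\<lambda>m z. m) (hd (tl ys)))"
    using computable_prim_rec[where H = "\<lambda>m z xs. m", OF computable_const computable_hd computable_tl[OF computable_hd], of k 0] by simp
  ultimately have "computable k (\<lambda>xs. F xs - G xs)"
    using computable_prim_rec[where H = "\<lambda>n y xs. rec_nat 0 (\<lambda>m z. m) y" and F = F and N = G and k = k] by simp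
  from computable_if_zero[OF this computable_const[of k 0] computable_const[of k "Suc 0"]] show ?thesis
    unfolding decidable_def by simp
qed

lemma decidable_eq: "computable k F \<Longrightarrow> computable k G \<Longrightarrow> decidable k (\<lambda>xs. F xs = G xs)"
  using decidable_conj[OF decidable_le decidable_le, of k F G G F] by (auto simp: order_eq_iff)

lemma decidable_less: "computable k F \<Longrightarrow> computable k G \<Longrightarrow> decidable k (\<lambda>xs. F xs < G xs)"
  using decidable_not[OF decidable_le, of k G F] by (simp add: not_le)

text \<open>Division is not among the operations shown computable, so the test of bit
  \<open>x\<close> is phrased as a splitting of \<open>n\<close> into higher bits, the bit itself
  and a remainder, with bounded quantifiers only.\<close>

lemma set_decode_iff: "x \<in> set_decode n \<longleftrightarrow> (\<exists>q<Suc n. \<exists>r<2 ^ x. n = q * 2 ^ Suc x + 2 ^ x + r)"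
proof
  assume "x \<in> set_decode n"
  then have "odd (n div 2 ^ x)" by (simp add: set_decode_def)
  then have "n = (n div 2 ^ x div 2) * 2 ^ Suc x + 2 ^ x + n mod 2 ^ x"
  proof -
    have "n = (n div 2 ^ x) * 2 ^ x + n mod 2 ^ x" by (rule div_mult_mod_eq[symmetric])
    also have "n div 2 ^ x = 2 * (n div 2 ^ x div 2) + 1"
      using \<open>odd (n div 2 ^ x)\<close> by (rule odd_two_times_div_two_succ[symmetric])
    finally show ?thesis by (simp add: algebra_simps)
  qed
  moreover have "n div 2 ^ x div 2 < Suc n"
    by (meson div_le_dividend le_imp_less_Suc le_trans)
  ultimately show "\<exists>q<Suc n. \<exists>r<2 ^ x. n = q * 2 ^ Suc x + 2 ^ x + r"
    by (intro exI[of _ "n div 2 ^ x div 2"] conjI exI[of _ "n mod 2 ^ x"]) auto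
next
  assume "\<exists>q<Suc n. \<exists>r<2 ^ x. n = q * 2 ^ Suc x + 2 ^ x + r"
  then obtain q r where "r < 2 ^ x" "n = (2 * q + 1) * 2 ^ x + r"
    by (auto simp: algebra_simps)
  then have "n div 2 ^ x = 2 * q + 1" by (simp del: mult_Suc add: div_mult_self3)
  then show "x \<in> set_decode n" by (simp add: set_decode_def)
qed

lemma decidable_mem: "computable k F \<Longrightarrow> computable k G \<Longrightarrow> decidable k (\<lambda>xs. F xs \<in> set_decode (G xs))"
  unfolding set_decode_iff
  by (intro decidable_ex decidable_eq computable_add computable_mult computable_power computable_Suc computable_const)
    (rule computable_tl computable_hd | assumption)+

lemma set_decode_less: "x \<in> set_decode n \<Longrightarrow> x < n"
proof -
  assume "x \<in> set_decode n"
  then have "2 ^ x \<le> n" unfolding set_decode_iff by auto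
  then show ?thesis using less_exp[of x] by linarith
qed

text \<open>Search: the witness \<open>c\<close> is found together with the output \<open>n\<close>, and then forgotten.\<close>

lemma computable_search:
  assumes "decidable (Suc (Suc k)) (\<lambda>ys. P (hd ys) (hd (tl ys)) (tl (tl ys)))"
  shows "\<exists>h. \<forall>xs. length xs = k \<longrightarrow> (\<exists>n c. P n c xs) \<longrightarrow> (\<exists>n. computes h xs n \<and> (\<exists>c. P n c xs))"
proof -
  \<comment> \<open>\<open>Mu\<close> finds a single number, so output and witness are searched as
    one pair. Both components are at most the code of the pair, which bounds the
    quantifiers.\<close>
  let ?Q = "\<lambda>w xs. \<exists>n<Suc w. \<exists>c<Suc w. w = prod_encode (n, c) \<and> P n c xs"
  \<comment> \<open>The graph of the first projection; a second minimisation extracts the output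
    from the pair.\<close>
  let ?R = "\<lambda>n w. \<exists>c<Suc w. w = prod_encode (n, c)"
  have Q: "?Q w xs \<longleftrightarrow> (case prod_decode w of (n, c) \<Rightarrow> P n c xs)" for w xs
  proof -
    obtain n c where w: "w = prod_encode (n, c)" by (metis prod_decode_inverse surj_pair)
    then show ?thesis using le_prod_encode_1[of n c] le_prod_encode_2[of c n] by (auto simp: less_Suc_eq_le)
  qed
  have R: "?R n w \<longleftrightarrow> n = fst (prod_decode w)" for n w
  proof -
    obtain n' c where w: "w = prod_encode (n', c)" by (metis prod_decode_inverse surj_pair)
    then show ?thesis using le_prod_encode_2[of c n'] by (auto simp: less_Suc_eq_le)
  qed
  \<comment> \<open>The quantifier over \<open>c\<close> is the inner one, so \<open>c\<close>
    precedes \<open>n\<close> in the argument list.\<close>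
  have swap: "decidable (Suc (Suc (Suc k))) (\<lambda>ys. P (hd (tl ys)) (hd ys) (tl (tl (tl ys))))"
  proof -
    have "computable (Suc (Suc (Suc k))) (\<lambda>ys. (\<lambda>zs. if P (hd zs) (hd (tl zs)) (tl (tl zs)) then 0 else Suc 0)
      (map (\<lambda>F. F ys) ((\<lambda>ys. ys ! 1) # (\<lambda>ys. ys ! 0) # map (\<lambda>i ys. ys ! (Suc (Suc (Suc i)))) [0..<k])))"
      using assms unfolding decidable_def by (intro computable_comp) (auto intro!: computable_nth)
    moreover have "map (\<lambda>F. F ys) (map (\<lambda>i ys. ys ! Suc (Suc (Suc i))) [0..<k]) = tl (tl (tl ys))"
      if "length ys = Suc (Suc (Suc k))" for ys :: "nat list"
      using that by (intro nth_equalityI) (auto simp: nth_tl)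
    ultimately show ?thesis
      unfolding decidable_def by (elim computable_cong[rotated]) (auto simp: length_Suc_conv)
  qed
  have "decidable (Suc k) (\<lambda>ys. ?Q (hd ys) (tl ys))"
    by (intro decidable_ex decidable_conj decidable_eq computable_prod_encode computable_Suc swap) (rule computable_hd computable_tl)+
  then obtain f where f: "\<And>ys. length ys = Suc k \<Longrightarrow> computes f ys (if ?Q (hd ys) (tl ys) then 0 else Suc 0)"
    unfolding decidable_def computable_def by blast
  have "decidable 2 (\<lambda>ys. ?R (ys ! 0) (ys ! 1))"
    unfolding numeral_2_eq_2 by (intro decidable_ex decidable_eq computable_prod_encode computable_Suc) (rule computable_hd computable_tl computable_nth | simp)+
  then obtain g where g: "\<And>ys. length ys = 2 \<Longrightarrow> computes g ys (if ?R (ys ! 0) (ys ! 1) then 0 else Suc 0)"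
    unfolding decidable_def computable_def by blast
  have Mug: "computes (Mu g) [w] (fst (prod_decode w))" for w
  proof (rule computes.mu)
    show "computes g [fst (prod_decode w), w] 0"
      using g[of "[fst (prod_decode w), w]"] unfolding nth_Cons_0 One_nat_def nth_Cons_Suc R by simp
    show "\<forall>m<fst (prod_decode w). \<exists>k. computes g [m, w] (Suc k)"
    proof (intro allI impI)
      fix m assume "m < fst (prod_decode w)"
      then have "computes g [m, w] (Suc 0)" using g[of "[m, w]"]
        unfolding nth_Cons_0 One_nat_def nth_Cons_Suc R by simp
      then show "\<exists>k. computes g [m, w] (Suc k)" ..
    qed
  qed
  have "\<exists>n. computes (Comp (Mu g) [Mu f]) xs n \<and> (\<exists>c. P n c xs)"
    if xs: "length xs = k" and ex: "\<exists>n c. P n c xs" for xs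
  proof -
    define w where "w = (LEAST w. ?Q w xs)"
    obtain n c where "P n c xs" using ex by blast
    then have "?Q (prod_encode (n, c)) xs" unfolding Q by simp
    then have w: "?Q w xs" unfolding w_def by (rule LeastI)
    have nw: "\<not> ?Q m xs" if "m < w" for m using that unfolding w_def by (rule not_less_Least)
    have "computes (Mu f) xs w"
    proof (rule computes.mu)
      have fw: "computes f (m # xs) (if ?Q m xs then 0 else Suc 0)" for m
        using f[of "m # xs"] unfolding list.sel length_Cons xs by blast
      show "computes f (w # xs) 0" using fw[of w] unfolding if_P[OF w] .
      show "\<forall>m<w. \<exists>k. computes f (m # xs) (Suc k)"
      proof (intro allI impI)
        fix m assume "m < w"
        then have "computes f (m # xs) (Suc 0)" using fw[of m] unfolding if_not_P[OF nw[OF \<open>m < w\<close>]] by blast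
        then show "\<exists>k. computes f (m # xs) (Suc k)" ..
      qed
    qed
    then have "computes (Comp (Mu g) [Mu f]) xs (fst (prod_decode w))"
      by (intro computes.comp[of _ _ "[w]"] Mug) simp
    moreover have "\<exists>c. P (fst (prod_decode w)) c xs"
      using w unfolding Q by (auto split: prod.splits)
    ultimately show ?thesis by blast
  qed
  then show ?thesis by blast
qed

section \<open>Finite relations as numbers\<close>

definition set3 :: "nat \<Rightarrow> (nat \<times> nat \<times> nat) set" where
  "set3 n = {(x, y, z). list_encode [x, y, z] \<in> set_decode n}"

definition set4 :: "nat \<Rightarrow> (nat \<times> nat \<times> nat \<times> nat) set" where
  "set4 n = {(x, y, z, u). list_encode [x, y, z, u] \<in> set_decode n}"

lemma decidable_set3:
  "computable k F \<Longrightarrow> computable k G \<Longrightarrow> computable k H \<Longrightarrow> computable k N \<Longrightarrow> decidable k (\<lambda>xs. (F xs, G xs, H xs) \<in> set3 (N xs))"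
  unfolding set3_def mem_Collect_eq prod.case
  by (intro decidable_mem computable_list_encode_Cons computable_list_encode_Nil)

lemma decidable_set4:
  "computable k F \<Longrightarrow> computable k G \<Longrightarrow> computable k H \<Longrightarrow> computable k I \<Longrightarrow> computable k N \<Longrightarrow>
    decidable k (\<lambda>xs. (F xs, G xs, H xs, I xs) \<in> set4 (N xs))"
  unfolding set4_def mem_Collect_eq prod.case
  by (intro decidable_mem computable_list_encode_Cons computable_list_encode_Nil)

lemma list_encode_ge: "x \<in> set xs \<Longrightarrow> x < list_encode xs"
proof (induction xs)
  case (Cons y ys)
  then show ?case
    using le_prod_encode_1[of y "list_encode ys"] le_prod_encode_2[of "list_encode ys" y]
    by (auto simp: less_Suc_eq_le)
qed simp

lemma set3_less: "(x, y, z) \<in> set3 n \<Longrightarrow> x < n \<and> y < n \<and> z < n"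
  using list_encode_ge[of _ "[x, y, z]"] set_decode_less[of "list_encode [x, y, z]" n]
  by (fastforce simp: set3_def simp del: list_encode.simps)

lemma set4_less: "(x, y, z, u) \<in> set4 n \<Longrightarrow> x < n \<and> y < n \<and> z < n \<and> u < n"
  using list_encode_ge[of _ "[x, y, z, u]"] set_decode_less[of "list_encode [x, y, z, u]" n]
  by (fastforce simp: set4_def simp del: list_encode.simps)

text \<open>The second part excludes members of the coded set that are not triples.
  \<open>set3\<close> ignores these, but they would spoil the equation between a number and the code
  of an automaton.\<close>

lemma set3_surj:
  assumes "finite A"
  shows "\<exists>n. set3 n = A \<and> (\<forall>w\<in>set_decode n. \<exists>x y z. w = list_encode [x, y, z])"
proof (intro exI conjI)
  let ?f = "\<lambda>(x, y, z). list_encode [x, y, z]"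
  have fin: "finite (?f ` A)" using assms by simp
  have inj: "inj ?f" by (auto intro!: injI simp: list_encode_eq simp del: list_encode.simps)
  show "set3 (set_encode (?f ` A)) = A"
    unfolding set3_def set_encode_inverse[OF fin] using inj_image_mem_iff[OF inj, of _ A] by fastforce
  show "\<forall>w\<in>set_decode (set_encode (?f ` A)). \<exists>x y z. w = list_encode [x, y, z]"
    unfolding set_encode_inverse[OF fin] by auto
qed

lemma set4_surj:
  assumes "finite A"
  shows "\<exists>n. set4 n = A"
proof (intro exI)
  let ?f = "\<lambda>(x, y, z, u). list_encode [x, y, z, u]"
  have fin: "finite (?f ` A)" using assms by simp
  have inj: "inj ?f" by (auto intro!: injI simp: list_encode_eq simp del: list_encode.simps)
  show "set4 (set_encode (?f ` A)) = A"
    unfolding set4_def set_encode_inverse[OF fin] using inj_image_mem_iff[OF inj, of _ A] by fastforce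
qed

text \<open>The code of a fixed finite set is a constant of the program, whether or not the set can
  be computed from the group. The tables of the group enter the decision procedure in this
  way.\<close>

lemma decidable_finite3:
  assumes "finite A" "computable k F" "computable k G" "computable k H"
  shows "decidable k (\<lambda>xs. (F xs, G xs, H xs) \<in> A)"
  using set3_surj[OF assms(1)] decidable_set3[OF assms(2-4) computable_const] by metis

lemma decidable_finite2:
  assumes "finite A" "computable k F" "computable k G"
  shows "decidable k (\<lambda>xs. (F xs, G xs) \<in> A)"
proof -
  have "finite ((\<lambda>(x, y). (0::nat, x, y)) ` A)" using assms(1) by simp
  from decidable_finite3[OF this computable_const assms(2,3), of 0] show ?thesis
    by (rule decidable_cong[rotated]) (auto simp: image_iff)
qed

lemma decidable_finite1:
  assumes "finite A" "computable k F"
  shows "decidable k (\<lambda>xs. F xs \<in> A)"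
  using decidable_mem[OF assms(2) computable_const[of k "set_encode A"]] set_encode_inverse[OF assms(1)] by simp

section \<open>Quasi-geodesics in hyperbolic spaces\<close>

text \<open>The four-point condition survives enlarging \<delta>, and \<delta> \<ge> 1 lets
  multiples of \<delta> dominate natural numbers in the logarithmic estimate.\<close>

locale hyperbolic_space =
  fixes X :: "'a set" and d :: "'a \<Rightarrow> 'a \<Rightarrow> real" and \<delta> :: real
  assumes dist_refl: "x \<in> X \<Longrightarrow> d x x = 0"
    and dist_nonneg: "x \<in> X \<Longrightarrow> y \<in> X \<Longrightarrow> 0 \<le> d x y"
    and dist_sym: "x \<in> X \<Longrightarrow> y \<in> X \<Longrightarrow> d x y = d y x"
    and dist_triangle: "x \<in> X \<Longrightarrow> y \<in> X \<Longrightarrow> z \<in> X \<Longrightarrow> d x z \<le> d x y + d y z"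
    and delta_ge_1: "1 \<le> \<delta>"
    and four_point: "p \<in> X \<Longrightarrow> x \<in> X \<Longrightarrow> y \<in> X \<Longrightarrow> z \<in> X \<Longrightarrow>
      min (gromov_product d p x y) (gromov_product d p y z) - \<delta> \<le> gromov_product d p x z"
begin

definition geodesic :: "(nat \<Rightarrow> 'a) \<Rightarrow> nat \<Rightarrow> bool" where
  "geodesic \<gamma> n \<longleftrightarrow> (\<forall>i\<le>n. \<gamma> i \<in> X) \<and> (\<forall>i\<le>n. \<forall>j\<le>n. d (\<gamma> i) (\<gamma> j) = \<bar>real i - real j\<bar>)"

definition quasi :: "real \<Rightarrow> real \<Rightarrow> (nat \<Rightarrow> 'a) \<Rightarrow> nat \<Rightarrow> bool" where
  "quasi l \<mu> w m \<longleftrightarrow> (\<forall>i\<le>m. w i \<in> X) \<and> (\<forall>i<m. d (w i) (w (Suc i)) \<le> l) \<and>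
     (\<forall>i\<le>m. \<forall>j\<le>m. \<bar>real i - real j\<bar> \<le> l * d (w i) (w j) + \<mu>)"

text \<open>Each cut of the chain into two costs one \<delta>, and \<open>k\<close> nested cuts
  suffice for up to \<open>2 ^ k\<close> links. This logarithmic loss is what drives the Morse
  lemma.\<close>

lemma gromov_product_chain:
  assumes "p \<in> X" "\<forall>i\<le>N. y i \<in> X" "0 < N" "N \<le> 2 ^ k"
    and "\<forall>i<N. D \<le> gromov_product d p (y i) (y (Suc i))"
  shows "D - real k * \<delta> \<le> gromov_product d p (y 0) (y N)"
  using assms
proof (induction k arbitrary: y N)
  case 0
  then have "N = 1" by simp
  with 0 show ?case by simp
next
  case (Suc k)
  show ?case
  proof (cases "N \<le> 2 ^ k")
    case True
    then have "D - real k * \<delta> \<le> gromov_product d p (y 0) (y N)"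
      using Suc by blast
    then show ?thesis using delta_ge_1 by (simp add: algebra_simps)
  next
    case False
    \<comment> \<open>Cutting at a power of two makes both pieces meet the bound for
      \<open>k\<close>.\<close>
    define h where "h = (2::nat) ^ k"
    have h: "0 < h" "h < N" "N - h \<le> 2 ^ k" "h \<le> 2 ^ k"
      using False Suc.prems(4) by (auto simp: h_def)
    have 1: "D - real k * \<delta> \<le> gromov_product d p (y 0) (y h)"
      using Suc.prems h by (intro Suc.IH) auto
    have "D - real k * \<delta> \<le> gromov_product d p (y (0 + h)) (y (N - h + h))"
      using Suc.prems h by (intro Suc.IH[where y = "\<lambda>i. y (i + h)"]) auto
    then have 2: "D - real k * \<delta> \<le> gromov_product d p (y h) (y N)"
      using h by simp
    have "min (gromov_product d p (y 0) (y h)) (gromov_product d p (y h) (y N)) - \<delta>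
      \<le> gromov_product d p (y 0) (y N)"
      using Suc.prems h by (intro four_point) auto
    with 1 2 show ?thesis by (simp add: algebra_simps)
  qed
qed

text \<open>Consecutive points at distance at most \<open>l\<close> from each other and at least
  \<open>D\<close> from \<open>p\<close> have Gromov product at least \<open>D - l / 2\<close>; the
  chain estimate does the rest.\<close>

lemma quasi_gromov_product:
  assumes w: "quasi l \<mu> w m" and p: "p \<in> X" "\<forall>j\<le>m. D \<le> d p (w j)"
    and "i \<le> m" "j \<le> m" "\<bar>real i - real j\<bar> \<le> 2 ^ k" "0 \<le> l"
  shows "D - l / 2 - real k * \<delta> \<le> gromov_product d p (w i) (w j)"
proof -
  have *: "D - l / 2 - real k * \<delta> \<le> gromov_product d p (w i) (w j)"
    if "i \<le> j" "j \<le> m" "real j - real i \<le> 2 ^ k" for i j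
  proof (cases "i = j")
    case True
    have "D \<le> d p (w j)" "0 \<le> real k * \<delta>" "d (w j) (w j) = 0"
      using that p w delta_ge_1 dist_refl[of "w j"] by (auto simp: quasi_def)
    then show ?thesis
      using True \<open>0 \<le> l\<close> by (simp add: gromov_product_def)
  next
    case False
    have "D - l / 2 - real k * \<delta> \<le> gromov_product d p (w (0 + i)) (w (j - i + i))"
    proof (rule gromov_product_chain[where y = "\<lambda>t. w (t + i)"])
      have "real (j - i) \<le> real (2 ^ k)" using that by (simp add: of_nat_diff)
      then show "j - i \<le> 2 ^ k" by (simp only: of_nat_le_iff)
      show "\<forall>t<j - i. D - l / 2 \<le> gromov_product d p (w (t + i)) (w (Suc t + i))"
      proof (intro allI impI)
        fix t assume t: "t < j - i"
        then have "d (w (t + i)) (w (Suc t + i)) \<le> l" "D \<le> d p (w (t + i))" "D \<le> d p (w (Suc t + i))"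
          using w p that unfolding quasi_def by auto
        then show "D - l / 2 \<le> gromov_product d p (w (t + i)) (w (Suc t + i))"
          unfolding gromov_product_def by (simp add: field_simps)
      qed
    qed (use that p w False in \<open>auto simp: quasi_def\<close>)
    then show ?thesis using that by simp
  qed
  show ?thesis
  proof (cases "i \<le> j")
    case True
    then show ?thesis using assms by (intro *) auto
  next
    case False
    then have "D - l / 2 - real k * \<delta> \<le> gromov_product d p (w j) (w i)"
      using assms by (intro *) auto
    moreover have "gromov_product d p (w i) (w j) = gromov_product d p (w j) (w i)"
      using w assms(4,5) dist_sym[of "w i" "w j"] by (simp add: gromov_product_def quasi_def)
    ultimately show ?thesis by simp
  qed
qed

text \<open>\<open>\<gamma> i\<close> is a point of largest deviation \<open>D\<close>. A detour
  along \<open>w\<close>, which keeps distance \<open>D\<close> from it, joins points of \<gamma> on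
  both sides. Along the detour the Gromov products at \<open>\<gamma> i\<close> stay near
  \<open>D\<close>, up to a logarithmic loss, whereas the product of the two points of \<gamma>
  vanishes.\<close>

lemma deviation_bound:
  assumes \<gamma>: "geodesic \<gamma> n" and w: "quasi l \<mu> w m"
    and ends: "d (\<gamma> 0) (w 0) \<le> c" "d (\<gamma> n) (w m) \<le> c"
    and i: "i \<le> n" and D: "0 \<le> D" "\<forall>j\<le>m. D \<le> d (\<gamma> i) (w j)" "\<forall>i\<le>n. \<exists>j\<le>m. d (\<gamma> i) (w j) \<le> D"
    and l: "1 \<le> l" "0 \<le> c" and k: "l * (6 * D + 2 + 2 * c) + \<mu> \<le> 2 ^ k"
  shows "D \<le> c + l / 2 + (real k + 2) * \<delta>"
proof -
  define a where "a = nat \<lceil>2 * D\<rceil>"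
  have a: "2 * D \<le> real a" "real a \<le> 2 * D + 1"
    using D(1) unfolding a_def by linarith+
  define p where "p = \<gamma> i"
  have X: "\<gamma> i \<in> X" if "i \<le> n" for i using \<gamma> that by (simp add: geodesic_def)
  have wX: "w j \<in> X" if "j \<le> m" for j using w that by (simp add: quasi_def)
  have dg: "d (\<gamma> i) (\<gamma> j) = \<bar>real i - real j\<bar>" if "i \<le> n" "j \<le> n" for i j
    using \<gamma> that by (simp add: geodesic_def)
  have pX: "p \<in> X" using X i p_def by blast
  \<comment> \<open>A point of \<gamma> at distance at least \<open>2 * D\<close> from
    \<open>p\<close> is joined to \<open>w\<close> by a jump of length at most \<open>D\<close>,
    with Gromov product at least half of \<open>2 * D + D - D\<close>. At an end of \<gamma> the
    jump has length at most \<open>c\<close> and the loss is \<open>c\<close>.\<close>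
  have side: "\<exists>j\<le>m. D - c \<le> gromov_product d p (\<gamma> t) (w j) \<and> d (\<gamma> t) (w j) \<le> D + c"
    if t: "t \<le> n" "real a \<le> \<bar>real t - real i\<bar> \<or> t = 0 \<or> t = n" for t
    using t(2)
  proof (elim disjE)
    assume far: "real a \<le> \<bar>real t - real i\<bar>"
    obtain j where j: "j \<le> m" "d (\<gamma> t) (w j) \<le> D" using D(3) t by blast
    have "2 * D \<le> d p (\<gamma> t)" unfolding p_def using dg[OF i t(1)] far a by linarith
    moreover have "D \<le> d p (w j)" using D(2) j p_def by blast
    ultimately show ?thesis using j l by (intro exI[of _ j]) (auto simp: gromov_product_def)
  next
    assume "t = 0"
    then have "D - c \<le> gromov_product d p (\<gamma> t) (w 0) \<and> d (\<gamma> t) (w 0) \<le> D + c"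
      using ends(1) dist_triangle[of p "\<gamma> 0" "w 0"] pX X[of 0] wX[of 0] D(1,2) p_def l
      unfolding gromov_product_def by force
    then show ?thesis by blast
  next
    assume "t = n"
    then have "D - c \<le> gromov_product d p (\<gamma> t) (w m) \<and> d (\<gamma> t) (w m) \<le> D + c"
      using ends(2) dist_triangle[of p "\<gamma> n" "w m"] pX X[of n] wX[of m] D(1,2) p_def l
      unfolding gromov_product_def by force
    then show ?thesis by blast
  qed
  \<comment> \<open>Truncated subtraction makes \<open>s\<close> the start of \<gamma> if fewer than
    \<open>a\<close> steps are left, just as \<open>min\<close> does at the other end.\<close>
  define s where "s = i - a"
  define t where "t = min n (i + a)"
  have st: "s \<le> n" "t \<le> n" "s \<le> i" "i \<le> t" "real i - real s \<le> a" "real t - real i \<le> a"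
    using i unfolding s_def t_def by auto
  obtain j where j: "j \<le> m" "D - c \<le> gromov_product d p (\<gamma> s) (w j)" "d (\<gamma> s) (w j) \<le> D + c"
    using side[OF st(1)] unfolding s_def by force
  obtain j' where j': "j' \<le> m" "D - c \<le> gromov_product d p (\<gamma> t) (w j')" "d (\<gamma> t) (w j') \<le> D + c"
    using side[OF st(2)] unfolding t_def by force
  have "d (w j) (w j') \<le> d (w j) (\<gamma> s) + (d (\<gamma> s) (\<gamma> t) + d (\<gamma> t) (w j'))"
    using dist_triangle[of "w j" "\<gamma> s" "w j'"] dist_triangle[of "\<gamma> s" "\<gamma> t" "w j'"] wX j j' X st by force
  also have "\<dots> \<le> (D + c) + (2 * a + (D + c))"
    using j j' dist_sym[of "w j" "\<gamma> s"] wX X st dg[OF st(1,2)] by (intro add_mono) auto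
  \<comment> \<open>By \<open>a \<le> 2 * D + 1\<close>; this is the origin of
    \<open>6 * D + 2 + 2 * c\<close> in the hypothesis on \<open>k\<close>.\<close>
  also have "\<dots> \<le> 6 * D + 2 + 2 * c" using a by simp
  finally have "l * d (w j) (w j') \<le> l * (6 * D + 2 + 2 * c)" using l by (intro mult_left_mono) auto
  then have "\<bar>real j - real j'\<bar> \<le> 2 ^ k"
    using w j(1) j'(1) k unfolding quasi_def by force
  then have mid: "D - l / 2 - real k * \<delta> \<le> gromov_product d p (w j) (w j')"
    using quasi_gromov_product[OF w pX] D(2) j(1) j'(1) l p_def by auto
  have j'2: "D - c \<le> gromov_product d p (w j') (\<gamma> t)"
    using j' dist_sym[of "\<gamma> t" "w j'"] X st wX by (simp add: gromov_product_def)
  \<comment> \<open>\<open>p\<close> lies between the two points on a geodesic.\<close>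
  have "gromov_product d p (\<gamma> s) (\<gamma> t) = 0"
    unfolding gromov_product_def p_def using dg st i by simp
  moreover have "min (gromov_product d p (\<gamma> s) (w j)) (gromov_product d p (w j) (w j')) - \<delta>
      \<le> gromov_product d p (\<gamma> s) (w j')"
    "min (gromov_product d p (\<gamma> s) (w j')) (gromov_product d p (w j') (\<gamma> t)) - \<delta>
      \<le> gromov_product d p (\<gamma> s) (\<gamma> t)"
    using pX X st wX j j' by (auto intro: four_point)
  moreover have "0 \<le> real k * \<delta>" using delta_ge_1 by simp
  moreover have "(real k + 2) * \<delta> = real k * \<delta> + 2 * \<delta>" by (simp add: algebra_simps)
  ultimately show ?thesis
    using j(2) mid j'2 l delta_ge_1 by linarith
qed

text \<open>\<open>k\<close> may be taken of the order of the logarithm of \<open>D\<close>, so the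
  hypothesis bounds \<open>D\<close> by a logarithm of itself.\<close>

lemma logarithmic_bound:
  fixes A B e :: real
  shows "\<exists>D0. \<forall>D. (\<forall>k. A * D + B \<le> 2 ^ k \<longrightarrow> D \<le> e + (real k + 2) * \<delta>) \<longrightarrow> D \<le> D0"
proof -
  have "\<forall>\<^sub>F k :: nat in sequentially. \<bar>A\<bar> * (e + (real k + 3) * \<delta>) + B \<le> 2 ^ k"
    by real_asymp
  then obtain k0 where k0: "\<And>k. k0 \<le> k \<Longrightarrow> \<bar>A\<bar> * (e + (real k + 3) * \<delta>) + B \<le> 2 ^ k"
    unfolding eventually_sequentially by blast
  have "D \<le> max 0 (e + (real k0 + 2) * \<delta>)"
    if D: "\<forall>k. A * D + B \<le> 2 ^ k \<longrightarrow> D \<le> e + (real k + 2) * \<delta>" for D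
  proof (rule ccontr)
    assume big: "\<not> D \<le> max 0 (e + (real k0 + 2) * \<delta>)"
    \<comment> \<open>With 3 in place of 2, the least \<open>k\<close> of this kind still violates
      \<open>D \<le> e + (real k + 2) * \<delta>\<close>; it remains to see that
      \<open>2 ^ k\<close> reaches \<open>A * D + B\<close>.\<close>
    let ?P = "\<lambda>k. D \<le> e + (real k + 3) * \<delta>"
    obtain n :: nat where n: "D - e \<le> real n" using real_arch_simple by blast
    also have "\<dots> \<le> (real n + 3) * \<delta>"
      using mult_mono[of "real n" "real n + 3" 1 \<delta>] delta_ge_1 by simp
    finally have ex: "?P n" by simp
    define k where "k = (LEAST k. ?P k)"
    have Pk: "?P k" unfolding k_def by (rule LeastI[of ?P, OF ex])
    have k0k: "k0 \<le> k"
    proof (rule ccontr)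
      assume "\<not> k0 \<le> k"
      then have "(real k + 3) * \<delta> \<le> (real k0 + 2) * \<delta>"
        using delta_ge_1 by (intro mult_right_mono) auto
      with big Pk show False by simp
    qed
    have less: "e + (real k + 2) * \<delta> < D"
    proof (cases k)
      case 0
      with k0k big show ?thesis by simp
    next
      case (Suc j)
      then have "\<not> ?P j" using not_less_Least[of j ?P] unfolding k_def by simp
      with Suc show ?thesis by (simp add: algebra_simps)
    qed
    have "A * D \<le> \<bar>A\<bar> * D" using big by (intro mult_right_mono) auto
    also have "\<dots> \<le> \<bar>A\<bar> * (e + (real k + 3) * \<delta>)" using Pk by (intro mult_left_mono) auto
    finally have "A * D + B \<le> 2 ^ k" using k0[OF k0k] by linarith
    with D less show False by (meson not_less)
  qed
  then show ?thesis by blast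
qed

lemma geodesic_near_quasi:
  assumes "1 \<le> l" "0 \<le> c"
  shows "\<exists>D. \<forall>\<gamma> n w m. geodesic \<gamma> n \<longrightarrow> quasi l \<mu> w m \<longrightarrow> d (\<gamma> 0) (w 0) \<le> c \<longrightarrow> d (\<gamma> n) (w m) \<le> c \<longrightarrow>
    (\<forall>i\<le>n. \<exists>j\<le>m. d (\<gamma> i) (w j) \<le> D)"
proof -
  obtain D0 where D0: "\<And>D. (\<forall>k. 6 * l * D + (l * (2 + 2 * c) + \<mu>) \<le> 2 ^ k \<longrightarrow> D \<le> c + l / 2 + (real k + 2) * \<delta>) \<Longrightarrow> D \<le> D0"
    using logarithmic_bound[of "6 * l" "l * (2 + 2 * c) + \<mu>" "c + l / 2"] by blast
  have "\<exists>j\<le>m. d (\<gamma> i) (w j) \<le> D0"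
    if \<gamma>: "geodesic \<gamma> n" and w: "quasi l \<mu> w m" and ends: "d (\<gamma> 0) (w 0) \<le> c" "d (\<gamma> n) (w m) \<le> c"
      and i: "i \<le> n" for \<gamma> n w m i
  proof -
    \<comment> \<open>The distance from \<open>\<gamma> i\<close> to the path.
      \<open>deviation_bound\<close> is applied at a point \<open>i0\<close> where it is
      largest.\<close>
    define f where "f i = Min ((\<lambda>j. d (\<gamma> i) (w j)) ` {..m})" for i
    have f_le: "f i \<le> d (\<gamma> i) (w j)" if "j \<le> m" for i j
      using that unfolding f_def by (intro Min_le) auto
    have f_ex: "\<exists>j\<le>m. d (\<gamma> i) (w j) = f i" for i
    proof -
      have "f i \<in> (\<lambda>j. d (\<gamma> i) (w j)) ` {..m}" unfolding f_def by (intro Min_in) auto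
      then show ?thesis by auto
    qed
    define D where "D = Max (f ` {..n})"
    have "D \<in> f ` {..n}" unfolding D_def by (intro Max_in) auto
    then obtain i0 where i0: "i0 \<le> n" "f i0 = D" by auto
    have fD: "f i \<le> D" if "i \<le> n" for i using that unfolding D_def by (intro Max_ge) auto
    have "0 \<le> D"
      using f_ex[of i0] i0 \<gamma> w dist_nonneg unfolding geodesic_def quasi_def by metis
    have "D \<le> D0"
    proof (rule D0, intro allI impI)
      fix k assume "6 * l * D + (l * (2 + 2 * c) + \<mu>) \<le> 2 ^ k"
      then have "l * (6 * D + 2 + 2 * c) + \<mu> \<le> 2 ^ k" by (simp add: algebra_simps)
      then show "D \<le> c + l / 2 + (real k + 2) * \<delta>"
        using deviation_bound[OF \<gamma> w ends i0(1) \<open>0 \<le> D\<close>] f_le i0 f_ex fD assms by metis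
    qed
    then show ?thesis using f_ex[of i] fD[OF i] by force
  qed
  then show ?thesis by blast
qed

section \<open>Comparison of two quasi-geodesics\<close>

lemma discrete_intermediate:
  fixes g :: "nat \<Rightarrow> nat"
  assumes "g 0 \<le> j" "j \<le> g n" "\<And>i. i < n \<Longrightarrow> \<bar>real (g i) - real (g (Suc i))\<bar> \<le> B" "0 \<le> B"
  shows "\<exists>i\<le>n. \<bar>real (g i) - real j\<bar> \<le> B"
  using assms
proof (induction n)
  case (Suc n)
  show ?case
  proof (cases "j \<le> g n")
    case True
    then show ?thesis using Suc by (meson le_SucI less_SucI)
  next
    case False
    then show ?thesis using Suc.prems(2) Suc.prems(3)[of n]
      by (intro exI[of _ "Suc n"]) auto
  qed
qed auto

lemma quasi_step: "quasi l \<mu> w m \<Longrightarrow> i \<le> j \<Longrightarrow> j \<le> m \<Longrightarrow> d (w i) (w j) \<le> l * (real j - real i)"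
proof (induction "j - i" arbitrary: j)
  case 0
  then show ?case using dist_refl by (simp add: quasi_def)
next
  case (Suc k)
  then obtain j' where j: "j = Suc j'" "i \<le> j'" by (cases j) auto
  have "d (w i) (w j) \<le> d (w i) (w j') + d (w j') (w j)"
    using Suc.prems j by (intro dist_triangle) (auto simp: quasi_def)
  also have "\<dots> \<le> l * (real j' - real i) + l"
    using Suc j by (intro add_mono) (auto simp: quasi_def)
  finally show ?case using j by (simp add: algebra_simps)
qed

lemma quasi_lipschitz:
  assumes "quasi l \<mu> w m" "i \<le> m" "j \<le> m"
  shows "d (w i) (w j) \<le> l * \<bar>real i - real j\<bar>"
proof (cases "i \<le> j")
  case True
  then show ?thesis using quasi_step[OF assms(1) True] assms by simp
next
  case False
  then have "d (w j) (w i) \<le> l * (real i - real j)" using quasi_step[OF assms(1)] assms by simp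
  then show ?thesis using False assms dist_sym[of "w i" "w j"] by (simp add: quasi_def)
qed

lemma geodesic_imp_quasi: "geodesic \<gamma> n \<Longrightarrow> 1 \<le> l \<Longrightarrow> 0 \<le> \<mu> \<Longrightarrow> quasi l \<mu> \<gamma> n"
  unfolding geodesic_def quasi_def
  by (auto simp: add_increasing2 mult_le_cancel_right1 intro: order_trans[of _ "l * _"])

text \<open>Partners of consecutive points of \<open>v\<close> are at distance at most
  \<open>2 * D + l\<close>, so on the quasi-geodesic \<open>w\<close> their positions differ by a
  bounded amount.\<close>

lemma quasi_near_matched:
  assumes v: "quasi l \<mu> v n" and w: "quasi l \<mu> w m" and l: "1 \<le> l" "0 \<le> \<mu>" "0 \<le> D"
    and near: "\<forall>i\<le>n. \<exists>j\<le>m. d (v i) (w j) \<le> D" and ends: "d (v 0) (w 0) \<le> D" "d (v n) (w m) \<le> D"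
  shows "\<exists>g. (\<forall>i\<le>n. g i \<le> m \<and> d (v i) (w (g i)) \<le> D) \<and> (0 < n \<longrightarrow> g 0 = 0) \<and> g n = m \<and>
    (\<forall>i<n. \<bar>real (g i) - real (g (Suc i))\<bar> \<le> l * (2 * D + l) + \<mu>)"
proof -
  obtain g0 where g0: "\<And>i. i \<le> n \<Longrightarrow> g0 i \<le> m \<and> d (v i) (w (g0 i)) \<le> D"
    using near by metis
  \<comment> \<open>The end is tested first: for \<open>n = 0\<close> the condition at
    \<open>n\<close> takes precedence over the one at 0.\<close>
  define g where "g i = (if i = n then m else if i = 0 then 0 else g0 i)" for i
  have g: "g i \<le> m" "d (v i) (w (g i)) \<le> D" if "i \<le> n" for i
    using g0[OF that] ends that by (auto simp: g_def)
  have "\<bar>real (g i) - real (g (Suc i))\<bar> \<le> l * (2 * D + l) + \<mu>" if i: "i < n" for i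
  proof -
    have X: "v i \<in> X" "v (Suc i) \<in> X" "w (g i) \<in> X" "w (g (Suc i)) \<in> X"
      using v w g i by (auto simp: quasi_def)
    have "d (w (g i)) (w (g (Suc i))) \<le> d (w (g i)) (v i) + (d (v i) (v (Suc i)) + d (v (Suc i)) (w (g (Suc i))))"
      using dist_triangle[of "w (g i)" "v i" "w (g (Suc i))"] dist_triangle[of "v i" "v (Suc i)" "w (g (Suc i))"] X
      by linarith
    also have "\<dots> \<le> D + (l + D)"
      using g[of i] g[of "Suc i"] i v dist_sym[of "v i" "w (g i)"] X by (intro add_mono) (auto simp: quasi_def)
    finally have "l * d (w (g i)) (w (g (Suc i))) \<le> l * (2 * D + l)"
      using l by (intro mult_left_mono) auto
    then show ?thesis using w g[of i] g[of "Suc i"] i unfolding quasi_def by force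
  qed
  then show ?thesis using g by (intro exI[of _ g]) (auto simp: g_def)
qed

text \<open>Matched positions run from 0 to \<open>m\<close> in bounded steps, so every position of
  \<open>w\<close> is close to a matched one. The last summand of the bound is for
  \<open>n = 0\<close>, where \<open>w\<close> is short because its ends are close to each
  other.\<close>

lemma quasi_near_sym:
  assumes v: "quasi l \<mu> v n" and w: "quasi l \<mu> w m" and l: "1 \<le> l" "0 \<le> \<mu>" "0 \<le> D"
    and near: "\<forall>i\<le>n. \<exists>j\<le>m. d (v i) (w j) \<le> D" and ends: "d (v 0) (w 0) \<le> D" "d (v n) (w m) \<le> D"
  shows "\<forall>j\<le>m. \<exists>i\<le>n. d (w j) (v i) \<le> D + l * (l * (2 * D + l) + \<mu>) + l * (l * (2 * D) + \<mu>)"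
proof (intro allI impI)
  fix j assume j: "j \<le> m"
  define B where "B = l * (2 * D + l) + \<mu>"
  have B0: "0 \<le> B" using l by (simp add: B_def)
  obtain g where g: "\<forall>i\<le>n. g i \<le> m \<and> d (v i) (w (g i)) \<le> D" "0 < n \<longrightarrow> g 0 = 0" "g n = m"
    "\<And>i. i < n \<Longrightarrow> \<bar>real (g i) - real (g (Suc i))\<bar> \<le> B"
    using quasi_near_matched[OF assms] unfolding B_def by blast
  show "\<exists>i\<le>n. d (w j) (v i) \<le> D + l * (l * (2 * D + l) + \<mu>) + l * (l * (2 * D) + \<mu>)"
  proof (cases "n = 0")
    case False
    then obtain i where i: "i \<le> n" "\<bar>real (g i) - real j\<bar> \<le> B"
      using discrete_intermediate[of g j n B] g j B0 by auto
    have "d (w j) (v i) \<le> d (w j) (w (g i)) + d (w (g i)) (v i)"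
      using v w i j g(1) by (intro dist_triangle) (auto simp: quasi_def)
    also have "\<dots> \<le> l * B + D"
    proof (rule add_mono)
      show "d (w j) (w (g i)) \<le> l * B"
      proof -
        have "d (w j) (w (g i)) \<le> l * \<bar>real j - real (g i)\<bar>" using quasi_lipschitz[OF w j] g(1) i by blast
        also have "\<dots> \<le> l * B" using i l by (intro mult_left_mono) auto
        finally show ?thesis .
      qed
      show "d (w (g i)) (v i) \<le> D"
        using g(1) i dist_sym[of "w (g i)" "v i"] v w by (simp add: quasi_def)
    qed
    finally show ?thesis using i l by (intro exI[of _ i]) (auto simp: B_def intro: order_trans add_increasing2)
  next
    case True
    have X: "v 0 \<in> X" "w 0 \<in> X" "w m \<in> X" using v w by (auto simp: quasi_def)
    have "d (w 0) (w m) \<le> 2 * D"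
      using dist_triangle[of "w 0" "v 0" "w m"] dist_sym[of "w 0" "v 0"] X True ends by simp
    then have "l * d (w 0) (w m) \<le> l * (2 * D)" using l by (intro mult_left_mono) auto
    moreover have "real m \<le> l * d (w 0) (w m) + \<mu>" using w by (force simp: quasi_def)
    ultimately have "real j \<le> l * (2 * D) + \<mu>" using j by simp
    then have "d (w j) (w 0) \<le> l * (l * (2 * D) + \<mu>)"
    proof -
      have "d (w j) (w 0) \<le> l * real j" using quasi_lipschitz[OF w j, of 0] by simp
      also have "\<dots> \<le> l * (l * (2 * D) + \<mu>)"
        using \<open>real j \<le> l * (2 * D) + \<mu>\<close> l by (intro mult_left_mono) auto
      finally show ?thesis .
    qed
    moreover have "d (w j) (v 0) \<le> d (w j) (w 0) + d (w 0) (v 0)"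
      using X w j by (intro dist_triangle) (auto simp: quasi_def)
    moreover have "d (w 0) (v 0) \<le> D" using ends dist_sym X by simp
    moreover have "0 \<le> l * (l * (2 * D + l) + \<mu>)" using l by simp
    ultimately show ?thesis by (intro exI[of _ 0]) auto
  qed
qed

text \<open>Both paths are compared with a geodesic between the ends of \<open>v\<close>:
  \<open>D\<close> bounds the way from the geodesic to either path, \<open>E\<close> the way from
  \<open>v\<close> to the geodesic.\<close>

lemma quasi_stability:
  assumes geod: "\<And>x y. x \<in> X \<Longrightarrow> y \<in> X \<Longrightarrow> \<exists>\<gamma> n. geodesic \<gamma> n \<and> \<gamma> 0 = x \<and> \<gamma> n = y"
    and l: "1 \<le> l" "0 \<le> \<mu>" "0 \<le> c"
  shows "\<exists>K\<ge>0. \<forall>v n w m. quasi l \<mu> v n \<longrightarrow> quasi l \<mu> w m \<longrightarrow> d (v 0) (w 0) \<le> c \<longrightarrow> d (v n) (w m) \<le> c \<longrightarrow>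
    (\<forall>i\<le>n. \<exists>j\<le>m. d (v i) (w j) \<le> K)"
proof -
  obtain D0 where D0: "\<And>\<gamma> n w m i. geodesic \<gamma> n \<Longrightarrow> quasi l \<mu> w m \<Longrightarrow> d (\<gamma> 0) (w 0) \<le> c \<Longrightarrow> d (\<gamma> n) (w m) \<le> c
      \<Longrightarrow> i \<le> n \<Longrightarrow> \<exists>j\<le>m. d (\<gamma> i) (w j) \<le> D0"
    using geodesic_near_quasi[OF l(1,3), of \<mu>] by blast
  define D where "D = max D0 c"
  have D: "0 \<le> D" "c \<le> D" "D0 \<le> D" using l by (auto simp: D_def)
  define E where "E = D + l * (l * (2 * D + l) + \<mu>) + l * (l * (2 * D) + \<mu>)"
  have "0 \<le> E" using D l by (simp add: E_def)
  have "\<exists>j\<le>m. d (v i) (w j) \<le> E + D"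
    if v: "quasi l \<mu> v n" and w: "quasi l \<mu> w m" and ends: "d (v 0) (w 0) \<le> c" "d (v n) (w m) \<le> c"
      and i: "i \<le> n" for v n w m i
  proof -
    have X: "v 0 \<in> X" "v n \<in> X" "v i \<in> X" using v i by (auto simp: quasi_def)
    obtain \<gamma> k where \<gamma>: "geodesic \<gamma> k" "\<gamma> 0 = v 0" "\<gamma> k = v n" using geod X by blast
    have same: "d (\<gamma> 0) (v 0) \<le> c" "d (\<gamma> k) (v n) \<le> c" using \<gamma> dist_refl X l by auto
    have near: "\<forall>t\<le>k. \<exists>i\<le>n. d (\<gamma> t) (v i) \<le> D"
      using D0[OF \<gamma>(1) v same] D(3) by fastforce
    have same': "d (\<gamma> 0) (v 0) \<le> D" "d (\<gamma> k) (v n) \<le> D" using same D(2) by linarith+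
    obtain t where t: "t \<le> k" "d (v i) (\<gamma> t) \<le> E"
      using quasi_near_sym[OF geodesic_imp_quasi[OF \<gamma>(1) l(1,2)] v l(1,2) D(1) near same'] i
      unfolding E_def by blast
    obtain j where j: "j \<le> m" "d (\<gamma> t) (w j) \<le> D"
      using D0[OF \<gamma>(1) w, of t] \<gamma> ends t D(3) by fastforce
    have "d (v i) (w j) \<le> d (v i) (\<gamma> t) + d (\<gamma> t) (w j)"
      using X \<gamma> t w j by (intro dist_triangle) (auto simp: geodesic_def quasi_def)
    with t j show ?thesis by force
  qed
  moreover have "0 \<le> E + D" using D \<open>0 \<le> E\<close> by simp
  ultimately show ?thesis by blast
qed

end

text \<open>Monotonicity is needed to follow \<open>w\<close> through an automaton while
  \<open>v\<close> is read letter by letter: after \<open>i\<close> letters of \<open>v\<close>,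
  \<open>J i\<close> letters of \<open>w\<close> are consumed, and all positions passed in the next
  step are near \<open>v (Suc i)\<close>.\<close>

lemma (in hyperbolic_space) quasi_monotone_matching:
  assumes geod: "\<And>x y. x \<in> X \<Longrightarrow> y \<in> X \<Longrightarrow> \<exists>\<gamma> n. geodesic \<gamma> n \<and> \<gamma> 0 = x \<and> \<gamma> n = y"
    and l: "1 \<le> l" "0 \<le> \<mu>"
  shows "\<exists>K\<ge>0. \<forall>v n w m. quasi l \<mu> v n \<longrightarrow> quasi l \<mu> w m \<longrightarrow> v 0 = w 0 \<longrightarrow> v n = w m \<longrightarrow>
    (\<exists>J. J n = m \<and> (\<forall>i<n. J i \<le> J (Suc i)) \<and> (\<forall>j\<le>J 0. d (v 0) (w j) \<le> K) \<and>
      (\<forall>i<n. \<forall>j. J i \<le> j \<longrightarrow> j \<le> J (Suc i) \<longrightarrow> d (v (Suc i)) (w j) \<le> K))"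
proof -
  obtain D where D: "0 \<le> D" "\<And>v n w m i. quasi l \<mu> v n \<Longrightarrow> quasi l \<mu> w m \<Longrightarrow> d (v 0) (w 0) \<le> 0 \<Longrightarrow> d (v n) (w m) \<le> 0
      \<Longrightarrow> i \<le> n \<Longrightarrow> \<exists>j\<le>m. d (v i) (w j) \<le> D"
    using quasi_stability[OF geod l order_refl] by blast
  define B where "B = l * (2 * D + l) + \<mu>"
  define F where "F = l * (l * (D + l * B + D) + \<mu>) + D"
  have B: "0 \<le> B" "0 \<le> F" using l D by (auto simp: B_def F_def)
  \<comment> \<open>The summand \<open>l * \<mu>\<close> serves the case \<open>n = 0\<close>, in
    which \<open>w\<close> is a loop of length at most \<mu>.\<close>
  define K where "K = F + l * B + l * \<mu>"
  have K: "0 \<le> K" using l B by (simp add: K_def)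
  have "\<exists>J. J n = m \<and> (\<forall>i<n. J i \<le> J (Suc i)) \<and> (\<forall>j\<le>J 0. d (v 0) (w j) \<le> K) \<and>
      (\<forall>i<n. \<forall>j. J i \<le> j \<longrightarrow> j \<le> J (Suc i) \<longrightarrow> d (v (Suc i)) (w j) \<le> K)"
    if v: "quasi l \<mu> v n" and w: "quasi l \<mu> w m" and ends: "v 0 = w 0" "v n = w m" for v n w m
  proof (cases "n = 0")
    case True
    have "w 0 = w m" "w m \<in> X" using True ends w by (auto simp: quasi_def)
    then have "d (w 0) (w m) = 0" using dist_refl by simp
    then have m: "real m \<le> \<mu>" using w by (force simp: quasi_def)
    have "d (v 0) (w j) \<le> K" if j: "j \<le> m" for j
    proof -
      have "d (v 0) (w j) \<le> l * real j" using quasi_lipschitz[OF w, of 0 j] j ends by simp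
      also have "\<dots> \<le> l * \<mu>" using m j l by (intro mult_left_mono) auto
      finally show ?thesis using B l by (simp add: K_def add_increasing)
    qed
    with True show ?thesis by (intro exI[of _ "\<lambda>_. m"]) auto
  next
    case False
    have vX: "v i \<in> X" if "i \<le> n" for i using v that by (simp add: quasi_def)
    have wX: "w i \<in> X" if "i \<le> m" for i using w that by (simp add: quasi_def)
    have ends0: "d (v 0) (w 0) \<le> 0" "d (v n) (w m) \<le> 0"
      using ends dist_refl wX by auto
    have near: "\<forall>i\<le>n. \<exists>j\<le>m. d (v i) (w j) \<le> D" by (intro allI impI D(2)[OF v w ends0])
    have endsD: "d (v 0) (w 0) \<le> D" "d (v n) (w m) \<le> D" using ends0 D(1) by linarith+
    obtain g where g: "\<And>i. i \<le> n \<Longrightarrow> g i \<le> m" "\<And>i. i \<le> n \<Longrightarrow> d (v i) (w (g i)) \<le> D" "g 0 = 0" "g n = m"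
      "\<And>i. i < n \<Longrightarrow> \<bar>real (g i) - real (g (Suc i))\<bar> \<le> B"
      using quasi_near_matched[OF v w l D(1) near endsD] False unfolding B_def by blast
    \<comment> \<open>The running maximum makes the matching \<open>g\<close> monotone; what has to
      be shown is that nearness survives.\<close>
    define J where "J i = Max (g ` {..i})" for i
    have J_ge: "g i' \<le> J i" if "i' \<le> i" for i i' using that unfolding J_def by (intro Max_ge) auto
    have J_ex: "\<exists>i'\<le>i. g i' = J i" for i
    proof -
      have "J i \<in> g ` {..i}" unfolding J_def by (intro Max_in) auto
      then show ?thesis by auto
    qed
    have J0: "J 0 = 0" using g by (simp add: J_def)
    have Jm: "J i \<le> m" if "i \<le> n" for i
    proof -
      obtain i' where "i' \<le> i" "g i' = J i" using J_ex by blast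
      with g(1)[of i'] that show ?thesis by simp
    qed
    have Jn: "J n = m" using J_ge[of n n] Jm[of n] g by simp
    have J_Suc: "J (Suc i) = max (J i) (g (Suc i))" for i
      unfolding J_def atMost_Suc by (simp add: Max_insert max.commute)
    have nearJ: "d (v i) (w (J i)) \<le> F" if i: "i \<le> n" for i
    proof -
      obtain i' where i': "i' \<le> i" "g i' = J i" using J_ex by blast
      \<comment> \<open>The maximum \<open>J i\<close> is attained at a time
        \<open>i' \<le> i\<close>. From time \<open>i\<close> on, \<open>g\<close> climbs from at
        most \<open>J i\<close> up to \<open>m\<close>, so it comes within \<open>B\<close> of
        \<open>J i\<close> again at some time \<open>i + t\<close>. The points of \<open>v\<close>
        at these two times are close, hence so are the times, and \<open>i\<close> lies between
        them.\<close>
      have "\<exists>t\<le>n - i. \<bar>real (g (i + t)) - real (J i)\<bar> \<le> B"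
        by (rule discrete_intermediate[where g = "\<lambda>t. g (i + t)"]) (use i g J_ge[of i i] Jm B in auto)
      then obtain t where t: "i + t \<le> n" "\<bar>real (g (i + t)) - real (J i)\<bar> \<le> B"
        using i by (auto simp: le_diff_conv2 add.commute)
      have JX: "w (J i) \<in> X" "w (g (i + t)) \<in> X" "v i' \<in> X" "v (i + t) \<in> X"
        using i i' t g(1) Jm wX vX by auto
      have "d (w (J i)) (w (g (i + t))) \<le> l * \<bar>real (J i) - real (g (i + t))\<bar>"
        using quasi_lipschitz[OF w] Jm i g(1) t by blast
      also have "\<dots> \<le> l * B" using t l by (intro mult_left_mono) auto
      finally have "d (w (J i)) (w (g (i + t))) \<le> l * B" .
      moreover have "d (v i') (w (J i)) \<le> D" using g(2)[of i'] i' i by simp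
      moreover have "d (w (g (i + t))) (v (i + t)) \<le> D" using g(2)[of "i + t"] t dist_sym JX by simp
      moreover have "d (v i') (v (i + t)) \<le> d (v i') (w (J i)) + (d (w (J i)) (w (g (i + t))) + d (w (g (i + t))) (v (i + t)))"
        using dist_triangle[of "v i'" "w (J i)" "v (i + t)"] dist_triangle[of "w (J i)" "w (g (i + t))" "v (i + t)"] JX
        by linarith
      ultimately have "d (v i') (v (i + t)) \<le> D + l * B + D" by linarith
      then have "l * d (v i') (v (i + t)) \<le> l * (D + l * B + D)" using l by (intro mult_left_mono) auto
      moreover have "\<bar>real i' - real (i + t)\<bar> \<le> l * d (v i') (v (i + t)) + \<mu>"
      proof -
        have "i' \<le> n" using i' i by simp
        with v t(1) show ?thesis unfolding quasi_def by blast
      qed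
      ultimately have ii': "real i - real i' \<le> l * (D + l * B + D) + \<mu>" using i' by linarith
      have "d (v i') (v i) \<le> l * (real i - real i')" using quasi_step[OF v] i' i by blast
      also have "\<dots> \<le> l * (l * (D + l * B + D) + \<mu>)" using ii' l by (intro mult_left_mono) auto
      finally have "d (v i) (v i') \<le> l * (l * (D + l * B + D) + \<mu>)" using dist_sym vX i i' by simp
      moreover have "d (v i) (w (J i)) \<le> d (v i) (v i') + d (v i') (w (J i))"
        using JX vX i by (intro dist_triangle) auto
      ultimately show ?thesis using \<open>d (v i') (w (J i)) \<le> D\<close> unfolding F_def by linarith
    qed
    have between: "d (v (Suc i)) (w j) \<le> K" if i: "i < n" and j: "J i \<le> j" "j \<le> J (Suc i)" for i j
    proof -
      \<comment> \<open>\<open>J (Suc i)\<close> is either \<open>J i\<close> or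
        \<open>g (Suc i)\<close>, and the latter is at most \<open>g i + B\<close>, hence at most
        \<open>J i + B\<close>.\<close>
      have "real (J (Suc i)) - real (J i) \<le> B"
        using g(5)[OF i] J_ge[of i i] B(1) unfolding J_Suc by (auto simp: max_def)
      then have "\<bar>real (J (Suc i)) - real j\<bar> \<le> B" using j by simp
      then have "l * \<bar>real (J (Suc i)) - real j\<bar> \<le> l * B" using l by (intro mult_left_mono) auto
      moreover have "d (w (J (Suc i))) (w j) \<le> l * \<bar>real (J (Suc i)) - real j\<bar>"
        using Jm[of "Suc i"] i j by (intro quasi_lipschitz[OF w]) auto
      moreover have "d (v (Suc i)) (w j) \<le> d (v (Suc i)) (w (J (Suc i))) + d (w (J (Suc i))) (w j)"
        using Jm[of "Suc i"] i j vX wX by (intro dist_triangle) auto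
      moreover have "d (v (Suc i)) (w (J (Suc i))) \<le> F" using nearJ i by simp
      moreover have "0 \<le> l * \<mu>" using l by simp
      ultimately show ?thesis unfolding K_def by linarith
    qed
    have "d (v 0) (w j) \<le> K" if "j \<le> J 0" for j
      using that ends0(1) K J0 by simp
    with Jn between J_Suc show ?thesis by (intro exI[of _ J]) auto
  qed
  with K show ?thesis by blast
qed

section \<open>Word metrics and cone types\<close>

text \<open>Letters are numbers, so that words over them can be read by coded automata. Different
  letters may have the same value, and \<iota> is an inverse at the level of values.\<close>

locale word_group = group G for G :: "('a, 'b) monoid_scheme" (structure) +
  fixes \<Lambda> :: "nat set" and \<l> :: "nat \<Rightarrow> 'a" and \<iota> :: "nat \<Rightarrow> nat"
  assumes finite_letters: "finite \<Lambda>"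
    and letter_closed [simp]: "a \<in> \<Lambda> \<Longrightarrow> \<l> a \<in> carrier G"
    and inv_letter_closed: "a \<in> \<Lambda> \<Longrightarrow> \<iota> a \<in> \<Lambda>"
    and inv_letter: "a \<in> \<Lambda> \<Longrightarrow> \<l> (\<iota> a) = inv \<l> a"
    and letters_generate: "g \<in> carrier G \<Longrightarrow> \<exists>w\<in>lists \<Lambda>. foldr (\<lambda>a g. \<l> a \<otimes> g) w \<one> = g"
begin

definition wval :: "nat list \<Rightarrow> 'a" where
  "wval w = foldr (\<lambda>a g. \<l> a \<otimes> g) w \<one>"

definition len :: "'a \<Rightarrow> nat" where
  "len g = (LEAST n. \<exists>w\<in>lists \<Lambda>. length w = n \<and> wval w = g)"

definition ldist :: "'a \<Rightarrow> 'a \<Rightarrow> nat" where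
  "ldist g h = len (inv g \<otimes> h)"

definition geod :: "nat list \<Rightarrow> bool" where
  "geod w \<longleftrightarrow> w \<in> lists \<Lambda> \<and> len (wval w) = length w"

lemma wval_Nil [simp]: "wval [] = \<one>" and wval_Cons: "wval (a # w) = \<l> a \<otimes> wval w"
  by (simp_all add: wval_def)

lemma wval_closed [simp]: "w \<in> lists \<Lambda> \<Longrightarrow> wval w \<in> carrier G"
  by (induction w) (auto simp: wval_Cons)

lemma wval_closed_set [simp]: "\<forall>a\<in>set w. a \<in> \<Lambda> \<Longrightarrow> wval w \<in> carrier G"
  using wval_closed by (simp add: in_lists_conv_set)

lemma wval_append: "u \<in> lists \<Lambda> \<Longrightarrow> v \<in> lists \<Lambda> \<Longrightarrow> wval (u @ v) = wval u \<otimes> wval v"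
  by (induction u) (auto simp: wval_Cons m_assoc)

lemma wval_snoc: "u \<in> lists \<Lambda> \<Longrightarrow> a \<in> \<Lambda> \<Longrightarrow> wval (u @ [a]) = wval u \<otimes> \<l> a"
  by (simp add: wval_append wval_Cons)

lemma wval_single: "a \<in> \<Lambda> \<Longrightarrow> wval [a] = \<l> a"
  by (simp add: wval_Cons)

lemma wval_inverse: "w \<in> lists \<Lambda> \<Longrightarrow> wval (rev (map \<iota> w)) = inv (wval w) \<and> rev (map \<iota> w) \<in> lists \<Lambda>"
proof (induction w)
  case (Cons a w)
  then show ?case
    by (auto simp: wval_Cons wval_snoc inv_letter inv_letter_closed inv_mult_group)
qed simp

lemma len_le: "w \<in> lists \<Lambda> \<Longrightarrow> len (wval w) \<le> length w"
  unfolding len_def by (rule Least_le) blast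

lemma geod_ex: "g \<in> carrier G \<Longrightarrow> \<exists>w. geod w \<and> wval w = g"
proof -
  assume "g \<in> carrier G"
  then obtain w where "w \<in> lists \<Lambda>" "wval w = g" using letters_generate unfolding wval_def by blast
  then have "\<exists>n. \<exists>w\<in>lists \<Lambda>. length w = n \<and> wval w = g" by blast
  from LeastI_ex[OF this] show ?thesis unfolding geod_def len_def by metis
qed

lemma geod_lists: "geod w \<Longrightarrow> w \<in> lists \<Lambda>" and geod_len: "geod w \<Longrightarrow> len (wval w) = length w"
  by (simp_all add: geod_def)

lemma len_one [simp]: "len \<one> = 0"
  using len_le[of "[]"] by simp

lemma geod_Nil: "geod []"
  by (simp add: geod_def)

lemma geod_one: "geod w \<Longrightarrow> wval w = \<one> \<Longrightarrow> w = []"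
  by (auto simp: geod_def)

lemma len_mult:
  assumes "g \<in> carrier G" "h \<in> carrier G"
  shows "len (g \<otimes> h) \<le> len g + len h"
proof -
  obtain u v where "geod u" "wval u = g" "geod v" "wval v = h" using geod_ex assms by blast
  then show ?thesis using len_le[of "u @ v"] by (simp add: geod_def wval_append)
qed

lemma len_inv: "g \<in> carrier G \<Longrightarrow> len (inv g) = len g"
proof -
  have "len (inv g) \<le> len g" if "g \<in> carrier G" for g
  proof -
    obtain w where w: "geod w" "wval w = g" using geod_ex \<open>g \<in> carrier G\<close> by blast
    then show ?thesis using len_le[of "rev (map \<iota> w)"] wval_inverse[of w] by (auto simp: geod_def)
  qed
  from this[of g] this[of "inv g"] show "g \<in> carrier G \<Longrightarrow> len (inv g) = len g" by simp
qed

lemma len_letter: "a \<in> \<Lambda> \<Longrightarrow> len (\<l> a) \<le> 1"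
  using len_le[of "[a]"] by (simp add: wval_single)

lemma ldist_refl [simp]: "g \<in> carrier G \<Longrightarrow> ldist g g = 0"
  by (simp add: ldist_def)

lemma ldist_sym: "g \<in> carrier G \<Longrightarrow> h \<in> carrier G \<Longrightarrow> ldist g h = ldist h g"
  using len_inv[of "inv g \<otimes> h"] by (simp add: ldist_def inv_mult_group)

lemma inv_mult_cancel: "g \<in> carrier G \<Longrightarrow> h \<in> carrier G \<Longrightarrow> inv g \<otimes> (g \<otimes> h) = h"
  by (metis inv_closed l_inv l_one m_assoc)

lemma mult_inv_cancel: "g \<in> carrier G \<Longrightarrow> h \<in> carrier G \<Longrightarrow> g \<otimes> (inv g \<otimes> h) = h"
  by (metis inv_closed r_inv l_one m_assoc)

lemma ldist_triangle:
  assumes "f \<in> carrier G" "g \<in> carrier G" "h \<in> carrier G"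
  shows "ldist f h \<le> ldist f g + ldist g h"
proof -
  have "inv f \<otimes> h = (inv f \<otimes> g) \<otimes> (inv g \<otimes> h)"
    using assms by (simp add: m_assoc mult_inv_cancel)
  then show ?thesis unfolding ldist_def using len_mult[of "inv f \<otimes> g" "inv g \<otimes> h"] assms by simp
qed

lemma ldist_left: "f \<in> carrier G \<Longrightarrow> g \<in> carrier G \<Longrightarrow> h \<in> carrier G \<Longrightarrow> ldist (f \<otimes> g) (f \<otimes> h) = ldist g h"
  by (simp add: ldist_def inv_mult_group m_assoc inv_mult_cancel)

lemma ldist_mult_right: "g \<in> carrier G \<Longrightarrow> h \<in> carrier G \<Longrightarrow> ldist g (g \<otimes> h) = len h"
  by (simp add: ldist_def inv_mult_cancel)

lemma geod_append: "geod (u @ v) \<Longrightarrow> geod u \<and> geod v"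
proof -
  assume g: "geod (u @ v)"
  then have uv: "u \<in> lists \<Lambda>" "v \<in> lists \<Lambda>" by (auto simp: geod_def)
  then have "len (wval u \<otimes> wval v) = length u + length v" using g by (simp add: geod_def wval_append)
  then show ?thesis
    using uv len_mult[of "wval u" "wval v"] len_le[OF uv(1)] len_le[OF uv(2)]
    unfolding geod_def by simp
qed

lemma geod_take: "geod w \<Longrightarrow> geod (take t w)"
  using geod_append[of "take t w" "drop t w"] by simp

lemma geod_segment: "geod w \<Longrightarrow> i \<le> j \<Longrightarrow> j \<le> length w \<Longrightarrow> ldist (wval (take i w)) (wval (take j w)) = j - i"
proof -
  assume w: "geod w" "i \<le> j" "j \<le> length w"
  define u where "u = drop i (take j w)"
  have tj: "take j w = take i w @ u" using w(2) unfolding u_def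
    by (metis append_take_drop_id min.absorb1 take_take)
  have "geod (take i w @ u)" using geod_take[OF w(1), of j] tj by simp
  then have "geod u" "geod (take i w)" using geod_append by blast+
  moreover have "length u = j - i" using w by (simp add: u_def)
  ultimately show ?thesis
    unfolding tj by (simp add: wval_append geod_lists ldist_mult_right geod_len)
qed

lemma finite_ball: "finite {g \<in> carrier G. len g \<le> r}"
proof (rule finite_subset)
  show "{g \<in> carrier G. len g \<le> r} \<subseteq> wval ` {w. set w \<subseteq> \<Lambda> \<and> length w \<le> r}"
  proof
    fix g assume g: "g \<in> {g \<in> carrier G. len g \<le> r}"
    then obtain w where w: "geod w" "wval w = g" using geod_ex by blast
    then have "set w \<subseteq> \<Lambda>" "length w \<le> r" using g by (auto simp: geod_def)
    with w show "g \<in> wval ` {w. set w \<subseteq> \<Lambda> \<and> length w \<le> r}" by blast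
  qed
  show "finite (wval ` {w. set w \<subseteq> \<Lambda> \<and> length w \<le> r})"
    using finite_lists_length_le[OF finite_letters] by simp
qed

text \<open>Cannon's cone type of \<open>g\<close>: the words that extend a geodesic word for
  \<open>g\<close>, no matter which, to a geodesic word.\<close>

definition cone :: "'a \<Rightarrow> nat list set" where
  "cone g = {u \<in> lists \<Lambda>. len (g \<otimes> wval u) = len g + length u}"

text \<open>The cone type determines its successor under each admissible letter, so cone types can
  serve as states of an automaton for the geodesic words.\<close>

lemma cone_step:
  assumes "g \<in> carrier G" "[b] \<in> cone g"
  shows "cone (g \<otimes> \<l> b) = {u. b # u \<in> cone g}"
  using assms by (auto simp: cone_def wval_Cons m_assoc)

lemma cone_prefix:
  assumes g: "g \<in> carrier G" and uv: "u @ v \<in> cone g"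
  shows "u \<in> cone g"
proof -
  have uvL: "u \<in> lists \<Lambda>" "v \<in> lists \<Lambda>" using uv by (auto simp: cone_def)
  have "len (g \<otimes> wval u \<otimes> wval v) = len g + length u + length v"
    using uv uvL g by (auto simp: cone_def wval_append m_assoc)
  then show ?thesis
    using len_mult[of "g \<otimes> wval u" "wval v"] len_le[OF uvL(1)] len_le[OF uvL(2)] len_mult[of g "wval u"] uvL g
    by (auto simp: cone_def)
qed

lemma geod_snoc_iff:
  assumes "geod v" "b \<in> \<Lambda>"
  shows "geod (v @ [b]) \<longleftrightarrow> [b] \<in> cone (wval v)"
  using assms by (auto simp: geod_def cone_def wval_snoc wval_single)

end

text \<open>Positions are compared at equal times \<open>t\<close>; beyond its end a word stays at
  its value.\<close>

locale fellow_travel_group = word_group +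
  fixes k :: nat
  assumes fellow_travel: "geod u \<Longrightarrow> geod v \<Longrightarrow> ldist (wval u) (wval v) \<le> 1 \<Longrightarrow>
    ldist (wval (take t u)) (wval (take t v)) \<le> k"
begin

text \<open>The lengths of the elements near \<open>g\<close>, relative to that of \<open>g\<close>, determine the cone type of \<open>g\<close>.\<close>

lemma cone_subset:
  assumes g: "g \<in> carrier G" "g' \<in> carrier G"
    and lev: "\<And>h. h \<in> carrier G \<Longrightarrow> len h \<le> k \<Longrightarrow> int (len (g \<otimes> h)) - len g = int (len (g' \<otimes> h)) - len g'"
  shows "cone g \<subseteq> cone g'"
proof
  show "u \<in> cone g'" if "u \<in> cone g" for u
    using that
  proof (induction u rule: rev_induct)
    case Nil
    then show ?case using g by (simp add: cone_def)
  next
    case (snoc b w)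
    have L: "w \<in> lists \<Lambda>" "b \<in> \<Lambda>" using snoc.prems by (auto simp: cone_def)
    have w: "w \<in> cone g'" using snoc cone_prefix[OF g(1)] by blast
    obtain x where x: "geod x" "wval x = g'" using geod_ex[OF g(2)] by blast
    have xL: "x \<in> lists \<Lambda>" and lx: "length x = len g'" using x by (auto simp: geod_def)
    have xw: "geod (x @ w)" using w x L by (auto simp: geod_def cone_def wval_append)
    have wb: "wval (w @ [b]) \<in> carrier G" using L by simp
    \<comment> \<open>A geodesic word for the product that might be shorter than expected. It ends
      within one letter of the geodesic word \<open>x @ w\<close>, so at time \<open>len g'\<close>
      it is near \<open>g'\<close>.\<close>
    obtain u where u: "geod u" "wval u = g' \<otimes> wval (w @ [b])" using geod_ex g wb by blast
    have uL: "u \<in> lists \<Lambda>" using u geod_lists by blast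
    have "ldist (wval (x @ w)) (wval u) \<le> 1"
      using u x g L xL len_letter ldist_mult_right[of "g' \<otimes> wval w" "\<l> b"]
      by (simp add: wval_append wval_single m_assoc)
    from fellow_travel[OF xw u(1) this, of "len g'"]
    have near: "ldist g' (wval (take (len g') u)) \<le> k" using x lx by simp
    define u1 where "u1 = take (len g') u"
    define u2 where "u2 = drop (len g') u"
    have uu: "u = u1 @ u2" by (simp add: u1_def u2_def)
    have u12: "u1 \<in> lists \<Lambda>" "u2 \<in> lists \<Lambda>" using uL uu by auto
    define h where "h = inv g' \<otimes> wval u1"
    have h: "h \<in> carrier G" "len h \<le> k" "g' \<otimes> h = wval u1"
      using near u12 g by (auto simp: h_def u1_def ldist_def mult_inv_cancel)
    have "h \<otimes> wval u2 = wval (w @ [b])"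
    proof -
      have "g' \<otimes> (h \<otimes> wval u2) = g' \<otimes> wval (w @ [b])"
        using u(2) h u12 g uu by (simp add: m_assoc[symmetric] wval_append)
      then show ?thesis using g h u12 wb by (metis inv_mult_cancel m_closed wval_closed)
    qed
    \<comment> \<open>The way of \<open>u\<close> from \<open>g'\<close> on is copied at
      \<open>g\<close>: leave through \<open>h\<close>, continue with \<open>u2\<close>. Since
      \<open>h\<close> has the same relative level at both places, the known length seen from
      \<open>g\<close> becomes a lower bound seen from \<open>g'\<close>.\<close>
    then have "len (g \<otimes> wval (w @ [b])) = len (g \<otimes> h \<otimes> wval u2)"
      using g h u12 by (metis m_assoc wval_closed)
    also have "\<dots> \<le> len (g \<otimes> h) + length u2"
      using len_mult[of "g \<otimes> h" "wval u2"] len_le[OF u12(2)] m_closed[OF g(1) h(1)] wval_closed[OF u12(2)]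
      by linarith
    finally have "len g + length w + 1 \<le> len (g \<otimes> h) + length u2"
      using snoc.prems by (auto simp: cone_def)
    moreover have "int (len (g \<otimes> h)) = int (len g) + int (len (wval u1)) - int (len g')"
      using lev[OF h(1,2)] h(3) by simp
    moreover have "len (wval u1) \<le> length u1" using len_le u12 by blast
    moreover have "len (g' \<otimes> wval (w @ [b])) = length u1 + length u2"
      using u uu geod_len by (metis length_append)
    moreover have "len (g' \<otimes> wval (w @ [b])) \<le> len g' + length (w @ [b])"
      using len_mult[OF g(2) wb] len_le[of "w @ [b]"] L by fastforce
    ultimately have "len (g' \<otimes> wval (w @ [b])) = len g' + length (w @ [b])"
      unfolding length_append by simp
    then show ?case using L by (simp add: cone_def)
  qed
qed

lemma finite_image_factor:
  assumes "finite (f ` A)" "\<And>x y. x \<in> A \<Longrightarrow> y \<in> A \<Longrightarrow> f x = f y \<Longrightarrow> c x = c y"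
  shows "finite (c ` A)"
proof (rule finite_subset)
  show "c ` A \<subseteq> (\<lambda>z. c (SOME x. x \<in> A \<and> f x = z)) ` (f ` A)"
  proof
    fix y assume "y \<in> c ` A"
    then obtain x where x: "x \<in> A" "y = c x" by blast
    have "(SOME x'. x' \<in> A \<and> f x' = f x) \<in> A \<and> f (SOME x'. x' \<in> A \<and> f x' = f x) = f x"
      by (rule someI[of "\<lambda>x'. x' \<in> A \<and> f x' = f x" x]) (simp add: x)
    then have "c (SOME x'. x' \<in> A \<and> f x' = f x) = y" using assms(2) x by blast
    then show "y \<in> (\<lambda>z. c (SOME x. x \<in> A \<and> f x = z)) ` (f ` A)" using x by blast
  qed
qed (use assms in auto)

lemma finite_cones: "finite (cone ` carrier G)"
proof -
  let ?Bl = "{h \<in> carrier G. len h \<le> k}"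
  \<comment> \<open>The relative levels on the ball of radius \<open>k\<close>, as the graph of a
    function with values between \<open>- k\<close> and \<open>k\<close>.\<close>
  let ?f = "\<lambda>g. {(h, int (len (g \<otimes> h)) - len g) |h. h \<in> ?Bl}"
  have "?f ` carrier G \<subseteq> Pow (?Bl \<times> {- int k..int k})"
  proof (intro image_subsetI PowI subsetI)
    fix g z assume g: "g \<in> carrier G" and "z \<in> ?f g"
    then obtain h where h: "h \<in> carrier G" "len h \<le> k" "z = (h, int (len (g \<otimes> h)) - len g)" by blast
    have "len g \<le> len (g \<otimes> h) + len (inv h)"
      using len_mult[of "g \<otimes> h" "inv h"] g h by (simp add: m_assoc)
    then show "z \<in> ?Bl \<times> {- int k..int k}"
      using h len_mult[OF g h(1)] len_inv[OF h(1)] by auto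
  qed
  moreover have "finite (Pow (?Bl \<times> {- int k..int k}))" using finite_ball by simp
  ultimately have fin: "finite (?f ` carrier G)" by (rule finite_subset)
  show ?thesis
  proof (rule finite_image_factor[of ?f "carrier G" cone, OF fin])
    fix g g' assume g: "g \<in> carrier G" "g' \<in> carrier G" and eq: "?f g = ?f g'"
    have "int (len (g \<otimes> h)) - len g = int (len (g' \<otimes> h)) - len g'" if "h \<in> carrier G" "len h \<le> k" for h
    proof -
      have "(h, int (len (g \<otimes> h)) - len g) \<in> ?f g'" using that eq by blast
      then show ?thesis by auto
    qed
    then show "cone g = cone g'" using cone_subset g by (metis subset_antisym)
  qed
qed

end

section \<open>Elements as numbers\<close>

text \<open>Elements of the group as numbers in base \<open>B\<close>: digit \<open>0\<close> stands for the identity, digit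
  \<open>Suc a\<close> for the letter \<open>a\<close>. Hence leading zeros are harmless, and concatenation of words is arithmetic.\<close>

locale digit_group = fellow_travel_group +
  fixes B I :: nat
  assumes k_ge_2: "2 \<le> k" and I_def: "I = Suc k" and B_ge_2: "2 \<le> B" and letters_less: "a \<in> \<Lambda> \<Longrightarrow> Suc a < B"
begin

text \<open>Digits that stand for no letter count as the identity, so every list of digits, and
  later every number, has a value.\<close>

definition dval :: "nat \<Rightarrow> 'a" where
  "dval d = (if d \<noteq> 0 \<and> d - 1 \<in> \<Lambda> then \<l> (d - 1) else \<one>)"

definition lval :: "nat list \<Rightarrow> 'a" where
  "lval ds = foldr (\<lambda>d g. dval d \<otimes> g) ds \<one>"

abbreviation digits :: "nat list set" where
  "digits \<equiv> lists {..<B}"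

lemma dval_closed [simp]: "dval d \<in> carrier G"
  by (simp add: dval_def)

lemma dval_0 [simp]: "dval 0 = \<one>"
  by (simp add: dval_def)

lemma dval_Suc [simp]: "a \<in> \<Lambda> \<Longrightarrow> dval (Suc a) = \<l> a"
  by (simp add: dval_def)

lemma len_dval: "len (dval d) \<le> 1"
  using len_letter by (simp add: dval_def)

lemma lval_Nil [simp]: "lval [] = \<one>" and lval_Cons: "lval (d # ds) = dval d \<otimes> lval ds"
  by (simp_all add: lval_def)

lemma lval_closed [simp]: "lval ds \<in> carrier G"
  by (induction ds) (simp_all add: lval_Cons)

lemma lval_append: "lval (xs @ ys) = lval xs \<otimes> lval ys"
  by (induction xs) (simp_all add: lval_Cons m_assoc)

lemma lval_zeros [simp]: "lval (replicate n 0) = \<one>"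
  by (induction n) (simp_all add: lval_Cons)

lemma lval_map_Suc: "w \<in> lists \<Lambda> \<Longrightarrow> lval (map Suc w) = wval w"
  by (induction w) (auto simp: lval_Cons wval_Cons)

lemma map_Suc_digits: "w \<in> lists \<Lambda> \<Longrightarrow> map Suc w \<in> digits"
  using letters_less by auto

lemma zeros_digits [simp]: "replicate n 0 \<in> digits"
  using B_ge_2 by auto

text \<open>Padding with zeros reaches the length \<open>n\<close> exactly, so that blocks holding a
  difference can all have the same length.\<close>

lemma digits_ex:
  assumes "g \<in> carrier G" "len g \<le> n"
  shows "\<exists>ds\<in>digits. length ds = n \<and> lval ds = g"
proof -
  obtain w where w: "geod w" "wval w = g" using geod_ex assms by blast
  have "w \<in> lists \<Lambda>" using w geod_lists by blast
  then have "replicate (n - len g) 0 @ map Suc w \<in> digits"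
    using map_Suc_digits zeros_digits by (metis append_in_lists_conv)
  moreover have "length (replicate (n - len g) 0 @ map Suc w) = n"
    using w assms by (auto simp: geod_def)
  moreover have "lval (replicate (n - len g) 0 @ map Suc w) = g"
    using w assms by (simp add: lval_append lval_map_Suc geod_lists)
  ultimately show ?thesis by blast
qed

text \<open>The relations of a finite presentation as rewriting: \<open>I = k + 1\<close> digits
  have room for a difference of \<open>k\<close> digits and one digit read. Preserving the length
  keeps all intermediate words in a bounded range of numbers.\<close>

definition window :: "nat list \<Rightarrow> nat list \<Rightarrow> bool" where
  "window xs ys \<longleftrightarrow> (\<exists>p r r' s. xs = p @ r @ s \<and> ys = p @ r' @ s \<and> length r = length r' \<and> length r \<le> I \<and>
     lval r = lval r' \<and> xs \<in> digits \<and> ys \<in> digits)"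

lemma window_intro:
  assumes "length r = length r'" "length r \<le> I" "lval r = lval r'" "p @ r @ s \<in> digits" "p @ r' @ s \<in> digits"
  shows "window (p @ r @ s) (p @ r' @ s)"
  unfolding window_def using assms by blast

lemma window_sym: "window xs ys \<Longrightarrow> window ys xs"
  unfolding window_def by metis

lemma windows_sym: "window\<^sup>*\<^sup>* xs ys \<Longrightarrow> window\<^sup>*\<^sup>* ys xs"
  by (induction rule: rtranclp_induct) (auto intro: window_sym converse_rtranclp_into_rtranclp)

lemma window_context: "window xs ys \<Longrightarrow> p \<in> digits \<Longrightarrow> s \<in> digits \<Longrightarrow> window (p @ xs @ s) (p @ ys @ s)"
proof -
  assume "window xs ys" "p \<in> digits" "s \<in> digits"
  then obtain p' r r' s' where w: "xs = p' @ r @ s'" "ys = p' @ r' @ s'" "length r = length r'" "length r \<le> I"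
    "lval r = lval r'" "xs \<in> digits" "ys \<in> digits"
    unfolding window_def by blast
  have "window ((p @ p') @ r @ (s' @ s)) ((p @ p') @ r' @ (s' @ s))"
    using w \<open>p \<in> digits\<close> \<open>s \<in> digits\<close> by (intro window_intro) simp_all
  then show ?thesis using w(1,2) by simp
qed

lemma windows_context:
  "window\<^sup>*\<^sup>* xs ys \<Longrightarrow> p \<in> digits \<Longrightarrow> s \<in> digits \<Longrightarrow> window\<^sup>*\<^sup>* (p @ xs @ s) (p @ ys @ s)"
  by (induction rule: rtranclp_induct) (auto intro: window_context rtranclp.rtrancl_into_rtrancl)

text \<open>A block of \<open>r\<close> digits holding the difference of the two prefixes is moved along the word.\<close>

lemma windows_synchronous:
  assumes V: "V \<in> digits" "V' \<in> digits" "length V = length V'" "lval V = lval V'" and r: "r < I"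
    and near: "\<And>i. i \<le> length V \<Longrightarrow> ldist (lval (take i V')) (lval (take i V)) \<le> r"
  shows "window\<^sup>*\<^sup>* (replicate r 0 @ V) (V' @ replicate r 0)"
proof -
  \<comment> \<open>The difference of the prefixes of length \<open>i\<close>, carried as a block of
    \<open>r\<close> digits at the seam between the two words.\<close>
  let ?c = "\<lambda>i. inv (lval (take i V')) \<otimes> lval (take i V)"
  have "\<exists>c\<in>digits. length c = r \<and> lval c = ?c i \<and> window\<^sup>*\<^sup>* (replicate r 0 @ V) (take i V' @ c @ drop i V)"
    if "i \<le> length V" for i
    using that
  proof (induction i)
    case 0
    show ?case by (rule bexI[of _ "replicate r 0"]) simp_all
  next
    case (Suc i)
    then obtain c where c: "c \<in> digits" "length c = r" "lval c = ?c i"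
      "window\<^sup>*\<^sup>* (replicate r 0 @ V) (take i V' @ c @ drop i V)"
      using Suc.IH[OF Suc_leD[OF Suc.prems]] by blast
    obtain c' where c': "c' \<in> digits" "length c' = r" "lval c' = ?c (Suc i)"
      using digits_ex[of "?c (Suc i)" r] near[OF Suc.prems] by (auto simp: ldist_def)
    have i: "i < length V" "i < length V'" using Suc.prems V by auto
    have dV: "drop i V = V ! i # drop (Suc i) V" "take (Suc i) V = take i V @ [V ! i]"
      "take (Suc i) V' = take i V' @ [V' ! i]"
      using i by (simp_all add: Cons_nth_drop_Suc take_Suc_conv_app_nth)
    \<comment> \<open>The block moves by one position: it absorbs the next digit of \<open>V\<close>
      and emits that of \<open>V'\<close>, which touches \<open>r + 1 \<le> I\<close>
      digits.\<close>
    have "lval (c @ [V ! i]) = inv (lval (take i V')) \<otimes> lval (take (Suc i) V)"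
      using c(3) by (simp add: dV lval_append lval_Cons m_assoc)
    also have "\<dots> = lval ([V' ! i] @ c')"
      using c'(3) by (simp add: dV lval_append lval_Cons inv_mult_group m_assoc mult_inv_cancel)
    finally have eq: "lval (c @ [V ! i]) = lval ([V' ! i] @ c')" .
    have tdig: "take i V' \<in> digits" "drop (Suc i) V \<in> digits" "V ! i < B" "V' ! i < B"
    proof -
      have "set (take i V') \<subseteq> {..<B}" "set (drop (Suc i) V) \<subseteq> {..<B}"
        using V set_take_subset[of i V'] set_drop_subset[of "Suc i" V] by (auto simp: lists_eq_set)
      then show "take i V' \<in> digits" "drop (Suc i) V \<in> digits" by (auto simp: lists_eq_set)
      show "V ! i < B" "V' ! i < B"
        using V(1,2) nth_mem[OF i(1)] nth_mem[OF i(2)] by (auto simp: lists_eq_set)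
    qed
    have "window (take i V' @ (c @ [V ! i]) @ drop (Suc i) V) (take i V' @ ([V' ! i] @ c') @ drop (Suc i) V)"
    proof (rule window_intro[OF _ _ eq])
      show "length (c @ [V ! i]) = length ([V' ! i] @ c')" "length (c @ [V ! i]) \<le> I"
        using c(2) c'(2) r by simp_all
      show "take i V' @ (c @ [V ! i]) @ drop (Suc i) V \<in> digits" "take i V' @ ([V' ! i] @ c') @ drop (Suc i) V \<in> digits"
        using c(1) c'(1) tdig by simp_all
    qed
    then have "window (take i V' @ c @ drop i V) (take (Suc i) V' @ c' @ drop (Suc i) V)"
      by (simp add: dV)
    with c(4) have "window\<^sup>*\<^sup>* (replicate r 0 @ V) (take (Suc i) V' @ c' @ drop (Suc i) V)"
      by (rule rtranclp.rtrancl_into_rtrancl)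
    with c' show ?case by blast
  qed
  from this[OF order_refl] obtain c where c: "c \<in> digits" "length c = r" "lval c = ?c (length V)"
    "window\<^sup>*\<^sup>* (replicate r 0 @ V) (take (length V) V' @ c @ drop (length V) V)"
    by blast
  have c1: "lval c = \<one>" using c(3) V by simp
  have c4: "window\<^sup>*\<^sup>* (replicate r 0 @ V) (V' @ c)" using c(4) V(3) by simp
  \<comment> \<open>At the end the difference is the identity, so the block may be cleared.\<close>
  have "window (V' @ c @ []) (V' @ replicate r 0 @ [])"
  proof (rule window_intro)
    show "lval c = lval (replicate r 0)" using c1 by simp
    show "V' @ c @ [] \<in> digits" "V' @ replicate r 0 @ [] \<in> digits"
      using c(1) V(2) zeros_digits[of r] by simp_all
  qed (use c(2) r in simp_all)
  then have "window (V' @ c) (V' @ replicate r 0)" by simp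
  with c4 show ?thesis by (rule rtranclp.rtrancl_into_rtrancl)
qed

text \<open>Synchronous rewriting of a word into itself, where all differences are the
  identity.\<close>

lemma windows_commute:
  "V \<in> digits \<Longrightarrow> r < I \<Longrightarrow> window\<^sup>*\<^sup>* (replicate r 0 @ V) (V @ replicate r 0)"
  by (rule windows_synchronous) auto

text \<open>Digits are fed in one at a time: a geodesic word followed by a digit fellow travels with
  a geodesic word for the product, so windows turn one into the other. The \<open>k\<close> leading
  zeros are the space for the difference block.\<close>

lemma windows_to_geod:
  assumes "ds \<in> digits" "geod u" "wval u = lval ds"
  shows "length u \<le> length ds \<and>
    window\<^sup>*\<^sup>* (replicate k 0 @ ds) (replicate k 0 @ replicate (length ds - length u) 0 @ map Suc u)"
  using assms
proof (induction ds arbitrary: u rule: rev_induct)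
  case Nil
  then have "u = []" using geod_one by simp
  then show ?case by simp
next
  case (snoc d ds)
  obtain v where v: "geod v" "wval v = lval ds" using geod_ex lval_closed by blast
  have ds: "ds \<in> digits" "d < B" using snoc.prems by auto
  have IH: "length v \<le> length ds"
    "window\<^sup>*\<^sup>* (replicate k 0 @ ds) (replicate k 0 @ replicate (length ds - length v) 0 @ map Suc v)"
    using snoc.IH[OF ds(1) v] by auto
  have L: "u \<in> lists \<Lambda>" "v \<in> lists \<Lambda>" using snoc.prems v geod_lists by auto
  have uval: "wval u = wval v \<otimes> dval d" using snoc.prems v by (simp add: lval_append lval_Cons)
  have near: "ldist (wval u) (wval v) \<le> 1"
  proof -
    have "ldist (wval v) (wval u) = len (dval d)" unfolding uval using L by (intro ldist_mult_right) auto
    then show ?thesis using len_dval[of d] ldist_sym[OF wval_closed[OF L(1)] wval_closed[OF L(2)]] by simp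
  qed
  have lu: "length u \<le> length v + 1"
  proof -
    have "len (wval u) \<le> len (wval v) + len (dval d)" unfolding uval using L by (intro len_mult) auto
    then show ?thesis using len_dval[of d] geod_len[OF v(1)] geod_len[OF snoc.prems(2)] by linarith
  qed
  have lv: "length v \<le> length u + 1"
  proof -
    have "wval u \<otimes> (inv (wval u) \<otimes> wval v) = wval v"
      using L by (intro mult_inv_cancel) auto
    moreover have "len (wval u \<otimes> (inv (wval u) \<otimes> wval v)) \<le> len (wval u) + ldist (wval u) (wval v)"
      unfolding ldist_def using L by (intro len_mult) auto
    ultimately show ?thesis using near geod_len[OF v(1)] geod_len[OF snoc.prems(2)] by simp
  qed
  define a where "a = length ds - length v"
  \<comment> \<open>The number of zeros after \<open>u\<close> that equalises the lengths. The
    lengths of \<open>u\<close> and \<open>v\<close> differ by at most 1, so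
    \<open>e \<le> 2\<close>, which is below \<open>I\<close> because \<open>k\<close> is at least
    2.\<close>
  define e where "e = length v + 1 - length u"
  have e: "e < I" "e + length u = length v + 1" using lu lv k_ge_2 by (auto simp: e_def I_def)
  have dig: "map Suc v @ [d] \<in> digits" "map Suc u @ replicate e 0 \<in> digits" "map Suc u \<in> digits"
    using map_Suc_digits[OF L(1)] map_Suc_digits[OF L(2)] ds(2) zeros_digits[of e]
    by (simp_all only: append_in_lists_conv Cons_in_lists_iff lists.Nil lessThan_iff simp_thms)
  have total: "lval (map Suc v @ [d]) = lval (map Suc u @ replicate e 0)"
    using uval L by (simp add: lval_append lval_Cons lval_map_Suc)
  have 1: "window\<^sup>*\<^sup>* (replicate k 0 @ map Suc v @ [d]) ((map Suc u @ replicate e 0) @ replicate k 0)"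
  proof (rule windows_synchronous[OF dig(1,2) _ total])
    fix i assume i: "i \<le> length (map Suc v @ [d])"
    have t: "take j x \<in> lists \<Lambda>" if "x \<in> lists \<Lambda>" for j x
      using that set_take_subset[of j x] by (auto simp: lists_eq_set)
    show "ldist (lval (take i (map Suc u @ replicate e 0))) (lval (take i (map Suc v @ [d]))) \<le> k"
    proof (cases "i \<le> length v")
      case True
      have "lval (take i (map Suc v @ [d])) = wval (take i v)"
        using True lval_map_Suc[OF t[OF L(2)], of i] by (simp add: take_map)
      moreover have "lval (take i (map Suc u @ replicate e 0)) = wval (take i u)"
        using lval_map_Suc[OF t[OF L(1)], of i] wval_closed[OF t[OF L(1)], of i]
        by (simp add: take_map lval_append take_replicate)
      ultimately show ?thesis using fellow_travel[OF snoc.prems(2) v(1) near, of i] by simp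
    next
      case False
      then have "take i (map Suc v @ [d]) = map Suc v @ [d]" using i by simp
      moreover have "take i (map Suc u @ replicate e 0) = map Suc u @ replicate e 0"
        using False e by simp
      ultimately show ?thesis using total by simp
    qed
  qed (use e I_def in auto)
  \<comment> \<open>The \<open>k\<close> zeros return to the front; after that the \<open>e\<close>
    zeros behind \<open>u\<close> are moved in front of it.\<close>
  have 2: "window\<^sup>*\<^sup>* ((map Suc u @ replicate e 0) @ replicate k 0) (replicate k 0 @ map Suc u @ replicate e 0)"
    using windows_sym[OF windows_commute[OF dig(2), of k]] by (simp add: I_def)
  have 3: "window\<^sup>*\<^sup>* (replicate k 0 @ (map Suc u @ replicate e 0) @ []) (replicate k 0 @ (replicate e 0 @ map Suc u) @ [])"
    using windows_sym[OF windows_commute[OF dig(3) e(1)]] by (intro windows_context) auto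
  have vu: "window\<^sup>*\<^sup>* (replicate k 0 @ map Suc v @ [d]) (replicate k 0 @ replicate e 0 @ map Suc u)"
    using rtranclp_trans[OF rtranclp_trans[OF 1 2]] 3 by simp
  have swap: "replicate a 0 @ replicate k 0 = replicate k 0 @ replicate a (0::nat)"
    by (simp flip: replicate_add add: add.commute)
  have vu': "window\<^sup>*\<^sup>* (replicate a 0 @ (replicate k 0 @ map Suc v @ [d]) @ [])
    (replicate a 0 @ (replicate k 0 @ replicate e 0 @ map Suc u) @ [])"
    by (intro windows_context vu zeros_digits) simp
  have 4: "window\<^sup>*\<^sup>* (replicate k 0 @ replicate a 0 @ map Suc v @ [d])
    (replicate k 0 @ replicate a 0 @ replicate e 0 @ map Suc u)"
  proof -
    have eq: "replicate a 0 @ (replicate k 0 @ x) @ [] = replicate k 0 @ replicate a 0 @ x" for x :: "nat list"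
      using arg_cong[OF swap, of "\<lambda>y. y @ x"] by simp
    show ?thesis using vu' unfolding eq .
  qed
  have "window\<^sup>*\<^sup>* ([] @ (replicate k 0 @ ds) @ [d]) ([] @ (replicate k 0 @ replicate a 0 @ map Suc v) @ [d])"
    using IH(2) ds unfolding a_def by (intro windows_context) auto
  then have "window\<^sup>*\<^sup>* (replicate k 0 @ ds @ [d]) (replicate k 0 @ replicate a 0 @ map Suc v @ [d])"
    by simp
  then have "window\<^sup>*\<^sup>* (replicate k 0 @ ds @ [d]) (replicate k 0 @ replicate a 0 @ replicate e 0 @ map Suc u)"
    using 4 by (rule rtranclp_trans)
  moreover have "replicate (length (ds @ [d]) - length u) (0::nat) = replicate a 0 @ replicate e 0"
    using IH(1) e(2) unfolding replicate_add[symmetric] a_def by (intro arg_cong[of _ _ "\<lambda>n. replicate n 0"]) simp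
  ultimately show ?case using lu IH(1) by simp
qed

text \<open>Both words are rewritten into the same padded geodesic word.\<close>

lemma windows_connect:
  assumes "xs \<in> digits" "ys \<in> digits" "length xs = length ys" "lval xs = lval ys"
  shows "window\<^sup>*\<^sup>* (replicate k 0 @ xs) (replicate k 0 @ ys)"
proof -
  obtain u where u: "geod u" "wval u = lval xs" using geod_ex lval_closed by blast
  show ?thesis
    using windows_to_geod[OF assms(1) u] windows_to_geod[OF assms(2) u(1)] u(2) assms(3,4)
    by (metis windows_sym rtranclp_trans)
qed

section \<open>Digit words as numbers in base \<open>B\<close>\<close>

definition num :: "nat list \<Rightarrow> nat" where
  "num ds = foldl (\<lambda>n d. n * B + d) 0 ds"

lemma num_Nil [simp]: "num [] = 0" and num_snoc: "num (ds @ [d]) = num ds * B + d"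
  by (simp_all add: num_def)

lemma num_append: "num (xs @ ys) = num xs * B ^ length ys + num ys"
proof (induction ys rule: rev_induct)
  case (snoc d ys)
  have "num (xs @ ys @ [d]) = num ((xs @ ys) @ [d])" by simp
  also have "\<dots> = num xs * B ^ length (ys @ [d]) + num (ys @ [d])"
    unfolding num_snoc snoc by (simp add: algebra_simps)
  finally show ?case .
qed simp

lemma num_less: "ds \<in> digits \<Longrightarrow> num ds < B ^ length ds"
proof (induction ds rule: rev_induct)
  case (snoc d ds)
  then have "num ds + 1 \<le> B ^ length ds" "d < B" by auto
  then have "num ds * B + d < (num ds + 1) * B" by (simp add: algebra_simps)
  also have "\<dots> \<le> B ^ length ds * B" using \<open>num ds + 1 \<le> B ^ length ds\<close> by (rule mult_right_mono) simp
  finally show ?case by (simp add: num_snoc mult.commute)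
qed simp

lemma num_surj: "n < B ^ j \<Longrightarrow> \<exists>ds\<in>digits. length ds = j \<and> num ds = n"
proof (induction j arbitrary: n)
  case 0
  then show ?case by (intro bexI[of _ "[]"]) auto
next
  case (Suc j)
  have B: "0 < B" using B_ge_2 by simp
  have "n div B < B ^ j" using Suc.prems B by (simp add: div_less_iff_less_mult mult.commute)
  then obtain ds where ds: "ds \<in> digits" "length ds = j" "num ds = n div B" using Suc.IH by blast
  then show ?case using B
    by (intro bexI[of _ "ds @ [n mod B]"]) (auto simp: num_snoc)
qed

lemma num_zeros [simp]: "num (replicate n 0) = 0"
  by (induction n) (simp_all add: num_snoc replicate_append_same[symmetric])

function nval :: "nat \<Rightarrow> 'a" where
  "nval n = (if n = 0 then \<one> else nval (n div B) \<otimes> dval (n mod B))"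
  by auto
termination
  by (relation "Wellfounded.measure id") (use B_ge_2 in auto)

declare nval.simps [simp del]

lemma nval_0 [simp]: "nval 0 = \<one>"
  by (simp add: nval.simps)

lemma nval_closed [simp]: "nval n \<in> carrier G"
proof (induction n rule: nval.induct)
  case (1 n)
  then show ?case by (subst nval.simps) auto
qed

lemma nval_digit: "d < B \<Longrightarrow> nval (n * B + d) = nval n \<otimes> dval d"
  using B_ge_2 by (subst nval.simps) auto

lemma nval_num: "ds \<in> digits \<Longrightarrow> nval (num ds) = lval ds"
  by (induction ds rule: rev_induct) (auto simp: num_snoc nval_digit lval_append lval_Cons)

lemma nval_concat:
  assumes "s < B ^ j"
  shows "nval (p * B ^ j + s) = nval p \<otimes> nval s"
proof -
  obtain ds where ds: "ds \<in> digits" "length ds = j" "num ds = s" using num_surj[OF assms] by blast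
  have "p < B ^ p" using B_ge_2 less_exp[of p] by (meson less_le_trans power_mono le_trans zero_le)
  then obtain es where es: "es \<in> digits" "num es = p" using num_surj by blast
  have "num (es @ ds) = p * B ^ j + s" using ds es by (simp add: num_append)
  moreover have "es @ ds \<in> digits" using ds es by auto
  ultimately show ?thesis using nval_num[of "es @ ds"] nval_num[of es] nval_num[of ds] ds es by (simp add: lval_append)
qed

lemma nval_letter: "a \<in> \<Lambda> \<Longrightarrow> nval (Suc a) = \<l> a"
  using nval_digit[of "Suc a" 0] letters_less by simp

lemma nval_ex: "g \<in> carrier G \<Longrightarrow> len g \<le> j \<Longrightarrow> \<exists>n<B ^ j. nval n = g"
  using digits_ex num_less nval_num by metis

text \<open>The word problem for words of at most \<open>I\<close> digits, which is a finite
  table.\<close>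

definition EQ :: "(nat \<times> nat) set" where
  "EQ = {(r, r'). r < B ^ I \<and> r' < B ^ I \<and> nval r = nval r'}"

text \<open>The bounds on the quantifiers make this relation decidable.\<close>

definition win :: "nat \<Rightarrow> nat \<Rightarrow> bool" where
  "win n n' \<longleftrightarrow> (\<exists>j<Suc (n + n'). \<exists>p<Suc n. \<exists>s<Suc n. \<exists>r<Suc n. \<exists>r'<Suc n'.
     n = (p * B ^ I + r) * B ^ j + s \<and> n' = (p * B ^ I + r') * B ^ j + s \<and> s < B ^ j \<and> (r, r') \<in> EQ)"

lemma win_nval: "win n n' \<Longrightarrow> nval n = nval n'"
  unfolding win_def EQ_def by (auto simp: nval_concat)

text \<open>A window of fewer than \<open>I\<close> digits is enlarged to exactly \<open>I\<close>
  by digits on its left, which are zeros where the word has none. The alternative of equal numbers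
  covers the windows so far to the left that the bound on \<open>j\<close> in \<open>win\<close>
  fails.\<close>

lemma win_num:
  assumes "window xs ys"
  shows "num xs = num ys \<or> win (num xs) (num ys)"
proof -
  obtain p r r' s where w: "xs = p @ r @ s" "ys = p @ r' @ s" "length r = length r'" "length r \<le> I"
     "lval r = lval r'" "xs \<in> digits" "ys \<in> digits"
    using assms unfolding window_def by blast
  have dig: "p \<in> digits" "r \<in> digits" "r' \<in> digits" "s \<in> digits" using w by auto
  define i j where "i = length r" and "j = length s"
  \<comment> \<open>\<open>t\<close> holds the digits that the enlarged window takes in,
    \<open>q\<close> the rest of \<open>p\<close>.\<close>
  define q t where "q = num p div B ^ (I - i)" and "t = num p mod B ^ (I - i)"
  have B0: "0 < B" using B_ge_2 by simp
  have t: "t < B ^ (I - i)" using B0 by (simp add: t_def)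
  have pw: "B ^ (I - i) * B ^ i = B ^ I" using w(4) by (simp add: i_def flip: power_add)
  have np: "num p = q * B ^ (I - i) + t" unfolding q_def t_def by (rule div_mult_mod_eq[symmetric])
  define R where "R x = t * B ^ i + num x" for x
  have R: "R x < B ^ I" "nval (R x) = nval t \<otimes> lval x" if "x \<in> digits" "length x = i" for x
  proof -
    have x: "num x < B ^ i" using num_less that by blast
    have "R x < (t + 1) * B ^ i" unfolding R_def using x by (simp add: algebra_simps)
    also have "\<dots> \<le> B ^ (I - i) * B ^ i" using t by (intro mult_right_mono) auto
    finally show "R x < B ^ I" using pw by simp
    show "nval (R x) = nval t \<otimes> lval x" unfolding R_def using nval_concat[OF x] nval_num that by simp
  qed
  have n: "num (p @ x @ s) = (q * B ^ I + R x) * B ^ j + num s" if "length x = i" for x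
  proof -
    have "num (p @ x @ s) = (num p * B ^ i + num x) * B ^ j + num s"
      using that by (simp add: num_append j_def i_def algebra_simps power_add)
    also have "num p * B ^ i = q * B ^ I + t * B ^ i" unfolding np pw[symmetric] by (simp add: algebra_simps)
    finally show ?thesis by (simp add: R_def algebra_simps)
  qed
  have nx: "num xs = (q * B ^ I + R r) * B ^ j + num s" and ny: "num ys = (q * B ^ I + R r') * B ^ j + num s"
    using n[of r] n[of r'] w i_def by auto
  have eq: "(R r, R r') \<in> EQ" using R[of r] R[of r'] w dig by (auto simp: EQ_def i_def)
  have s: "num s < B ^ j" using num_less dig j_def by blast
  have le: "y \<le> (x * B ^ e + y) * B ^ f" "x \<le> (x * B ^ e + y) * B ^ f" for x y e f
  proof -
    have 1: "1 \<le> B ^ e" "1 \<le> B ^ f" using B0 by auto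
    have "x * 1 \<le> x * B ^ e" using 1 by (intro mult_left_mono) auto
    then have "x \<le> x * B ^ e + y" "y \<le> x * B ^ e + y" unfolding mult_1_right by linarith+
    moreover have "(x * B ^ e + y) * 1 \<le> (x * B ^ e + y) * B ^ f" using 1 by (intro mult_left_mono) auto
    ultimately show "y \<le> (x * B ^ e + y) * B ^ f" "x \<le> (x * B ^ e + y) * B ^ f"
      unfolding mult_1_right by (blast intro: le_trans)+
  qed
  show ?thesis
  proof (cases "j < Suc (num xs + num ys)")
    case True
    have "q < Suc (num xs)" "num s < Suc (num xs)" "R r < Suc (num xs)" "R r' < Suc (num ys)"
      using le[of "R r" q I j] le[of q I "R r" j] le[of "R r'" q I j] unfolding nx ny by linarith+
    then show ?thesis unfolding win_def using True nx ny s eq by blast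
  next
    case False
    \<comment> \<open>Both numbers are now below \<open>B ^ j\<close>, so everything to the left of
      the last \<open>j\<close> digits, the window included, is 0.\<close>
    have "j < B ^ j" using B_ge_2 less_exp[of j] by (meson less_le_trans power_mono le_trans zero_le)
    then have "num xs < B ^ j" "num ys < B ^ j" using False by auto
    moreover have "y = 0" if "y * B ^ j + num s < B ^ j" for y
    proof (rule ccontr)
      assume "y \<noteq> 0"
      then have "1 * B ^ j \<le> y * B ^ j" by (intro mult_right_mono) auto
      with that show False by simp
    qed
    ultimately have "q * B ^ I + R r = 0" "q * B ^ I + R r' = 0" unfolding nx ny by blast+
    then show ?thesis unfolding nx ny by simp
  qed
qed

text \<open>The rewriting needs \<open>k\<close> digits of working space, so it runs through numbers
  of up to \<open>j + k\<close> digits.\<close>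

lemma win_connect:
  assumes "n < B ^ j" "n' < B ^ j" "nval n = nval n'"
  shows "(\<lambda>x y. win x y \<and> x < B ^ (j + k) \<and> y < B ^ (j + k))\<^sup>*\<^sup>* n n'"
proof -
  obtain xs where xs: "xs \<in> digits" "length xs = j" "num xs = n" using num_surj assms by blast
  obtain ys where ys: "ys \<in> digits" "length ys = j" "num ys = n'" using num_surj assms by blast
  have "window\<^sup>*\<^sup>* (replicate k 0 @ xs) (replicate k 0 @ ys)"
    using windows_connect xs ys assms nval_num by metis
  then have "(\<lambda>x y. win x y \<and> x < B ^ (j + k) \<and> y < B ^ (j + k))\<^sup>*\<^sup>* (num (replicate k 0 @ xs)) (num (replicate k 0 @ ys))
      \<and> length (replicate k 0 @ ys) = j + k"
  proof (induction rule: rtranclp_induct)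
    case base
    then show ?case using xs ys by simp
  next
    case (step y z)
    have "length z = length y" using step.hyps(2) unfolding window_def by auto
    moreover have "y \<in> digits" "z \<in> digits" using step.hyps(2) unfolding window_def by auto
    ultimately show ?case using win_num[OF step.hyps(2)] num_less[of y] num_less[of z] step.IH
      by (auto intro: rtranclp.rtrancl_into_rtrancl)
  qed
  then show ?thesis using xs ys by (simp add: num_append)
qed

end

section \<open>Certificates for complements\<close>

primrec path :: "(nat \<times> nat \<times> nat) set \<Rightarrow> nat \<Rightarrow> nat list \<Rightarrow> nat \<Rightarrow> bool" where
  "path T p [] q \<longleftrightarrow> p = q"
| "path T p (a # w) q \<longleftrightarrow> (\<exists>r. (p, a, r) \<in> T \<and> path T r w q)"

lemma path_append: "path T p (u @ v) q \<longleftrightarrow> (\<exists>r. path T p u r \<and> path T r v q)"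
  by (induction u arbitrary: p) auto

lemma path_snoc: "path T p (u @ [a]) q \<longleftrightarrow> (\<exists>r. path T p u r \<and> (r, a, q) \<in> T)"
  by (simp add: path_append)

lemma path_lists: "path T p w q \<Longrightarrow> T \<subseteq> UNIV \<times> L \<times> UNIV \<Longrightarrow> w \<in> lists L"
  by (induction w arbitrary: p) auto

text \<open>The cone type of the identity is number 0 because automata start in state 0, which is
  the code of the pair of 0 and 0.\<close>

locale cone_coded_group = digit_group +
  fixes \<kappa> :: "nat list set \<Rightarrow> nat"
  assumes inj_code: "inj_on \<kappa> (cone ` carrier G)" and code_one: "\<kappa> (cone \<one>) = 0"
begin

definition D :: "(nat \<times> nat \<times> nat) set" where
  "D = {(\<kappa> (cone g), b, \<kappa> (cone (g \<otimes> \<l> b))) |g b. g \<in> carrier G \<and> [b] \<in> cone g}"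

text \<open>Together with \<open>RT\<close> this tells how the quotient of two geodesic words
  changes when the first or the second one is extended by a letter.\<close>

definition LT :: "(nat \<times> nat \<times> nat) set" where
  "LT = {(b, n, n'). b \<in> \<Lambda> \<and> n < B ^ I \<and> n' < B ^ I \<and> nval n' = inv (\<l> b) \<otimes> nval n}"

definition RT :: "(nat \<times> nat \<times> nat) set" where
  "RT = {(n, b, n'). b \<in> \<Lambda> \<and> n < B ^ I \<and> n' < B ^ I \<and> nval n' = nval n \<otimes> \<l> b}"

definition ONE :: "nat set" where
  "ONE = {n. n < B ^ I \<and> nval n = \<one>}"

definition INV :: "(nat \<times> nat) set" where
  "INV = (\<lambda>b. (b, Suc (\<iota> b))) ` \<Lambda>"

text \<open>A change of reference point from \<open>v\<close> to \<open>v\<close> followed by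
  \<open>b\<close>, which multiplies displacements by the inverse of \<open>b\<close> on the left.
  Zeros may stand between the new digit and \<open>n\<close>, since \<open>j\<close> only has to be
  large enough.\<close>

definition prep :: "nat \<Rightarrow> nat \<Rightarrow> nat \<Rightarrow> bool" where
  "prep b n n' \<longleftrightarrow> (\<exists>j<Suc n'. \<exists>c<Suc n'. (b, c) \<in> INV \<and> n < B ^ j \<and> n' = c * B ^ j + n)"

text \<open>Displacements are identified by single windows and not by a table of products, since
  such a table would depend on the unknown radius of the ball.\<close>

definition move :: "(nat \<times> nat \<times> nat) set \<Rightarrow> nat \<Rightarrow> nat \<Rightarrow> nat \<Rightarrow> nat \<Rightarrow> bool" where
  "move T q n q' n' \<longleftrightarrow> (\<exists>a<Suc n'. (q, a, q') \<in> T \<and> n' = n * B + Suc a) \<or> (q' = q \<and> win n n')"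

definition reach :: "nat set \<Rightarrow> (nat \<times> nat \<times> nat) set \<Rightarrow> nat \<Rightarrow> 'a set" where
  "reach J T q = {wval w |w p. p \<in> J \<and> path T p w q}"

text \<open>A certificate for the complement of the subset accepted by the automaton \<open>(mI, mA, mT)\<close>
  consists of a deterministic automaton with states \<open>St\<close>, accepting states \<open>F\<close> and transitions \<open>Tr\<close>
  that reads exactly the geodesic words (the first component of a state is a cone type), and of
  \<^item> facts \<open>(s, q, n, r) \<in> \<Phi>\<close>, claiming that \<open>v\<close> times the element written \<open>n\<close> is reached at \<open>q\<close>
    whenever the geodesic word \<open>v\<close> leads to \<open>s\<close> (\<open>r\<close> is a rank that makes justifications well-founded),
  \<^item> triples \<open>(s, s', n) \<in> Z\<close> for all pairs of geodesic words whose quotient is written \<open>n\<close> and that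
    fellow travel,
  \<^item> a set \<open>U\<close> containing the states from which an accepting one can be reached.\<close>

definition justified :: "nat \<Rightarrow> nat set \<Rightarrow> (nat \<times> nat \<times> nat) set \<Rightarrow> (nat \<times> nat \<times> nat) set \<Rightarrow>
    (nat \<times> nat \<times> nat \<times> nat) set \<Rightarrow> bool" where
  "justified W mI mT Tr \<Phi> \<longleftrightarrow> (\<forall>s<W. \<forall>q<W. \<forall>n<W. \<forall>r<W. (s, q, n, r) \<in> \<Phi> \<longrightarrow>
     (\<exists>q0<W. \<exists>n0<W. \<exists>r0<W. (s, q0, n0, r0) \<in> \<Phi> \<and> r0 < r \<and> move mT q0 n0 q n) \<or>
     ((s = 0 \<longrightarrow> n = 0 \<and> q \<in> mI) \<and>
      (\<forall>s1<W. \<forall>b<W. (s1, b, s) \<in> Tr \<longrightarrow> (\<exists>n1<W. \<exists>r1<W. (s1, q, n1, r1) \<in> \<Phi> \<and> prep b n1 n))))"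

text \<open>The component \<open>y\<close> of a state carries arbitrary further information.
  Determinism and totality over the transitions between cone types make the automaton read each
  geodesic word along exactly one path from 0, and no other word.\<close>

definition cone_automaton :: "nat \<Rightarrow> nat set \<Rightarrow> (nat \<times> nat \<times> nat) set \<Rightarrow> bool" where
  "cone_automaton W St Tr \<longleftrightarrow> 0 \<in> St \<and>
     (\<forall>s<W. \<forall>b<W. \<forall>t<W. (s, b, t) \<in> Tr \<longrightarrow> s \<in> St \<and> t \<in> St \<and>
       (\<exists>d<W. \<exists>y<W. \<exists>d'<W. \<exists>y'<W. s = prod_encode (d, y) \<and> t = prod_encode (d', y') \<and> (d, b, d') \<in> D)) \<and>
     (\<forall>s<W. \<forall>b<W. \<forall>t<W. \<forall>t'<W. (s, b, t) \<in> Tr \<and> (s, b, t') \<in> Tr \<longrightarrow> t = t') \<and>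
     (\<forall>d<W. \<forall>y<W. \<forall>b<W. \<forall>d'<W. prod_encode (d, y) \<in> St \<and> (d, b, d') \<in> D \<longrightarrow>
       (\<exists>y'<W. (prod_encode (d, y), b, prod_encode (d', y')) \<in> Tr))"

text \<open>Either word may be extended alone, so a simultaneous step is two steps through a
  quotient of length at most \<open>k + 1\<close>. All numbers of a quotient that the tables offer
  have to be present, not just one of them.\<close>

definition pair_closed :: "nat \<Rightarrow> (nat \<times> nat \<times> nat) set \<Rightarrow> (nat \<times> nat \<times> nat) set \<Rightarrow> bool" where
  "pair_closed W Tr Z \<longleftrightarrow> (\<forall>n<W. n \<in> ONE \<longrightarrow> (0, 0, n) \<in> Z) \<and>
     (\<forall>s<W. \<forall>s'<W. \<forall>n<W. \<forall>b<W. \<forall>t<W. \<forall>n'<W.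
       ((s, s', n) \<in> Z \<and> (s, b, t) \<in> Tr \<and> (b, n, n') \<in> LT \<longrightarrow> (t, s', n') \<in> Z) \<and>
       ((s, s', n) \<in> Z \<and> (s', b, t) \<in> Tr \<and> (n, b, n') \<in> RT \<longrightarrow> (s, t, n') \<in> Z))"

text \<open>The last two conditions make the facts with displacement 0 complete at states in
  \<open>U\<close>: such facts are present at the start and pass along every step of the input
  automaton between geodesic words that \<open>Z\<close> relates.\<close>

definition certificate :: "nat \<Rightarrow> nat set \<Rightarrow> nat set \<Rightarrow> (nat \<times> nat \<times> nat) set \<Rightarrow> nat set \<Rightarrow> nat set \<Rightarrow>
    (nat \<times> nat \<times> nat) set \<Rightarrow> (nat \<times> nat \<times> nat \<times> nat) set \<Rightarrow> (nat \<times> nat \<times> nat) set \<Rightarrow> nat set \<Rightarrow> bool" where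
  "certificate W mI mA mT St F Tr \<Phi> Z U \<longleftrightarrow>
     cone_automaton W St Tr \<and> justified W mI mT Tr \<Phi> \<and> pair_closed W Tr Z \<and>
     (\<forall>s<W. s \<in> F \<longleftrightarrow> s \<in> St \<and> \<not> (\<exists>q<W. \<exists>r<W. q \<in> mA \<and> (s, q, 0, r) \<in> \<Phi>)) \<and>
     (\<forall>q<W. q \<in> mA \<longrightarrow> q \<in> U) \<and>
     (\<forall>q<W. \<forall>a<W. \<forall>q'<W. (q, a, q') \<in> mT \<and> q' \<in> U \<longrightarrow> q \<in> U) \<and>
     (\<forall>q<W. q \<in> mI \<and> q \<in> U \<longrightarrow> (\<exists>r<W. (0, q, 0, r) \<in> \<Phi>)) \<and>
     (\<forall>s<W. \<forall>s'<W. \<forall>a<W. \<forall>q<W. \<forall>q'<W. \<forall>r<W.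
       (s, s', Suc a) \<in> Z \<and> (q, a, q') \<in> mT \<and> q' \<in> U \<and> (s, q, 0, r) \<in> \<Phi> \<longrightarrow> (\<exists>r'<W. (s', q', 0, r') \<in> \<Phi>))"

lemma reach_initial: "q \<in> J \<Longrightarrow> \<one> \<in> reach J T q"
proof -
  assume "q \<in> J"
  then have "\<one> = wval [] \<and> q \<in> J \<and> path T q [] q" by simp
  then show ?thesis unfolding reach_def by blast
qed

lemma reach_step:
  assumes "g \<in> reach J T q" "(q, a, q') \<in> T" "T \<subseteq> UNIV \<times> \<Lambda> \<times> UNIV"
  shows "g \<otimes> \<l> a \<in> reach J T q'"
proof -
  obtain w p where w: "g = wval w" "p \<in> J" "path T p w q" using assms(1) unfolding reach_def by blast
  have "w \<in> lists \<Lambda>" "a \<in> \<Lambda>" using path_lists[OF w(3) assms(3)] assms(2,3) by auto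
  then have "g \<otimes> \<l> a = wval (w @ [a])" using w(1) by (simp add: wval_snoc)
  moreover have "path T p (w @ [a]) q'" using w(3) assms(2) path_snoc by blast
  ultimately show ?thesis using w(2) unfolding reach_def by blast
qed

lemma prep_nval: "prep b n n' \<Longrightarrow> b \<in> \<Lambda> \<and> nval n' = inv (\<l> b) \<otimes> nval n"
proof -
  assume "prep b n n'"
  then obtain j where "b \<in> \<Lambda>" "n < B ^ j" "n' = Suc (\<iota> b) * B ^ j + n"
    unfolding prep_def INV_def by blast
  then show ?thesis
    using nval_concat[of n j "Suc (\<iota> b)"] nval_letter[OF inv_letter_closed] inv_letter by simp
qed

lemma move_reach:
  assumes "move T q n q' n'" "g \<in> carrier G" "g \<otimes> nval n \<in> reach J T q" "T \<subseteq> UNIV \<times> \<Lambda> \<times> UNIV"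
  shows "g \<otimes> nval n' \<in> reach J T q'"
  using assms(1) unfolding move_def
proof (elim disjE exE conjE)
  fix a assume a: "(q, a, q') \<in> T" "n' = n * B + Suc a"
  have "a \<in> \<Lambda>" using a assms(4) by auto
  then have "nval n' = nval n \<otimes> \<l> a" using nval_digit[of "Suc a" n] letters_less a by simp
  then have "g \<otimes> nval n' = g \<otimes> nval n \<otimes> \<l> a" using \<open>a \<in> \<Lambda>\<close> assms(2) by (simp add: m_assoc)
  then show ?thesis using reach_step[OF assms(3) a(1) assms(4)] by simp
next
  assume "q' = q" "win n n'"
  then show ?thesis using win_nval assms(3) by metis
qed

text \<open>Induction over the geodesic word and, for a fixed word, over the rank. A fact without a
  derivation from a smaller rank has to be supported by all predecessors of \<open>s\<close>,
  because \<open>v\<close> may arrive through any of them.\<close>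

lemma facts_sound:
  assumes just: "justified W mI mT Tr \<Phi>"
    and bounds: "\<And>s q n r. (s, q, n, r) \<in> \<Phi> \<Longrightarrow> s < W \<and> q < W \<and> n < W \<and> r < W"
      "\<And>s b t. (s, b, t) \<in> Tr \<Longrightarrow> s < W \<and> b < W"
    and letters: "mT \<subseteq> UNIV \<times> \<Lambda> \<times> UNIV" "Tr \<subseteq> UNIV \<times> \<Lambda> \<times> UNIV"
    and "path Tr 0 v s" "(s, q, n, r) \<in> \<Phi>"
  shows "wval v \<otimes> nval n \<in> reach mI mT q"
  using assms(6,7)
proof (induction v arbitrary: s q n r rule: rev_induct)
  case Nil
  from Nil.prems(2) show ?case
  proof (induction r arbitrary: q n rule: less_induct)
    case (less r)
    consider (move) q0 n0 r0 where "(s, q0, n0, r0) \<in> \<Phi>" "r0 < r" "move mT q0 n0 q n"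
      | (base) "n = 0" "q \<in> mI"
    proof -
      have "s = 0" using Nil.prems(1) by simp
      then show ?thesis
        using just[unfolded justified_def, rule_format, of s q n r] bounds(1)[OF less.prems] less.prems that by blast
    qed
    then show ?case
    proof cases
      case move
      then show ?thesis using less.IH move_reach[OF move(3) _ _ letters(1), of \<one>] by simp
    next
      case base
      then show ?thesis using reach_initial by simp
    qed
  qed
next
  case (snoc b v)
  obtain s1 where s1: "path Tr 0 v s1" "(s1, b, s) \<in> Tr" using snoc.prems(1) path_snoc by blast
  have vL: "v \<in> lists \<Lambda>" "b \<in> \<Lambda>" using path_lists[OF s1(1) letters(2)] s1(2) letters(2) by auto
  from snoc.prems(2) show ?case
  proof (induction r arbitrary: q n rule: less_induct)
    case (less r)
    consider (move) q0 n0 r0 where "(s, q0, n0, r0) \<in> \<Phi>" "r0 < r" "move mT q0 n0 q n"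
      | (prep) n1 r1 where "(s1, q, n1, r1) \<in> \<Phi>" "prep b n1 n"
      using just[unfolded justified_def, rule_format, of s q n r] bounds(1)[OF less.prems] less.prems
        bounds(2)[OF s1(2)] s1(2) by blast
    then show ?case
    proof cases
      case move
      have "wval (v @ [b]) \<in> carrier G" using vL by simp
      then show ?thesis using less.IH[OF move(2,1)] move_reach[OF move(3) _ _ letters(1)] by blast
    next
      case prep
      have "wval (v @ [b]) \<otimes> nval n = wval v \<otimes> nval n1"
        using vL prep_nval[OF prep(2)] by (simp add: wval_snoc m_assoc mult_inv_cancel)
      then show ?thesis using snoc.IH[OF s1(1) prep(1)] by simp
    qed
  qed
qed

end

text \<open>All numbers that occur lie below \<open>W\<close>, so the bounded quantifiers of a
  certificate, there for decidability, are as good as unbounded ones.\<close>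

locale certified_group = cone_coded_group +
  fixes W :: nat and mI mA mT St F Tr \<Phi> Z U
  assumes cert: "certificate W mI mA mT St F Tr \<Phi> Z U"
    and Phi_less: "(s, q, n, r) \<in> \<Phi> \<Longrightarrow> s < W \<and> q < W \<and> n < W \<and> r < W"
    and Tr_less: "(s, b, t) \<in> Tr \<Longrightarrow> s < W \<and> b < W \<and> t < W"
    and Z_less: "(s, s', n) \<in> Z \<Longrightarrow> s < W \<and> s' < W \<and> n < W"
    and mT_less: "(s, b, t) \<in> mT \<Longrightarrow> s < W \<and> b < W \<and> t < W"
    and mI_less: "q \<in> mI \<Longrightarrow> q < W" and mA_less: "q \<in> mA \<Longrightarrow> q < W"
    and St_less: "s \<in> St \<Longrightarrow> s < W" and F_less: "s \<in> F \<Longrightarrow> s < W"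
    and D_less: "(d, b, d') \<in> D \<Longrightarrow> d < W \<and> b < W \<and> d' < W"
    and power_le: "B ^ I \<le> W"
    and mT_letters: "mT \<subseteq> UNIV \<times> \<Lambda> \<times> UNIV"
begin

lemma cert_cone_automaton: "cone_automaton W St Tr" and cert_justified: "justified W mI mT Tr \<Phi>"
  and cert_pairs: "pair_closed W Tr Z"
  using cert unfolding certificate_def by blast+

lemma accepting_iff: "s \<in> F \<longleftrightarrow> s \<in> St \<and> (\<forall>q r. q \<in> mA \<longrightarrow> (s, q, 0, r) \<notin> \<Phi>)"
proof -
  have c: "\<forall>s<W. s \<in> F \<longleftrightarrow> s \<in> St \<and> \<not> (\<exists>q<W. \<exists>r<W. q \<in> mA \<and> (s, q, 0, r) \<in> \<Phi>)"
    using cert unfolding certificate_def by (elim conjE)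
  have b: "(\<exists>q<W. \<exists>r<W. q \<in> mA \<and> (s, q, 0, r) \<in> \<Phi>) \<longleftrightarrow> (\<exists>q r. q \<in> mA \<and> (s, q, 0, r) \<in> \<Phi>)"
    using Phi_less by blast
  show ?thesis
  proof (cases "s < W")
    case True
    with c have "s \<in> F \<longleftrightarrow> s \<in> St \<and> \<not> (\<exists>q<W. \<exists>r<W. q \<in> mA \<and> (s, q, 0, r) \<in> \<Phi>)" by (elim allE impE)
    then show ?thesis unfolding b by blast
  next
    case False
    then show ?thesis using St_less F_less by blast
  qed
qed

lemma U_accepting: "q \<in> mA \<Longrightarrow> q \<in> U"
proof -
  have "\<forall>q<W. q \<in> mA \<longrightarrow> q \<in> U" using cert unfolding certificate_def by (elim conjE)
  then show "q \<in> mA \<Longrightarrow> q \<in> U" using mA_less by blast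
qed

lemma U_backward: "(q, a, q') \<in> mT \<Longrightarrow> q' \<in> U \<Longrightarrow> q \<in> U"
proof -
  have "\<forall>q<W. \<forall>a<W. \<forall>q'<W. (q, a, q') \<in> mT \<and> q' \<in> U \<longrightarrow> q \<in> U"
    using cert unfolding certificate_def by (elim conjE)
  then show "(q, a, q') \<in> mT \<Longrightarrow> q' \<in> U \<Longrightarrow> q \<in> U" using mT_less[of q a q'] by blast
qed

lemma Phi_initial: "q \<in> mI \<Longrightarrow> q \<in> U \<Longrightarrow> \<exists>r. (0, q, 0, r) \<in> \<Phi>"
proof -
  have "\<forall>q<W. q \<in> mI \<and> q \<in> U \<longrightarrow> (\<exists>r<W. (0, q, 0, r) \<in> \<Phi>)"
    using cert unfolding certificate_def by (elim conjE)
  then show "q \<in> mI \<Longrightarrow> q \<in> U \<Longrightarrow> \<exists>r. (0, q, 0, r) \<in> \<Phi>" using mI_less by blast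
qed

lemma Phi_step:
  assumes "(s, s', Suc a) \<in> Z" "(q, a, q') \<in> mT" "q' \<in> U" "(s, q, 0, r) \<in> \<Phi>"
  shows "\<exists>r'. (s', q', 0, r') \<in> \<Phi>"
proof -
  have c: "\<forall>s<W. \<forall>s'<W. \<forall>a<W. \<forall>q<W. \<forall>q'<W. \<forall>r<W.
       (s, s', Suc a) \<in> Z \<and> (q, a, q') \<in> mT \<and> q' \<in> U \<and> (s, q, 0, r) \<in> \<Phi> \<longrightarrow> (\<exists>r'<W. (s', q', 0, r') \<in> \<Phi>)"
    using cert unfolding certificate_def by (elim conjE)
  have "\<exists>r'<W. (s', q', 0, r') \<in> \<Phi>"
    by (rule c[rule_format, of s s' a q q' r])
      (use assms Phi_less[OF assms(4)] mT_less[OF assms(2)] Z_less[OF assms(1)] in simp_all)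
  then show ?thesis by blast
qed

lemma Tr_states:
  assumes "(s, b, t) \<in> Tr"
  shows "s \<in> St \<and> t \<in> St \<and> (\<exists>d y d' y'. s = prod_encode (d, y) \<and> t = prod_encode (d', y') \<and> (d, b, d') \<in> D)"
proof -
  have c: "\<forall>s<W. \<forall>b<W. \<forall>t<W. (s, b, t) \<in> Tr \<longrightarrow> s \<in> St \<and> t \<in> St \<and>
       (\<exists>d<W. \<exists>y<W. \<exists>d'<W. \<exists>y'<W. s = prod_encode (d, y) \<and> t = prod_encode (d', y') \<and> (d, b, d') \<in> D)"
    using cert_cone_automaton unfolding cone_automaton_def by (elim conjE)
  show ?thesis using c[rule_format, of s b t] Tr_less[OF assms] assms by blast
qed

lemma Tr_deterministic:
  assumes "(s, b, t) \<in> Tr" "(s, b, t') \<in> Tr"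
  shows "t = t'"
proof -
  have c: "\<forall>s<W. \<forall>b<W. \<forall>t<W. \<forall>t'<W. (s, b, t) \<in> Tr \<and> (s, b, t') \<in> Tr \<longrightarrow> t = t'"
    using cert_cone_automaton unfolding cone_automaton_def by (elim conjE)
  show ?thesis using c[rule_format, of s b t t'] Tr_less[OF assms(1)] Tr_less[OF assms(2)] assms by blast
qed

lemma Tr_total:
  assumes "prod_encode (d, y) \<in> St" "(d, b, d') \<in> D"
  shows "\<exists>y'. (prod_encode (d, y), b, prod_encode (d', y')) \<in> Tr"
proof -
  have c: "\<forall>d<W. \<forall>y<W. \<forall>b<W. \<forall>d'<W. prod_encode (d, y) \<in> St \<and> (d, b, d') \<in> D \<longrightarrow>
       (\<exists>y'<W. (prod_encode (d, y), b, prod_encode (d', y')) \<in> Tr)"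
    using cert_cone_automaton unfolding cone_automaton_def by (elim conjE)
  have "y < W" using St_less[OF assms(1)] le_prod_encode_2[of y d] by simp
  then show ?thesis using c[rule_format, of d y b d'] D_less[OF assms(2)] assms by blast
qed

lemma D_letter: "(d, b, d') \<in> D \<Longrightarrow> b \<in> \<Lambda>"
  unfolding D_def cone_def by simp blast

lemma Tr_letters: "Tr \<subseteq> UNIV \<times> \<Lambda> \<times> UNIV"
proof
  fix x assume "x \<in> Tr"
  then obtain s b t where x: "x = (s, b, t)" "(s, b, t) \<in> Tr" by (cases x) blast
  then have "b \<in> \<Lambda>" using Tr_states D_letter by blast
  then show "x \<in> UNIV \<times> \<Lambda> \<times> UNIV" using x by blast
qed

lemma zero_state: "0 \<in> St" "prod_encode (0, 0) = 0"
proof -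
  show "0 \<in> St" using cert_cone_automaton unfolding cone_automaton_def by (elim conjE)
qed (simp add: prod_encode_def)

text \<open>\<open>D\<close> speaks of some element with the given cone type. By injectivity of
  \<kappa> and by \<open>cone_step\<close>, any other element of that cone type gives the same
  transition.\<close>

lemma D_cone:
  assumes "(\<kappa> (cone g), b, d') \<in> D" "g \<in> carrier G"
  shows "[b] \<in> cone g \<and> d' = \<kappa> (cone (g \<otimes> \<l> b))"
proof -
  obtain h where h: "h \<in> carrier G" "\<kappa> (cone h) = \<kappa> (cone g)" "[b] \<in> cone h" "d' = \<kappa> (cone (h \<otimes> \<l> b))"
    using assms(1) unfolding D_def by auto
  have "cone h = cone g" using inj_onD[OF inj_code h(2)] h(1) assms(2) by blast
  then show ?thesis using h cone_step[OF h(1,3)] cone_step[of g b] assms(2) by simp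
qed

lemma path_geod: "path Tr 0 v s \<Longrightarrow> geod v \<and> s \<in> St \<and> (\<exists>y. s = prod_encode (\<kappa> (cone (wval v)), y))"
proof (induction v arbitrary: s rule: rev_induct)
  case Nil
  then have "s = 0" by simp
  moreover have "0 = prod_encode (\<kappa> (cone (wval [])), 0)" using code_one zero_state(2) by simp
  ultimately show ?case using zero_state(1) geod_Nil by blast
next
  case (snoc b v)
  obtain s1 where s1: "path Tr 0 v s1" "(s1, b, s) \<in> Tr" using snoc.prems path_snoc by blast
  obtain y where v: "geod v" "s1 = prod_encode (\<kappa> (cone (wval v)), y)" using snoc.IH[OF s1(1)] by blast
  obtain d1 y1 d' y' where d: "s1 = prod_encode (d1, y1)" "s = prod_encode (d', y')" "(d1, b, d') \<in> D" "s \<in> St"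
    using Tr_states[OF s1(2)] by blast
  then have D': "(\<kappa> (cone (wval v)), b, d') \<in> D" using v by simp
  have vL: "v \<in> lists \<Lambda>" "b \<in> \<Lambda>" using v geod_lists D_letter[OF D'] by auto
  have c: "[b] \<in> cone (wval v)" "d' = \<kappa> (cone (wval v \<otimes> \<l> b))" using D_cone[OF D'] vL by auto
  have "geod (v @ [b])" using geod_snoc_iff[OF v(1) vL(2)] c(1) by simp
  moreover have "s = prod_encode (\<kappa> (cone (wval (v @ [b]))), y')" using d(2) c(2) wval_snoc[OF vL] by simp
  ultimately show ?case using d(4) by blast
qed

lemma geod_path: "geod v \<Longrightarrow> \<exists>s. path Tr 0 v s"
proof (induction v rule: rev_induct)
  case (snoc b v)
  have v: "geod v" using geod_append[OF snoc.prems] by blast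
  obtain s where s: "path Tr 0 v s" using snoc.IH[OF v] by blast
  obtain y where y: "s = prod_encode (\<kappa> (cone (wval v)), y)" "s \<in> St" using path_geod[OF s] by blast
  have vL: "v \<in> lists \<Lambda>" "b \<in> \<Lambda>" using geod_lists[OF snoc.prems] by auto
  have "(\<kappa> (cone (wval v)), b, \<kappa> (cone (wval v \<otimes> \<l> b))) \<in> D"
    using geod_snoc_iff[OF v vL(2)] snoc.prems wval_closed[OF vL(1)] unfolding D_def by blast
  then obtain y' where "(s, b, prod_encode (\<kappa> (cone (wval v \<otimes> \<l> b)), y')) \<in> Tr"
    using Tr_total y by blast
  then show ?case using s path_snoc by blast
qed auto

lemma path_deterministic: "path Tr p v s \<Longrightarrow> path Tr p v s' \<Longrightarrow> s = s'"
  by (induction v arbitrary: p) (auto dest: Tr_deterministic)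

lemma path_snoc_from:
  assumes "path Tr p (w @ [b]) s" "path Tr p w s0"
  shows "(s0, b, s) \<in> Tr"
proof -
  obtain r where r: "path Tr p w r" "(r, b, s) \<in> Tr" using assms(1) path_snoc by blast
  then show ?thesis using path_deterministic[OF r(1) assms(2)] by simp
qed

lemma Z_one: "n \<in> ONE \<Longrightarrow> (0, 0, n) \<in> Z"
proof -
  have "\<forall>n<W. n \<in> ONE \<longrightarrow> (0, 0, n) \<in> Z" using cert_pairs unfolding pair_closed_def by (elim conjE)
  then show "n \<in> ONE \<Longrightarrow> (0, 0, n) \<in> Z" using power_le by (simp add: ONE_def)
qed

lemma Z_left_right:
  assumes "(s, s', n) \<in> Z"
  shows "(s, b, t) \<in> Tr \<Longrightarrow> (b, n, n') \<in> LT \<Longrightarrow> (t, s', n') \<in> Z"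
    and "(s', b, t) \<in> Tr \<Longrightarrow> (n, b, n') \<in> RT \<Longrightarrow> (s, t, n') \<in> Z"
proof -
  have c: "\<forall>s<W. \<forall>s'<W. \<forall>n<W. \<forall>b<W. \<forall>t<W. \<forall>n'<W.
       ((s, s', n) \<in> Z \<and> (s, b, t) \<in> Tr \<and> (b, n, n') \<in> LT \<longrightarrow> (t, s', n') \<in> Z) \<and>
       ((s, s', n) \<in> Z \<and> (s', b, t) \<in> Tr \<and> (n, b, n') \<in> RT \<longrightarrow> (s, t, n') \<in> Z)"
    using cert_pairs unfolding pair_closed_def by (elim conjE)
  have b: "s < W" "s' < W" "n < W" using Z_less[OF assms] by auto
  show "(t, s', n') \<in> Z" if t: "(s, b, t) \<in> Tr" "(b, n, n') \<in> LT"
  proof -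
    have "n' < W" using t(2) power_le by (simp add: LT_def)
    then show ?thesis using c[rule_format, of s s' n b t n'] b Tr_less[OF t(1)] t assms by blast
  qed
  show "(s, t, n') \<in> Z" if t: "(s', b, t) \<in> Tr" "(n, b, n') \<in> RT"
  proof -
    have "n' < W" using t(2) power_le by (simp add: RT_def)
    then show ?thesis using c[rule_format, of s s' n b t n'] b Tr_less[OF t(1)] t assms by blast
  qed
qed

text \<open>In one time step first \<open>u\<close> and then \<open>v\<close> is extended. The
  intermediate quotient has length at most \<open>k + 1\<close>, which is the reason for
  \<open>I = Suc k\<close>.\<close>

lemma pairs:
  assumes u: "geod u" and v: "geod v" and near: "ldist (wval u) (wval v) \<le> 1"
  shows "path Tr 0 (take t u) s \<Longrightarrow> path Tr 0 (take t v) s' \<Longrightarrow> n < B ^ I \<Longrightarrow>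
    nval n = inv (wval (take t u)) \<otimes> wval (take t v) \<Longrightarrow> (s, s', n) \<in> Z"
proof (induction t arbitrary: s s' n)
  case 0
  then have "s = 0" "s' = 0" "n \<in> ONE" by (simp_all add: ONE_def)
  then show ?case using Z_one by simp
next
  case (Suc t)
  have L: "take i u \<in> lists \<Lambda>" "take i v \<in> lists \<Lambda>" for i
    using geod_take[OF u] geod_take[OF v] geod_lists by blast+
  have closed: "wval (take i u) \<in> carrier G" "wval (take i v) \<in> carrier G" for i
    using L wval_closed by blast+
  obtain s0 where s0: "path Tr 0 (take t u) s0" using geod_path geod_take[OF u] by blast
  obtain s1 where s1: "path Tr 0 (take t v) s1" using geod_path geod_take[OF v] by blast
  let ?x = "inv (wval (take t u)) \<otimes> wval (take t v)"
  have x: "?x \<in> carrier G" "len ?x \<le> k"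
    using closed fellow_travel[OF u v near, of t] unfolding ldist_def by simp_all
  obtain n0 where n0: "n0 < B ^ I" "nval n0 = ?x" using nval_ex[OF x(1), of I] x(2) I_def by fastforce
  have Z0: "(s0, s1, n0) \<in> Z" using Suc.IH[OF s0 s1 n0] .
  have "\<exists>n1. n1 < B ^ I \<and> (s, s1, n1) \<in> Z \<and> nval n1 = inv (wval (take (Suc t) u)) \<otimes> wval (take t v)"
  proof (cases "t < length u")
    case False
    then have "take (Suc t) u = take t u" by simp
    moreover have "s = s0" using path_deterministic[OF Suc.prems(1)[unfolded calculation] s0] .
    ultimately show ?thesis using n0 Z0 by (intro exI[of _ n0]) simp
  next
    case True
    define b where "b = u ! t"
    have tu: "take (Suc t) u = take t u @ [b]" using True by (simp add: take_Suc_conv_app_nth b_def)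
    have b: "b \<in> \<Lambda>" using L(1)[of "Suc t"] tu by simp
    have tr: "(s0, b, s) \<in> Tr"
      using path_snoc_from[OF Suc.prems(1)[unfolded tu] s0] .
    let ?y = "inv (\<l> b) \<otimes> ?x"
    have "len ?y \<le> len (inv (\<l> b)) + len ?x" using b x by (intro len_mult) auto
    then have "len ?y \<le> I" using len_letter[OF b] len_inv[of "\<l> b"] b x(2) I_def by simp
    then obtain n1 where n1: "n1 < B ^ I" "nval n1 = ?y" using nval_ex[of ?y I] b x(1) by fastforce
    then have "(b, n0, n1) \<in> LT" using b n0 unfolding LT_def by simp
    then have "(s, s1, n1) \<in> Z" using Z_left_right(1)[OF Z0 tr] by blast
    moreover have "nval n1 = inv (wval (take (Suc t) u)) \<otimes> wval (take t v)"
      using n1 tu L[of t] b closed[of t] by (simp add: wval_snoc inv_mult_group m_assoc)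
    ultimately show ?thesis using n1 by blast
  qed
  then obtain n1 where n1: "n1 < B ^ I" "(s, s1, n1) \<in> Z" "nval n1 = inv (wval (take (Suc t) u)) \<otimes> wval (take t v)"
    by blast
  show ?case
  proof (cases "t < length v")
    case True
    define b where "b = v ! t"
    have tv: "take (Suc t) v = take t v @ [b]" using True by (simp add: take_Suc_conv_app_nth b_def)
    have b: "b \<in> \<Lambda>" using L(2)[of "Suc t"] tv by simp
    have tr: "(s1, b, s') \<in> Tr"
      using path_snoc_from[OF Suc.prems(2)[unfolded tv] s1] .
    have "nval n = nval n1 \<otimes> \<l> b"
      unfolding Suc.prems(4) n1(3) tv using b L closed by (simp add: wval_snoc m_assoc)
    then have "(n1, b, n) \<in> RT" using b n1 Suc.prems(3) unfolding RT_def by simp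
    then show ?thesis using Z_left_right(2)[OF n1(2) tr] by blast
  next
    case False
    \<comment> \<open>The last extension has to arrive at the prescribed number \<open>n\<close>,
      not just at some number of the same value. As \<open>v\<close> has ended, this is the
      extension of \<open>u\<close>, so the table is applied to \<open>n0\<close> once more, with
      result \<open>n\<close>.\<close>
    show ?thesis
    proof (cases "t < length u")
      case True
      define b where "b = u ! t"
      have tu: "take (Suc t) u = take t u @ [b]" using True by (simp add: take_Suc_conv_app_nth b_def)
      have b: "b \<in> \<Lambda>" using L(1)[of "Suc t"] tu by simp
      have tr: "(s0, b, s) \<in> Tr"
        using path_snoc_from[OF Suc.prems(1)[unfolded tu] s0] .
      have tv: "take (Suc t) v = take t v" using False by simp
      have "nval n = inv (\<l> b) \<otimes> nval n0"
        unfolding Suc.prems(4) n0(2) tu tv using b L closed by (simp add: wval_snoc inv_mult_group m_assoc)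
      then have "(b, n0, n) \<in> LT" using b n0 Suc.prems(3) unfolding LT_def by simp
      moreover have "s' = s1" using path_deterministic[OF Suc.prems(2)[unfolded tv] s1] .
      ultimately show ?thesis using Z_left_right(1)[OF Z0 tr] by blast
    next
      case False
      have tt: "take (Suc t) v = take t v" "take (Suc t) u = take t u" using False \<open>\<not> t < length v\<close> by simp_all
      then show ?thesis using Suc.IH[of s s' n] Suc.prems by simp
    qed
  qed
qed

text \<open>Induction over \<open>w\<close>, without any bound on its length: geodesic words for
  \<open>w\<close> and for \<open>w\<close> followed by \<open>a\<close> end at distance at most 1,
  so \<open>Z\<close> relates their states through \<open>Suc a\<close>, the number of the letter,
  and the fact is passed on.\<close>

lemma facts_complete:
  assumes "p \<in> mI" "path mT p w q" "q \<in> U" "geod v" "wval v = wval w" "path Tr 0 v s"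
  shows "\<exists>r. (s, q, 0, r) \<in> \<Phi>"
  using assms
proof (induction w arbitrary: q v s rule: rev_induct)
  case Nil
  then have "v = []" using geod_one by simp
  then show ?case using Nil Phi_initial by simp
next
  case (snoc a w)
  obtain q1 where q1: "path mT p w q1" "(q1, a, q) \<in> mT" using snoc.prems path_snoc by blast
  have wL: "w \<in> lists \<Lambda>" "a \<in> \<Lambda>" using path_lists[OF q1(1) mT_letters] q1(2) mT_letters by auto
  obtain u where u: "geod u" "wval u = wval w" using geod_ex wval_closed[OF wL(1)] by blast
  obtain s1 where s1: "path Tr 0 u s1" using geod_path u by blast
  \<comment> \<open>\<open>U\<close> is closed backwards along transitions, so the induction
    hypothesis applies to \<open>q1\<close>.\<close>
  obtain r where r: "(s1, q1, 0, r) \<in> \<Phi>"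
    using snoc.IH[OF snoc.prems(1) q1(1) U_backward[OF q1(2) snoc.prems(3)] u s1] by blast
  have uL: "wval u \<in> carrier G" using u wL by simp
  have v: "wval v = wval u \<otimes> \<l> a" using snoc.prems u wL by (simp add: wval_snoc)
  then have near: "ldist (wval u) (wval v) \<le> 1"
    using ldist_mult_right[OF uL letter_closed[OF wL(2)]] len_letter[OF wL(2)] by simp
  have "Suc a < B ^ I" using letters_less[OF wL(2)] B_ge_2 I_def by (simp add: less_le_trans)
  \<comment> \<open>The time is chosen so that both words have ended.\<close>
  then have "(s1, s, Suc a) \<in> Z"
    using pairs[OF u(1) snoc.prems(4) near, of "max (length u) (length v)" s1 s "Suc a"] s1 snoc.prems(6)
      v uL wL(2) nval_letter by (simp add: inv_mult_cancel)
  then show ?case using Phi_step[OF _ q1(2) snoc.prems(3) r] by blast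
qed

text \<open>A state accepts if no fact claims displacement 0 at an accepting state of the input.
  Hence completeness of the facts gives the inclusion into the complement, and their truth the
  converse.\<close>

theorem certificate_sound:
  "wval ` {v. \<exists>s\<in>F. path Tr 0 v s} = carrier G - (\<Union>q\<in>mA. reach mI mT q)"
proof (rule subset_antisym; rule subsetI)
  fix g assume "g \<in> wval ` {v. \<exists>s\<in>F. path Tr 0 v s}"
  then obtain v s where v: "g = wval v" "s \<in> F" "path Tr 0 v s" by blast
  have gv: "geod v" using path_geod[OF v(3)] by blast
  have "g \<notin> reach mI mT q" if q: "q \<in> mA" for q
  proof
    assume "g \<in> reach mI mT q"
    then obtain w p where w: "g = wval w" "p \<in> mI" "path mT p w q" unfolding reach_def by blast
    have "\<exists>r. (s, q, 0, r) \<in> \<Phi>"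
      using facts_complete[OF w(2,3) U_accepting[OF q] gv _ v(3)] v(1) w(1) by simp
    then show False using v(2) q accepting_iff by blast
  qed
  then show "g \<in> carrier G - (\<Union>q\<in>mA. reach mI mT q)" using v(1) wval_closed[OF geod_lists[OF gv]] by blast
next
  fix g assume g: "g \<in> carrier G - (\<Union>q\<in>mA. reach mI mT q)"
  then obtain v where v: "geod v" "wval v = g" using geod_ex by blast
  obtain s where s: "path Tr 0 v s" using geod_path v by blast
  have "(s, q, 0, r) \<notin> \<Phi>" if "q \<in> mA" for q r
  proof
    assume f: "(s, q, 0, r) \<in> \<Phi>"
    have "wval v \<otimes> nval 0 \<in> reach mI mT q"
    proof (rule facts_sound[OF cert_justified _ _ mT_letters Tr_letters s f])
      show "s < W \<and> q < W \<and> n < W \<and> r < W" if "(s, q, n, r) \<in> \<Phi>" for s q n r using Phi_less[OF that] .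
      show "s < W \<and> b < W" if "(s, b, t) \<in> Tr" for s b t using Tr_less[OF that] by blast
    qed
    moreover have "wval v \<otimes> nval 0 = g" using g v(2) by simp
    ultimately show False using g that by blast
  qed
  then have "s \<in> F" using accepting_iff path_geod[OF s] by blast
  then show "g \<in> wval ` {v. \<exists>s\<in>F. path Tr 0 v s}" using s v by blast
qed

end

section \<open>Existence of certificates\<close>

lemma path_states:
  "path T p w q \<Longrightarrow> \<exists>f. f 0 = p \<and> f (length w) = q \<and> (\<forall>j<length w. (f j, w ! j, f (Suc j)) \<in> T)"
proof (induction w arbitrary: q rule: rev_induct)
  case Nil
  then have "(\<lambda>_. p) 0 = p \<and> (\<lambda>_::nat. p) (length []) = q" by simp
  then show ?case by auto
next
  case (snoc a w)
  obtain r where r: "path T p w r" "(r, a, q) \<in> T" using snoc.prems path_snoc by blast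
  obtain f where f: "f 0 = p" "f (length w) = r" "\<And>j. j < length w \<Longrightarrow> (f j, w ! j, f (Suc j)) \<in> T"
    using snoc.IH[OF r(1)] by blast
  let ?f = "f(Suc (length w) := q)"
  have "(?f j, (w @ [a]) ! j, ?f (Suc j)) \<in> T" if j: "j < length (w @ [a])" for j
  proof (cases "j = length w")
    case True
    then show ?thesis using r(2) f(2) by simp
  next
    case False
    then show ?thesis using j f(3)[of j] by (simp add: nth_append)
  qed
  moreover have "?f 0 = p" "?f (length (w @ [a])) = q" using f(1) by simp_all
  ultimately show ?case by blast
qed

text \<open>The assumption \<open>matching\<close> is what remains of the quasi-isometric embedding.
  It concerns paths to states from which acceptance is possible, since other paths need not be
  quasi-geodesic.\<close>

locale matched_automaton = cone_coded_group +
  fixes mI mA :: "nat set" and mT :: "(nat \<times> nat \<times> nat) set" and R :: nat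
  assumes finite_mI: "finite mI" and finite_mT: "finite mT" and mT_letters: "mT \<subseteq> UNIV \<times> \<Lambda> \<times> UNIV"
    and matching: "geod v \<Longrightarrow> p \<in> mI \<Longrightarrow> path mT p w q \<Longrightarrow> \<exists>qa\<in>mA. \<exists>e. path mT q e qa \<Longrightarrow> wval v = wval w \<Longrightarrow>
      \<exists>J. J (length v) = length w \<and> (\<forall>i<length v. J i \<le> J (Suc i)) \<and>
        (\<forall>j\<le>J 0. ldist (wval []) (wval (take j w)) \<le> R) \<and>
        (\<forall>i<length v. \<forall>j. J i \<le> j \<longrightarrow> j \<le> J (Suc i) \<longrightarrow> ldist (wval (take (Suc i) v)) (wval (take j w)) \<le> R)"
begin

text \<open>\<open>R\<close> digits for a displacement in the ball, one for a letter appended or put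
  in front, and \<open>k\<close> as working space for the windows.\<close>

definition N :: nat where
  "N = B ^ (R + 1 + k)"

definition Q :: "nat set" where
  "Q = mI \<union> fst ` mT \<union> (\<lambda>(q, a, q'). q') ` mT"

definition stp :: "((nat \<times> nat) \<times> (nat \<times> nat)) set" where
  "stp = {((q, n), (q', n')). move mT q n q' n' \<and> n' < N}"

definition extend :: "(nat \<times> nat) set \<Rightarrow> nat \<Rightarrow> (nat \<times> nat) set" where
  "extend X b = {(q, n'). n' < N \<and> (\<exists>n. (q, n) \<in> stp\<^sup>* `` X \<and> prep b n n')}"

text \<open>Displacements before any move at the current reference point; these become the facts of
  rank 0. Their closure \<open>Y\<close> under moves is determined by them, so the state has to
  remember only this set.\<close>

definition X0 :: "nat list \<Rightarrow> (nat \<times> nat) set" where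
  "X0 v = foldl extend ((\<lambda>q. (q, 0)) ` mI) v"

definition Y :: "nat list \<Rightarrow> (nat \<times> nat) set" where
  "Y v = stp\<^sup>* `` X0 v"

text \<open>Only the empty word gets 0 as second component. Otherwise a nonempty word could lead to
  state 0, where an underived fact is required to have displacement 0 at an initial state of the
  input.\<close>

definition code :: "nat list \<Rightarrow> nat" where
  "code v = prod_encode (\<kappa> (cone (wval v)), if v = [] then 0 else Suc (set_encode (prod_encode ` X0 v)))"

definition St :: "nat set" where
  "St = code ` {v. geod v}"

definition Tr :: "(nat \<times> nat \<times> nat) set" where
  "Tr = {(code v, b, code (v @ [b])) |v b. geod (v @ [b])}"

text \<open>Moves can go round in circles; counting them from \<open>X0\<close> makes derivations
  well-founded.\<close>

definition rank :: "nat list \<Rightarrow> nat \<Rightarrow> nat \<Rightarrow> nat" where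
  "rank v q n = (LEAST r. (q, n) \<in> (stp ^^ r) `` X0 v)"

definition \<Phi> :: "(nat \<times> nat \<times> nat \<times> nat) set" where
  "\<Phi> = {(code v, q, n, rank v q n) |v q n. geod v \<and> (q, n) \<in> Y v}"

text \<open>All pairs of geodesic words with a quotient in range are taken, fellow travelling or
  not, so that closure under the tables needs no estimate.\<close>

definition Z :: "(nat \<times> nat \<times> nat) set" where
  "Z = {(code u, code v, n) |u v n. geod u \<and> geod v \<and> n < B ^ I \<and> nval n = inv (wval u) \<otimes> wval v}"

definition F :: "nat set" where
  "F = {s \<in> St. \<forall>q r. q \<in> mA \<longrightarrow> (s, q, 0, r) \<notin> \<Phi>}"

definition U :: "nat set" where
  "U = {q \<in> Q \<union> mA. \<exists>qa\<in>mA. \<exists>e. path mT q e qa}"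

lemma N_pos: "0 < N"
  using B_ge_2 by (simp add: N_def)

lemma X0_Nil: "X0 [] = (\<lambda>q. (q, 0)) ` mI" and X0_snoc: "X0 (v @ [b]) = extend (X0 v) b"
  by (simp_all add: X0_def)

lemma finite_Q: "finite Q"
  using finite_mI finite_mT by (simp add: Q_def)

lemma mT_Q: "(q, a, q') \<in> mT \<Longrightarrow> q \<in> Q \<and> q' \<in> Q"
proof -
  assume h: "(q, a, q') \<in> mT"
  have "q \<in> fst ` mT" "q' \<in> (\<lambda>(q, a, q'). q') ` mT"
    using imageI[OF h, of fst] imageI[OF h, of "\<lambda>(q, a, q'). q'"] by simp_all
  then show ?thesis unfolding Q_def by blast
qed

lemma stp_closed: "(x, y) \<in> stp \<Longrightarrow> x \<in> Q \<times> {..<N} \<Longrightarrow> y \<in> Q \<times> {..<N}"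
proof -
  assume a: "(x, y) \<in> stp" "x \<in> Q \<times> {..<N}"
  obtain q n q' n' where xy: "x = (q, n)" "y = (q', n')" by (cases x, cases y) blast
  have "move mT q n q' n'" "n' < N" using a(1) unfolding xy stp_def by simp_all
  moreover have "q \<in> Q" using a(2) unfolding xy by simp
  ultimately show ?thesis unfolding xy move_def using mT_Q by blast
qed

lemma stps_closed: "(x, y) \<in> stp\<^sup>* \<Longrightarrow> x \<in> Q \<times> {..<N} \<Longrightarrow> y \<in> Q \<times> {..<N}"
proof (induction rule: rtrancl_induct)
  case (step y z)
  then show ?case using stp_closed by blast
qed

lemma X0_subset: "X0 v \<subseteq> Q \<times> {..<N}"
proof (induction v rule: rev_induct)
  case Nil
  then show ?case using N_pos unfolding X0_Nil Q_def by blast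
next
  case (snoc b v)
  have "stp\<^sup>* `` X0 v \<subseteq> Q \<times> {..<N}" using stps_closed snoc by blast
  then show ?case unfolding X0_snoc extend_def by blast
qed

lemma Y_subset: "Y v \<subseteq> Q \<times> {..<N}"
  using stps_closed X0_subset unfolding Y_def by blast

lemma X0_in_Y: "x \<in> X0 v \<Longrightarrow> x \<in> Y v"
  unfolding Y_def by blast

lemma Y_step: "(q, n) \<in> Y v \<Longrightarrow> move mT q n q' n' \<Longrightarrow> n' < N \<Longrightarrow> (q', n') \<in> Y v"
proof -
  assume a: "(q, n) \<in> Y v" "move mT q n q' n'" "n' < N"
  then have "((q, n), (q', n')) \<in> stp" by (simp add: stp_def)
  moreover obtain x where "x \<in> X0 v" "(x, (q, n)) \<in> stp\<^sup>*" using a(1) unfolding Y_def by blast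
  ultimately show ?thesis unfolding Y_def by (intro ImageI[OF rtrancl.rtrancl_into_rtrancl])
qed

text \<open>The \<open>k\<close> additional digits in \<open>N\<close> leave room for the rewriting,
  so for up to \<open>R + 1\<close> digits membership does not depend on how a displacement is
  written.\<close>

lemma Y_windows:
  assumes "(q, n) \<in> Y v" "n < B ^ (R + 1)" "n' < B ^ (R + 1)" "nval n = nval n'"
  shows "(q, n') \<in> Y v"
proof -
  have "(\<lambda>x y. win x y \<and> x < B ^ (R + 1 + k) \<and> y < B ^ (R + 1 + k))\<^sup>*\<^sup>* n n'"
    using win_connect assms(2-4) by blast
  then show ?thesis
  proof (induction rule: rtranclp_induct)
    case base
    then show ?case using assms(1) .
  next
    case (step y z)
    have "move mT q y q z" using step.hyps(2) unfolding move_def by blast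
    then show ?case using Y_step[OF step.IH] step.hyps(2) unfolding N_def by blast
  qed
qed

lemma code_Nil: "code [] = 0"
  by (simp add: code_def code_one prod_encode_def)

lemma code_eq:
  assumes "geod u" "geod v" "code u = code v"
  shows "cone (wval u) = cone (wval v)" "X0 u = X0 v" "u = [] \<longleftrightarrow> v = []"
proof -
  have fin: "finite (X0 w)" for w
    using finite_subset[OF X0_subset] finite_Q by blast
  have e: "\<kappa> (cone (wval u)) = \<kappa> (cone (wval v))"
    "(if u = [] then 0 else Suc (set_encode (prod_encode ` X0 u))) = (if v = [] then 0 else Suc (set_encode (prod_encode ` X0 v)))"
    using assms(3) unfolding code_def prod_encode_eq by blast+
  show uv: "u = [] \<longleftrightarrow> v = []" using e(2) by (simp split: if_splits)
  have cl: "wval u \<in> carrier G" "wval v \<in> carrier G" using assms geod_lists wval_closed by blast+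
  show "cone (wval u) = cone (wval v)" using inj_onD[OF inj_code e(1)] cl by blast
  show "X0 u = X0 v"
  proof (cases "u = []")
    case False
    then have "set_encode (prod_encode ` X0 u) = set_encode (prod_encode ` X0 v)" using e(2) uv by simp
    then have "prod_encode ` X0 u = prod_encode ` X0 v"
      using set_encode_eq[of "prod_encode ` X0 u" "prod_encode ` X0 v"] fin by simp
    then show ?thesis using inj_image_eq_iff[OF inj_prod_encode] by blast
  qed (use uv in simp)
qed

text \<open>The code determines the cone type and \<open>X0\<close>, and the values of both after a
  letter are functions of these and the letter. This makes \<open>Tr\<close> deterministic.\<close>

lemma code_step:
  assumes "geod u" "geod v" "code u = code v" "geod (u @ [b])"
  shows "geod (v @ [b])" "code (v @ [b]) = code (u @ [b])"
proof -
  have b: "b \<in> \<Lambda>" using geod_lists[OF assms(4)] by simp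
  have L: "u \<in> lists \<Lambda>" "v \<in> lists \<Lambda>" using assms geod_lists by blast+
  have c: "cone (wval u) = cone (wval v)" and X: "X0 u = X0 v" using code_eq[OF assms(1-3)] by auto
  have bu: "[b] \<in> cone (wval u)" using geod_snoc_iff[OF assms(1) b] assms(4) by blast
  then show "geod (v @ [b])" using geod_snoc_iff[OF assms(2) b] c by blast
  have "cone (wval (u @ [b])) = {x. b # x \<in> cone (wval u)}"
    unfolding wval_snoc[OF L(1) b] using cone_step[OF wval_closed[OF L(1)] bu] .
  moreover have "cone (wval (v @ [b])) = {x. b # x \<in> cone (wval v)}"
    unfolding wval_snoc[OF L(2) b] using cone_step[OF wval_closed[OF L(2)] bu[unfolded c]] .
  ultimately show "code (v @ [b]) = code (u @ [b])" unfolding code_def X0_snoc X c by simp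
qed

lemma rank_code:
  assumes "geod u" "geod v" "code u = code v"
  shows "rank u q n = rank v q n"
  unfolding rank_def code_eq(2)[OF assms] ..

lemma Phi_iff: "geod v \<Longrightarrow> (code v, q, n, r) \<in> \<Phi> \<longleftrightarrow> (q, n) \<in> Y v \<and> r = rank v q n"
proof
  assume v: "geod v" and "(code v, q, n, r) \<in> \<Phi>"
  then obtain u where u: "geod u" "code v = code u" "(q, n) \<in> Y u" "r = rank u q n" unfolding \<Phi>_def by blast
  have "Y v = Y u" unfolding Y_def using code_eq(2)[OF v u(1,2)] by simp
  then show "(q, n) \<in> Y v \<and> r = rank v q n" using u rank_code[OF v u(1,2)] by simp
next
  assume "geod v" "(q, n) \<in> Y v \<and> r = rank v q n"
  then show "(code v, q, n, r) \<in> \<Phi>" unfolding \<Phi>_def by blast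
qed

lemma finite_St: "finite St"
proof (rule finite_subset)
  let ?A = "\<kappa> ` cone ` carrier G" and ?B = "insert 0 (Suc ` set_encode ` (\<lambda>X. prod_encode ` X) ` Pow (Q \<times> {..<N}))"
  show "St \<subseteq> prod_encode ` (?A \<times> ?B)"
  proof
    fix s assume "s \<in> St"
    then obtain v where v: "geod v" "s = code v" unfolding St_def by blast
    have "wval v \<in> carrier G" using v geod_lists wval_closed by blast
    then show "s \<in> prod_encode ` (?A \<times> ?B)" using X0_subset[of v] unfolding v(2) code_def by auto
  qed
  show "finite (prod_encode ` (?A \<times> ?B))" using finite_cones finite_Q by blast
qed

lemma code_St: "geod v \<Longrightarrow> code v \<in> St"
  unfolding St_def by blast

lemma finite_Tr: "finite Tr"
proof (rule finite_subset)
  show "Tr \<subseteq> St \<times> \<Lambda> \<times> St"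
  proof
    fix x assume "x \<in> Tr"
    then obtain v b where x: "x = (code v, b, code (v @ [b]))" "geod (v @ [b])" unfolding Tr_def by blast
    then show "x \<in> St \<times> \<Lambda> \<times> St" using geod_append[OF x(2)] code_St geod_lists[OF x(2)] by simp
  qed
  show "finite (St \<times> \<Lambda> \<times> St)" using finite_St finite_letters by simp
qed

lemma finite_Phi: "finite \<Phi>"
proof -
  \<comment> \<open>The rank depends on the state only, so it may be read off from an arbitrary word
    with that code.\<close>
  have "\<Phi> \<subseteq> (\<lambda>(s, q, n). (s, q, n, rank (SOME v. geod v \<and> code v = s) q n)) ` (St \<times> Q \<times> {..<N})"
  proof
    fix x assume "x \<in> \<Phi>"
    then obtain v q n where x: "x = (code v, q, n, rank v q n)" "geod v" "(q, n) \<in> Y v" unfolding \<Phi>_def by blast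
    have "geod (SOME u. geod u \<and> code u = code v) \<and> code (SOME u. geod u \<and> code u = code v) = code v"
      by (rule someI[of "\<lambda>u. geod u \<and> code u = code v" v]) (simp add: x)
    then have "rank (SOME u. geod u \<and> code u = code v) q n = rank v q n" using rank_code x(2) by blast
    moreover have "q \<in> Q" "n < N" using Y_subset x(3) by blast+
    ultimately show "x \<in> (\<lambda>(s, q, n). (s, q, n, rank (SOME v. geod v \<and> code v = s) q n)) ` (St \<times> Q \<times> {..<N})"
      unfolding x(1) using code_St[OF x(2)] by (intro image_eqI[of _ _ "(code v, q, n)"]) simp_all
  qed
  then show ?thesis by (rule finite_subset) (simp add: finite_St finite_Q)
qed

lemma finite_Z: "finite Z"
proof (rule finite_subset)
  show "Z \<subseteq> St \<times> St \<times> {..<B ^ I}" unfolding Z_def using code_St by blast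
  show "finite (St \<times> St \<times> {..<B ^ I})" using finite_St by simp
qed

lemma finite_F: "finite F"
  using finite_subset[OF _ finite_St, of F] unfolding F_def by blast

lemma Tr_path: "geod v \<Longrightarrow> path Tr 0 v (code v)"
proof (induction v rule: rev_induct)
  case Nil
  then show ?case using code_Nil by simp
next
  case (snoc b v)
  have "(code v, b, code (v @ [b])) \<in> Tr" unfolding Tr_def using snoc.prems by blast
  then show ?case using snoc geod_append path_snoc by blast
qed

lemma Tr_source:
  assumes "(code v, b, t) \<in> Tr" "geod v"
  shows "geod (v @ [b]) \<and> t = code (v @ [b])"
proof -
  obtain u where u: "code v = code u" "t = code (u @ [b])" "geod (u @ [b])" using assms(1) unfolding Tr_def by blast
  have "geod u" using geod_append[OF u(3)] by blast
  then show ?thesis using code_step[OF _ assms(2) u(1)[symmetric] u(3)] u(2) by simp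
qed

text \<open>The input automaton reads on while the reference point stays at \<open>g\<close>. After
  every letter the displacement is rewritten with \<open>R\<close> digits, so digits do not
  accumulate.\<close>

lemma reach_advance:
  assumes f: "\<And>j. j < length w \<Longrightarrow> (f j, w ! j, f (Suc j)) \<in> mT" and w: "w \<in> lists \<Lambda>"
    and g: "g \<in> carrier G" and "j \<le> j'" "j' \<le> length w"
    and near: "\<And>t. j \<le> t \<Longrightarrow> t \<le> j' \<Longrightarrow> ldist g (wval (take t w)) \<le> R"
    and x: "(f j, x) \<in> Y v" "x < B ^ (R + 1)" "nval x = inv g \<otimes> wval (take j w)"
  shows "\<exists>x'<B ^ R. (f j', x') \<in> Y v \<and> nval x' = inv g \<otimes> wval (take j' w)"
  using assms(4,5) near
proof (induction j' rule: dec_induct)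
  have tL: "take t w \<in> lists \<Lambda>" for t using w set_take_subset[of t w] by (auto simp: lists_eq_set)
  have small: "x < B ^ (R + 1)" if "x < B ^ R" for x
  proof -
    have "B ^ R \<le> B ^ (R + 1)" using B_ge_2 by (intro power_increasing) auto
    with that show ?thesis by (rule less_le_trans)
  qed
  have canon: "\<exists>x'<B ^ R. (q, x') \<in> Y v \<and> nval x' = h"
    if y: "(q, y) \<in> Y v" "y < B ^ (R + 1)" "nval y = h" "len h \<le> R" for q y h
  proof -
    obtain x' where x': "x' < B ^ R" "nval x' = h" using nval_ex[of h R] y(3,4) nval_closed by blast
    then show ?thesis using Y_windows[OF y(1,2) small[OF x'(1)]] y(3) by auto
  qed
  {
    case base
    show ?case using canon[OF x] base(2)[of j] unfolding ldist_def by simp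
  next
    case (step i)
    obtain x' where x': "x' < B ^ R" "(f i, x') \<in> Y v" "nval x' = inv g \<otimes> wval (take i w)"
      using step by force
    have i: "i < length w" using step.prems by simp
    define a where "a = w ! i"
    have a: "a \<in> \<Lambda>" "(f i, a, f (Suc i)) \<in> mT" using f[OF i] mT_letters unfolding a_def by auto
    have "x' * B + Suc a < (x' + 1) * B" using letters_less[OF a(1)] by simp
    also have "\<dots> \<le> B ^ R * B" using x'(1) by (intro mult_right_mono) auto
    finally have sm: "x' * B + Suc a < B ^ (R + 1)" by (simp add: mult.commute)
    also have "\<dots> \<le> N" unfolding N_def using B_ge_2 by (intro power_increasing) auto
    finally have smN: "x' * B + Suc a < N" .
    have "move mT (f i) x' (f (Suc i)) (x' * B + Suc a)" unfolding move_def using a(2) by auto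
    then have y: "(f (Suc i), x' * B + Suc a) \<in> Y v" using Y_step[OF x'(2) _ smN] by blast
    have "take (Suc i) w = take i w @ [a]" using i by (simp add: take_Suc_conv_app_nth a_def)
    then have "nval (x' * B + Suc a) = inv g \<otimes> wval (take (Suc i) w)"
      using nval_digit[of "Suc a" x'] letters_less[OF a(1)] x'(3) a(1) wval_snoc[OF tL a(1)] wval_closed[OF tL, of i] g
      by (simp add: m_assoc)
    from canon[OF y sm this] show ?case using step.prems(2)[of "Suc i"] step.hyps unfolding ldist_def by simp
  }
qed

text \<open>The monotone matching is a schedule: after \<open>i\<close> letters of \<open>v\<close>,
  \<open>J i\<close> letters of \<open>w\<close> have been read. Then \<open>prep\<close> moves the
  reference point past the next letter of \<open>v\<close>, and \<open>reach_advance\<close> reads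
  \<open>w\<close> up to \<open>J (Suc i)\<close>.\<close>

lemma Y_complete:
  assumes v: "geod v" and p: "p \<in> mI" and w: "path mT p w q" and q: "\<exists>qa\<in>mA. \<exists>e. path mT q e qa"
    and vw: "wval v = wval w"
  shows "(q, 0) \<in> Y v"
proof -
  obtain J where J: "J (length v) = length w" "\<And>i. i < length v \<Longrightarrow> J i \<le> J (Suc i)"
    "\<And>j. j \<le> J 0 \<Longrightarrow> ldist (wval []) (wval (take j w)) \<le> R"
    "\<And>i j. i < length v \<Longrightarrow> J i \<le> j \<Longrightarrow> j \<le> J (Suc i) \<Longrightarrow> ldist (wval (take (Suc i) v)) (wval (take j w)) \<le> R"
    using matching[OF v p w q vw] by blast
  obtain f where f: "f 0 = p" "f (length w) = q" "\<And>j. j < length w \<Longrightarrow> (f j, w ! j, f (Suc j)) \<in> mT"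
    using path_states[OF w] by blast
  have wL: "w \<in> lists \<Lambda>" using path_lists[OF w mT_letters] .
  have vL: "v \<in> lists \<Lambda>" using geod_lists[OF v] .
  have tL: "take t v \<in> lists \<Lambda>" for t using vL set_take_subset[of t v] by (auto simp: lists_eq_set)
  have tw: "take t w \<in> lists \<Lambda>" for t using wL set_take_subset[of t w] by (auto simp: lists_eq_set)
  have Jle: "J i \<le> length w" if "i \<le> length v" for i
    using that
  proof (induction i rule: inc_induct)
    case base
    then show ?case using J(1) by simp
  next
    case (step i)
    then show ?case using J(2)[of i] by simp
  qed
  have claim: "\<exists>x<B ^ R. (f (J i), x) \<in> Y (take i v) \<and> nval x = inv (wval (take i v)) \<otimes> wval (take (J i) w)"
    if "i \<le> length v" for i
    using that
  proof (induction i)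
    case 0
    have "\<exists>x'<B ^ R. (f (J 0), x') \<in> Y [] \<and> nval x' = inv (wval []) \<otimes> wval (take (J 0) w)"
    proof (rule reach_advance[OF f(3) wL _ le0 Jle[OF le0]])
      show "ldist (wval []) (wval (take t w)) \<le> R" if "0 \<le> t" "t \<le> J 0" for t using J(3)[OF that(2)] .
      show "(f 0, 0) \<in> Y []" using p f(1) by (intro X0_in_Y) (simp add: X0_Nil)
      show "0 < B ^ (R + 1)" using B_ge_2 by simp
    qed simp_all
    then show ?case by simp
  next
    case (Suc i)
    then obtain x where x: "x < B ^ R" "(f (J i), x) \<in> Y (take i v)" "nval x = inv (wval (take i v)) \<otimes> wval (take (J i) w)"
      by force
    have i: "i < length v" using Suc.prems by simp
    define b where "b = v ! i"
    have tv: "take (Suc i) v = take i v @ [b]" using i by (simp add: take_Suc_conv_app_nth b_def)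
    have b: "b \<in> \<Lambda>" using tL[of "Suc i"] tv by simp
    define c where "c = Suc (\<iota> b)"
    \<comment> \<open>The inverse letter is placed directly before the \<open>R\<close> digits of
      \<open>x\<close>, so \<open>R + 1\<close> digits suffice.\<close>
    define y where "y = c * B ^ R + x"
    have cB: "c < B" using letters_less[OF inv_letter_closed[OF b]] by (simp add: c_def)
    have "y < (c + 1) * B ^ R" using x(1) by (simp add: y_def)
    also have "\<dots> \<le> B * B ^ R" using cB by (intro mult_right_mono) auto
    finally have yB: "y < B ^ (R + 1)" by simp
    also have "\<dots> \<le> N" unfolding N_def using B_ge_2 by (intro power_increasing) auto
    finally have yN: "y < N" .
    have pr: "prep b x y"
    proof -
      have "R < B ^ R" using less_le_trans[OF less_exp[of R] power_mono[of 2 B R]] B_ge_2 by simp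
      moreover have "1 * B ^ R \<le> c * B ^ R" "c * 1 \<le> c * B ^ R"
        using B_ge_2 by (intro mult_right_mono mult_left_mono; simp add: c_def)+
      ultimately have "R < Suc y" "c < Suc y" unfolding y_def by linarith+
      moreover have "(b, c) \<in> INV" using b by (simp add: INV_def c_def)
      ultimately show ?thesis unfolding prep_def using x(1) y_def by blast
    qed
    have "(f (J i), y) \<in> X0 (take (Suc i) v)"
      unfolding tv X0_snoc extend_def using x(2) pr yN unfolding Y_def by blast
    then have yY: "(f (J i), y) \<in> Y (take (Suc i) v)" by (rule X0_in_Y)
    have ny: "nval y = inv (wval (take (Suc i) v)) \<otimes> wval (take (J i) w)"
      using prep_nval[OF pr] x(3) b wval_closed[OF tL, of i] wval_closed[OF tw, of "J i"]
      unfolding tv wval_snoc[OF tL b] by (simp add: inv_mult_group m_assoc)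
    show ?case
      by (rule reach_advance[OF f(3) wL wval_closed[OF tL] J(2)[OF i] Jle[OF Suc.prems] J(4)[OF i] yY yB ny])
  qed
  obtain x where x: "x < B ^ R" "(q, x) \<in> Y v" "nval x = inv (wval v) \<otimes> wval w"
    using claim[OF order_refl] J(1) f(2) by auto
  \<comment> \<open>The displacement reached is the identity, but it may be written by a number
    other than 0.\<close>
  have "nval x = nval 0" using x(3) vw wval_closed[OF vL] by simp
  moreover have "x < B ^ (R + 1)" "0 < B ^ (R + 1)"
  proof -
    have "B ^ R \<le> B ^ (R + 1)" using B_ge_2 by (intro power_increasing) auto
    with x(1) show "x < B ^ (R + 1)" by (rule less_le_trans)
    show "0 < B ^ (R + 1)" using B_ge_2 by simp
  qed
  ultimately show ?thesis using Y_windows[OF x(2)] by blast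
qed

end

section \<open>The constructed data form a certificate\<close>

context matched_automaton
begin

lemma rank_ex: "(q, n) \<in> Y v \<Longrightarrow> (q, n) \<in> (stp ^^ rank v q n) `` X0 v"
proof -
  assume "(q, n) \<in> Y v"
  then obtain x where "x \<in> X0 v" "(x, (q, n)) \<in> stp\<^sup>*" unfolding Y_def by blast
  then obtain r where "(q, n) \<in> (stp ^^ r) `` X0 v" using rtrancl_imp_relpow by blast
  then show ?thesis unfolding rank_def by (rule LeastI)
qed

text \<open>Rank 0 means membership in \<open>X0\<close>; any other fact has a last move from a fact
  of smaller rank. Words with the same code have the same \<open>X0\<close>, so every predecessor
  state supports the facts of rank 0.\<close>

lemma Phi_justified:
  assumes "(s, q, n, r) \<in> \<Phi>"
  shows "(\<exists>q0 n0 r0. (s, q0, n0, r0) \<in> \<Phi> \<and> r0 < r \<and> move mT q0 n0 q n) \<or>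
     ((s = 0 \<longrightarrow> n = 0 \<and> q \<in> mI) \<and>
      (\<forall>s1 b. (s1, b, s) \<in> Tr \<longrightarrow> (\<exists>n1 r1. (s1, q, n1, r1) \<in> \<Phi> \<and> prep b n1 n)))"
proof -
  obtain v where v: "s = code v" "geod v" "(q, n) \<in> Y v" "r = rank v q n"
    using assms unfolding \<Phi>_def by blast
  have r: "(q, n) \<in> (stp ^^ r) `` X0 v" using rank_ex[OF v(3)] v(4) by simp
  show ?thesis
  proof (cases r)
    case 0
    then have X: "(q, n) \<in> X0 v" using r by simp
    have "n = 0 \<and> q \<in> mI" if "s = 0"
    proof -
      have "v = []" using code_eq(3)[OF geod_Nil v(2)] code_Nil v(1) that by simp
      then show ?thesis using X X0_Nil by auto
    qed
    moreover have "\<exists>n1 r1. (s1, q, n1, r1) \<in> \<Phi> \<and> prep b n1 n" if tr: "(s1, b, s) \<in> Tr" for s1 b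
    proof -
      obtain u where u: "s1 = code u" "s = code (u @ [b])" "geod (u @ [b])" using tr unfolding Tr_def by blast
      have "X0 (u @ [b]) = X0 v" using code_eq(2)[OF u(3) v(2)] u(2) v(1) by simp
      then have "(q, n) \<in> extend (X0 u) b" using X X0_snoc by simp
      then obtain n1 where "(q, n1) \<in> Y u" "prep b n1 n" unfolding extend_def Y_def by blast
      then show ?thesis using Phi_iff[of u q n1] geod_append[OF u(3)] u(1) by blast
    qed
    ultimately show ?thesis by blast
  next
    case (Suc r')
    then obtain q0 n0 where x: "(q0, n0) \<in> (stp ^^ r') `` X0 v" "((q0, n0), (q, n)) \<in> stp"
      using r by auto
    have "(q0, n0) \<in> Y v" using x(1) relpow_imp_rtrancl unfolding Y_def by blast
    then have "(s, q0, n0, rank v q0 n0) \<in> \<Phi>" using Phi_iff[OF v(2)] v(1) by blast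
    moreover have "rank v q0 n0 \<le> r'" unfolding rank_def by (rule Least_le[of "\<lambda>r. (q0, n0) \<in> (stp ^^ r) `` X0 v", OF x(1)])
    moreover have "move mT q0 n0 q n" using x(2) unfolding stp_def by simp
    ultimately show ?thesis using Suc by (meson le_imp_less_Suc)
  qed
qed

lemma Z_ONE: "n \<in> ONE \<Longrightarrow> (0, 0, n) \<in> Z"
proof -
  assume "n \<in> ONE"
  then have "(0, 0, n) = (code [], code [], n) \<and> geod [] \<and> geod [] \<and> n < B ^ I \<and> nval n = inv (wval []) \<otimes> wval []"
    unfolding ONE_def using code_Nil geod_Nil by simp
  then show ?thesis unfolding Z_def by blast
qed

lemma Z_left:
  assumes "(s, s', n) \<in> Z" "(s, b, t) \<in> Tr" "(b, n, n') \<in> LT"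
  shows "(t, s', n') \<in> Z"
proof -
  obtain u v where uv: "s = code u" "s' = code v" "geod u" "geod v" "nval n = inv (wval u) \<otimes> wval v"
    using assms(1) unfolding Z_def by blast
  have t: "geod (u @ [b])" "t = code (u @ [b])" using Tr_source[OF assms(2)[unfolded uv(1)] uv(3)] by auto
  have b: "b \<in> \<Lambda>" "n' < B ^ I" "nval n' = inv (\<l> b) \<otimes> nval n" using assms(3) unfolding LT_def by auto
  have L: "wval u \<in> carrier G" "wval v \<in> carrier G" "u \<in> lists \<Lambda>"
    using geod_lists[OF uv(3)] geod_lists[OF uv(4)] wval_closed by auto
  have "nval n' = inv (wval (u @ [b])) \<otimes> wval v"
    unfolding b(3) uv(5) wval_snoc[OF L(3) b(1)] using L b(1) by (simp add: inv_mult_group m_assoc)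
  then show ?thesis unfolding Z_def using t uv b(2) by blast
qed

lemma Z_right:
  assumes "(s, s', n) \<in> Z" "(s', b, t) \<in> Tr" "(n, b, n') \<in> RT"
  shows "(s, t, n') \<in> Z"
proof -
  obtain u v where uv: "s = code u" "s' = code v" "geod u" "geod v" "nval n = inv (wval u) \<otimes> wval v"
    using assms(1) unfolding Z_def by blast
  have t: "geod (v @ [b])" "t = code (v @ [b])" using Tr_source[OF assms(2)[unfolded uv(2)] uv(4)] by auto
  have b: "b \<in> \<Lambda>" "n' < B ^ I" "nval n' = nval n \<otimes> \<l> b" using assms(3) unfolding RT_def by auto
  have L: "wval u \<in> carrier G" "wval v \<in> carrier G" "v \<in> lists \<Lambda>"
    using geod_lists[OF uv(3)] geod_lists[OF uv(4)] wval_closed by auto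
  have "nval n' = inv (wval u) \<otimes> wval (v @ [b])"
    unfolding b(3) uv(5) wval_snoc[OF L(3) b(1)] using L b(1) by (simp add: m_assoc)
  then show ?thesis unfolding Z_def using t uv b(2) by blast
qed

lemma U_iff: "q \<in> Q \<union> mA \<Longrightarrow> q \<in> U \<longleftrightarrow> (\<exists>qa\<in>mA. \<exists>e. path mT q e qa)"
  unfolding U_def by blast

context
  fixes W :: nat
  assumes Phi_less: "\<And>s q n r. (s, q, n, r) \<in> \<Phi> \<Longrightarrow> s < W \<and> q < W \<and> n < W \<and> r < W"
    and Tr_less: "\<And>s b t. (s, b, t) \<in> Tr \<Longrightarrow> s < W \<and> b < W \<and> t < W"
begin

lemma all_justified: "justified W mI mT Tr \<Phi>"
  unfolding justified_def
proof (intro allI impI)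
  fix s q n r assume "(s, q, n, r) \<in> \<Phi>"
  from Phi_justified[OF this]
  show "(\<exists>q0<W. \<exists>n0<W. \<exists>r0<W. (s, q0, n0, r0) \<in> \<Phi> \<and> r0 < r \<and> move mT q0 n0 q n) \<or>
     ((s = 0 \<longrightarrow> n = 0 \<and> q \<in> mI) \<and>
      (\<forall>s1<W. \<forall>b<W. (s1, b, s) \<in> Tr \<longrightarrow> (\<exists>n1<W. \<exists>r1<W. (s1, q, n1, r1) \<in> \<Phi> \<and> prep b n1 n)))"
  proof (elim disjE)
    assume "\<exists>q0 n0 r0. (s, q0, n0, r0) \<in> \<Phi> \<and> r0 < r \<and> move mT q0 n0 q n"
    then show ?thesis using Phi_less by blast
  next
    assume a: "(s = 0 \<longrightarrow> n = 0 \<and> q \<in> mI) \<and>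
      (\<forall>s1 b. (s1, b, s) \<in> Tr \<longrightarrow> (\<exists>n1 r1. (s1, q, n1, r1) \<in> \<Phi> \<and> prep b n1 n))"
    have "\<exists>n1<W. \<exists>r1<W. (s1, q, n1, r1) \<in> \<Phi> \<and> prep b n1 n" if "(s1, b, s) \<in> Tr" for s1 b
      using a that Phi_less by blast
    with a show ?thesis by blast
  qed
qed

text \<open>The argument passes through the group: the fact at \<open>s\<close> is true, so the
  input reaches \<open>q'\<close> at the value of \<open>v\<close>, and by \<open>Y_complete\<close>
  this is recorded at \<open>s'\<close>. Membership of \<open>q'\<close> in \<open>U\<close> makes
  \<open>matching\<close> available for the path in question.\<close>

lemma Phi_transfer:
  assumes "(s, s', Suc a) \<in> Z" "(q, a, q') \<in> mT" "q' \<in> U" "(s, q, 0, r) \<in> \<Phi>"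
  shows "\<exists>r'. (s', q', 0, r') \<in> \<Phi>"
proof -
  obtain u v where uv: "s = code u" "s' = code v" "geod u" "geod v" "nval (Suc a) = inv (wval u) \<otimes> wval v"
    using assms(1) unfolding Z_def by blast
  have a: "a \<in> \<Lambda>" using assms(2) mT_letters by auto
  have L: "wval u \<in> carrier G" "wval v \<in> carrier G"
    using geod_lists[OF uv(3)] geod_lists[OF uv(4)] wval_closed by auto
  have TrL: "Tr \<subseteq> UNIV \<times> \<Lambda> \<times> UNIV"
  proof
    fix x assume "x \<in> Tr"
    then obtain v b where x: "x = (code v, b, code (v @ [b]))" "geod (v @ [b])" unfolding Tr_def by blast
    then show "x \<in> UNIV \<times> \<Lambda> \<times> UNIV" using geod_lists[OF x(2)] by simp
  qed
  have "wval u \<otimes> nval 0 \<in> reach mI mT q"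
  proof (rule facts_sound[OF all_justified _ _ mT_letters TrL Tr_path[OF uv(3)]])
    show "(code u, q, 0, r) \<in> \<Phi>" using assms(4) uv(1) by simp
    show "s < W \<and> q < W \<and> n < W \<and> r < W" if "(s, q, n, r) \<in> \<Phi>" for s q n r using Phi_less[OF that] .
    show "s < W \<and> b < W" if "(s, b, t) \<in> Tr" for s b t using Tr_less[OF that] by blast
  qed
  then have "wval u \<otimes> \<l> a \<in> reach mI mT q'" using reach_step[OF _ assms(2) mT_letters, of "wval u" mI] L by simp
  moreover have "wval u \<otimes> \<l> a = wval v"
    using uv(5) nval_letter[OF a] L by (simp add: mult_inv_cancel)
  ultimately obtain w p where w: "wval v = wval w" "p \<in> mI" "path mT p w q'" unfolding reach_def by auto
  have "\<exists>qa\<in>mA. \<exists>e. path mT q' e qa" using assms(3) unfolding U_def by blast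
  then have "(q', 0) \<in> Y v" using Y_complete[OF uv(4) w(2,3) _ w(1)] by blast
  then show ?thesis using Phi_iff[OF uv(4)] uv(2) by blast
qed

lemma Tr_cone_automaton: "cone_automaton W St Tr"
  unfolding cone_automaton_def
proof (intro conjI allI impI)
  show "0 \<in> St" using code_St[OF geod_Nil] code_Nil by simp
  show "t = t'" if t: "(s, b, t) \<in> Tr \<and> (s, b, t') \<in> Tr" for s b t t'
  proof -
    obtain v where v: "s = code v" "t = code (v @ [b])" "geod (v @ [b])" using t unfolding Tr_def by blast
    have "geod v" using geod_append[OF v(3)] by blast
    then show ?thesis using Tr_source[of v b t'] t v by blast
  qed
  show "\<exists>y'<W. (prod_encode (d, y), b, prod_encode (d', y')) \<in> Tr"
    if a: "prod_encode (d, y) \<in> St \<and> (d, b, d') \<in> D" for d y b d'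
  proof -
    obtain v where v: "prod_encode (d, y) = code v" "geod v" using a unfolding St_def by blast
    obtain g where g: "d = \<kappa> (cone g)" "d' = \<kappa> (cone (g \<otimes> \<l> b))" "g \<in> carrier G" "[b] \<in> cone g"
      using a unfolding D_def by blast
    have "d = \<kappa> (cone (wval v))" using v(1) unfolding code_def by simp
    moreover have vL: "v \<in> lists \<Lambda>" using geod_lists[OF v(2)] .
    ultimately have c: "cone g = cone (wval v)" using g inj_onD[OF inj_code, of "cone g" "cone (wval v)"] by simp
    have b: "b \<in> \<Lambda>" using g(4) by (simp add: cone_def)
    have gb: "geod (v @ [b])" using geod_snoc_iff[OF v(2) b] g(4) c by simp
    have "cone (g \<otimes> \<l> b) = cone (wval (v @ [b]))"
      using cone_step[OF g(3,4)] cone_step[OF wval_closed[OF vL], of b] g(4) c wval_snoc[OF vL b] by simp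
    then obtain y' where y': "code (v @ [b]) = prod_encode (d', y')" unfolding code_def g(2) by metis
    have tr: "(prod_encode (d, y), b, prod_encode (d', y')) \<in> Tr"
      unfolding Tr_def v(1) y'[symmetric] using gb by blast
    then have "y' < W" using Tr_less[OF tr] le_prod_encode_2[of y' d'] by simp
    then show ?thesis using tr by blast
  qed
  fix s b t assume tr: "(s, b, t) \<in> Tr"
  then obtain v where v: "s = code v" "t = code (v @ [b])" "geod (v @ [b])" unfolding Tr_def by blast
  have gv: "geod v" using geod_append[OF v(3)] by blast
  show "s \<in> St" "t \<in> St" using code_St v gv by auto
  have b: "b \<in> \<Lambda>" "v \<in> lists \<Lambda>" using geod_lists[OF v(3)] by auto
  obtain y y' where y: "s = prod_encode (\<kappa> (cone (wval v)), y)" "t = prod_encode (\<kappa> (cone (wval v \<otimes> \<l> b)), y')"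
    unfolding v(1,2) code_def wval_snoc[OF b(2,1)] by blast
  have "[b] \<in> cone (wval v)" using geod_snoc_iff[OF gv b(1)] v(3) by blast
  then have "(\<kappa> (cone (wval v)), b, \<kappa> (cone (wval v \<otimes> \<l> b))) \<in> D"
    unfolding D_def using wval_closed[OF b(2)] by blast
  moreover have "s < W" "t < W" using Tr_less[OF tr] by auto
  then have "\<kappa> (cone (wval v)) < W" "y < W" "\<kappa> (cone (wval v \<otimes> \<l> b)) < W" "y' < W"
    using y le_prod_encode_1 le_prod_encode_2 le_less_trans by metis+
  ultimately show "\<exists>d<W. \<exists>y<W. \<exists>d'<W. \<exists>y'<W. s = prod_encode (d, y) \<and> t = prod_encode (d', y') \<and> (d, b, d') \<in> D"
    using y by blast
qed

theorem certificate_complete: "certificate W mI mA mT St F Tr \<Phi> Z U"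
  unfolding certificate_def
proof (intro conjI allI impI)
  show "cone_automaton W St Tr" by (rule Tr_cone_automaton)
  show "justified W mI mT Tr \<Phi>" by (rule all_justified)
  show "pair_closed W Tr Z"
    unfolding pair_closed_def using Z_ONE Z_left Z_right by blast
  show "s \<in> F \<longleftrightarrow> s \<in> St \<and> \<not> (\<exists>q<W. \<exists>r<W. q \<in> mA \<and> (s, q, 0, r) \<in> \<Phi>)" for s
    unfolding F_def using Phi_less by blast
  show "q \<in> U" if "q \<in> mA" for q
  proof -
    have "path mT q [] q" by simp
    then show ?thesis using that U_iff by blast
  qed
  show "q \<in> U" if step: "(q, a, q') \<in> mT \<and> q' \<in> U" for q a q'
  proof -
    obtain qa e where "qa \<in> mA" "path mT q' e qa" using step unfolding U_def by blast
    then have "qa \<in> mA" "path mT q (a # e) qa" using step by auto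
    moreover have "q \<in> Q" using step mT_Q by blast
    ultimately show ?thesis using U_iff by blast
  qed
  show "\<exists>r<W. (0, q, 0, r) \<in> \<Phi>" if "q \<in> mI \<and> q \<in> U" for q
  proof -
    have "(q, 0) \<in> Y []" using that by (intro X0_in_Y) (simp add: X0_Nil)
    then have "(0, q, 0, rank [] q 0) \<in> \<Phi>" using Phi_iff[OF geod_Nil, of q 0 "rank [] q 0"] code_Nil by simp
    then show ?thesis using Phi_less by blast
  qed
  show "\<exists>r'<W. (s', q', 0, r') \<in> \<Phi>"
    if "(s, s', Suc a) \<in> Z \<and> (q, a, q') \<in> mT \<and> q' \<in> U \<and> (s, q, 0, r) \<in> \<Phi>" for s s' a q q' r
    using Phi_transfer that Phi_less by blast
qed

end

end

section \<open>Decidability of the certificate relation\<close>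

context cone_coded_group
begin

lemma finite_D: "finite D"
proof (rule finite_subset)
  show "D \<subseteq> (\<kappa> ` cone ` carrier G) \<times> \<Lambda> \<times> (\<kappa> ` cone ` carrier G)"
  proof
    fix x assume "x \<in> D"
    then obtain g b where g: "x = (\<kappa> (cone g), b, \<kappa> (cone (g \<otimes> \<l> b)))" "g \<in> carrier G" "[b] \<in> cone g"
      unfolding D_def by blast
    then have "b \<in> \<Lambda>" by (simp add: cone_def)
    then show "x \<in> (\<kappa> ` cone ` carrier G) \<times> \<Lambda> \<times> (\<kappa> ` cone ` carrier G)" using g by simp
  qed
  show "finite ((\<kappa> ` cone ` carrier G) \<times> \<Lambda> \<times> (\<kappa> ` cone ` carrier G))"
    using finite_cones finite_letters by simp
qed

lemma finite_LT: "finite LT"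
  by (rule finite_subset[of _ "\<Lambda> \<times> {..<B ^ I} \<times> {..<B ^ I}"]) (auto simp: LT_def finite_letters)

lemma finite_RT: "finite RT"
  by (rule finite_subset[of _ "{..<B ^ I} \<times> \<Lambda> \<times> {..<B ^ I}"]) (auto simp: RT_def finite_letters)

lemma finite_ONE: "finite ONE"
  by (rule finite_subset[of _ "{..<B ^ I}"]) (auto simp: ONE_def)

lemma finite_EQ: "finite EQ"
  by (rule finite_subset[of _ "{..<B ^ I} \<times> {..<B ^ I}"]) (auto simp: EQ_def)

lemma finite_INV: "finite INV"
  by (simp add: INV_def finite_letters)

lemmas decidable_rules = decidable_all decidable_ex decidable_conj decidable_disj decidable_imp decidable_iff decidable_not decidable_eq decidable_less decidable_set3 decidable_set4 decidable_mem
  decidable_finite3[OF finite_D] decidable_finite3[OF finite_LT] decidable_finite3[OF finite_RT] decidable_finite1[OF finite_ONE]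
  decidable_finite2[OF finite_EQ] decidable_finite2[OF finite_INV]

text \<open>\<open>m\<close> codes the input, \<open>n\<close> the output and \<open>c\<close> the
  rest of the certificate; \<open>C\<close> is there to bound the numbers in the tables.
  \<open>Suc 0\<close> codes the set with the single initial state 0. The condition on
  \<open>aT\<close> makes \<open>n\<close> the code of an automaton, not merely a number with
  suitable decoded sets.\<close>

definition cert_num :: "nat \<Rightarrow> nat \<Rightarrow> nat \<Rightarrow> nat \<Rightarrow> bool" where
  "cert_num C n c m \<longleftrightarrow> (\<exists>mS<Suc m. \<exists>mI<Suc m. \<exists>mA<Suc m. \<exists>mT<Suc m. m = list_encode [mS, mI, mA, mT] \<and>
     (\<exists>aS<Suc n. \<exists>aF<Suc n. \<exists>aT<Suc n. n = list_encode [aS, Suc 0, aF, aT] \<and>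
       (\<forall>x<Suc n. x \<in> set_decode aT \<longrightarrow> (\<exists>s<Suc n. \<exists>b<Suc n. \<exists>t<Suc n. x = list_encode [s, b, t])) \<and>
     (\<exists>\<phi><Suc c. \<exists>z<Suc c. \<exists>u<Suc c. c = list_encode [\<phi>, z, u] \<and>
       certificate (n + c + m + C) (set_decode mI) (set_decode mA) (set3 mT)
         (set_decode aS) (set_decode aF) (set3 aT) (set4 \<phi>) (set3 z) (set_decode u))))"

lemma decidable_cert_num: "decidable (Suc (Suc (Suc 0))) (\<lambda>ys. cert_num C (hd ys) (hd (tl ys)) (hd (tl (tl ys))))"
  unfolding cert_num_def certificate_def cone_automaton_def justified_def pair_closed_def move_def prep_def win_def
  by (rule decidable_rules computable_intros)+

end

section \<open>Fellow travelling in hyperbolic groups\<close>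

context hyperbolic_space
begin

lemma quasi_mono:
  assumes "quasi l \<mu> w m" "l \<le> l'" "\<mu> \<le> \<mu>'"
  shows "quasi l' \<mu>' w m"
  unfolding quasi_def
proof (intro conjI allI impI)
  fix i j assume ij: "i \<le> m" "j \<le> m"
  then have "w i \<in> X" "w j \<in> X" using assms(1) unfolding quasi_def by blast+
  then have "0 \<le> d (w i) (w j)" by (rule dist_nonneg)
  then have "l * d (w i) (w j) \<le> l' * d (w i) (w j)" using assms(2) by (intro mult_right_mono)
  moreover have "\<bar>real i - real j\<bar> \<le> l * d (w i) (w j) + \<mu>" using assms(1) ij unfolding quasi_def by blast
  ultimately show "\<bar>real i - real j\<bar> \<le> l' * d (w i) (w j) + \<mu>'" using assms(3) by linarith
next
  show "w i \<in> X" if "i \<le> m" for i using assms(1) that unfolding quasi_def by blast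
  show "d (w i) (w (Suc i)) \<le> l'" if "i < m" for i
  proof -
    have "d (w i) (w (Suc i)) \<le> l" using assms(1) that unfolding quasi_def by blast
    then show ?thesis using assms(2) by linarith
  qed
qed

end

text \<open>Meant for the finitely many states of an automaton: one bound for shortest words that
  lead to a state, or from it to acceptance.\<close>

lemma finite_bounded_choice:
  fixes f :: "'x \<Rightarrow> nat \<Rightarrow> bool"
  assumes "finite A"
  shows "\<exists>E. \<forall>x\<in>A. (\<exists>n. f x n) \<longrightarrow> (\<exists>n\<le>E. f x n)"
  using assms
proof induction
  case (insert a A)
  then obtain E where E: "\<forall>x\<in>A. (\<exists>n. f x n) \<longrightarrow> (\<exists>n\<le>E. f x n)" by blast
  obtain m where m: "(\<exists>n. f a n) \<longrightarrow> (\<exists>n\<le>m. f a n)"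
  proof (cases "\<exists>n. f a n")
    case True
    then obtain n where "f a n" by blast
    then show ?thesis using that[of n] by blast
  qed (use that in blast)
  have "(\<exists>n. f x n) \<longrightarrow> (\<exists>n\<le>max E m. f x n)" if x: "x \<in> insert a A" for x
  proof
    assume ex: "\<exists>n. f x n"
    have "\<exists>n. (n \<le> E \<or> n \<le> m) \<and> f x n"
    proof (cases "x = a")
      case True
      then show ?thesis using m ex by blast
    next
      case False
      then have "x \<in> A" using x by blast
      then show ?thesis using E ex by blast
    qed
    then show "\<exists>n\<le>max E m. f x n" unfolding le_max_iff_disj .
  qed
  then show ?case by blast
qed blast

text \<open>\<open>d\<close> will be the word metric of a generating set that is known to be
  hyperbolic, \<open>ldist\<close> that of the given generators. The two are bi-Lipschitz
  equivalent, so geodesic words are quasi-geodesic for \<open>d\<close>, and the four-point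
  condition is used for \<open>d\<close> alone.\<close>

locale hyperbolic_word_group = word_group + hyperbolic_space "carrier G" d \<delta> for d \<delta> +
  fixes C :: real
  assumes C_ge_1: "1 \<le> C"
    and d_le: "g \<in> carrier G \<Longrightarrow> h \<in> carrier G \<Longrightarrow> d g h \<le> C * real (ldist g h)"
    and ldist_le: "g \<in> carrier G \<Longrightarrow> h \<in> carrier G \<Longrightarrow> real (ldist g h) \<le> C * d g h"
    and geodesic_ex: "g \<in> carrier G \<Longrightarrow> h \<in> carrier G \<Longrightarrow> \<exists>\<gamma> n. geodesic \<gamma> n \<and> \<gamma> 0 = g \<and> \<gamma> n = h"
begin

lemma take_closed: "w \<in> lists \<Lambda> \<Longrightarrow> wval (take t w) \<in> carrier G" "w \<in> lists \<Lambda> \<Longrightarrow> take t w \<in> lists \<Lambda>"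
proof -
  assume "w \<in> lists \<Lambda>"
  then show "take t w \<in> lists \<Lambda>" using set_take_subset[of t w] by (auto simp: lists_eq_set)
  then show "wval (take t w) \<in> carrier G" by (rule wval_closed)
qed

lemma take_step: "w \<in> lists \<Lambda> \<Longrightarrow> i < length w \<Longrightarrow> d (wval (take i w)) (wval (take (Suc i) w)) \<le> C"
proof -
  assume w: "w \<in> lists \<Lambda>" and i: "i < length w"
  have a: "w ! i \<in> \<Lambda>" using w nth_mem[OF i] by (auto simp: lists_eq_set)
  have "take (Suc i) w = take i w @ [w ! i]" using i by (simp add: take_Suc_conv_app_nth)
  then have "wval (take (Suc i) w) = wval (take i w) \<otimes> \<l> (w ! i)" using wval_snoc[OF take_closed(2)[OF w] a] by simp
  then have "ldist (wval (take i w)) (wval (take (Suc i) w)) \<le> 1"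
    using ldist_mult_right[OF take_closed(1)[OF w] letter_closed[OF a]] len_letter[OF a] by simp
  then have "C * real (ldist (wval (take i w)) (wval (take (Suc i) w))) \<le> C * 1"
    using C_ge_1 by (intro mult_left_mono) auto
  then show ?thesis using d_le[OF take_closed(1)[OF w] take_closed(1)[OF w], of i "Suc i"] by linarith
qed

lemma geod_quasi:
  assumes "geod v"
  shows "quasi C 0 (\<lambda>i. wval (take i v)) (length v)"
  unfolding quasi_def
proof (intro conjI allI impI)
  have v: "v \<in> lists \<Lambda>" using geod_lists[OF assms] .
  show "wval (take i v) \<in> carrier G" for i using take_closed(1)[OF v] .
  show "d (wval (take i v)) (wval (take (Suc i) v)) \<le> C" if "i < length v" for i using take_step[OF v that] .
  fix i j assume ij: "i \<le> length v" "j \<le> length v"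
  have "real (ldist (wval (take i v)) (wval (take j v))) = \<bar>real i - real j\<bar>"
  proof (cases "i \<le> j")
    case True
    then show ?thesis using geod_segment[OF assms True ij(2)] by simp
  next
    case False
    then have "ldist (wval (take j v)) (wval (take i v)) = i - j" using geod_segment[OF assms, of j i] ij by simp
    then show ?thesis
      unfolding ldist_sym[OF take_closed(1)[OF v, of i] take_closed(1)[OF v, of j]] using False by simp
  qed
  then show "\<bar>real i - real j\<bar> \<le> C * d (wval (take i v)) (wval (take j v)) + 0"
    using ldist_le[OF take_closed(1)[OF v] take_closed(1)[OF v], of i j] by simp
qed

lemma len_take: "geod v \<Longrightarrow> i \<le> length v \<Longrightarrow> len (wval (take i v)) = i"
  using geod_len[OF geod_take, of v i] by simp

lemma len_diff: "g \<in> carrier G \<Longrightarrow> h \<in> carrier G \<Longrightarrow> len h \<le> len g + ldist g h"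
proof -
  assume "g \<in> carrier G" "h \<in> carrier G"
  then show ?thesis unfolding ldist_def using len_mult[of g "inv g \<otimes> h"] mult_inv_cancel[of g h] by simp
qed

text \<open>Stability gives nearness at possibly different times \<open>t\<close> and
  \<open>j\<close>. Both times are distances from the identity, so they differ by at most
  \<open>k0\<close>, which leads to \<open>2 * k0\<close>; the summand 2 provides
  \<open>k \<ge> 2\<close>.\<close>

lemma fellow_travel_ex:
  "\<exists>k\<ge>2. \<forall>u v t. geod u \<longrightarrow> geod v \<longrightarrow> ldist (wval u) (wval v) \<le> 1 \<longrightarrow> ldist (wval (take t u)) (wval (take t v)) \<le> k"
proof -
  obtain K where K: "K \<ge> 0" "\<And>v n w m i. quasi C 0 v n \<Longrightarrow> quasi C 0 w m \<Longrightarrow> d (v 0) (w 0) \<le> C \<Longrightarrow> d (v n) (w m) \<le> C \<Longrightarrow>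
      i \<le> n \<Longrightarrow> \<exists>j\<le>m. d (v i) (w j) \<le> K"
  proof -
    have "\<exists>K\<ge>0. \<forall>v n w m. quasi C 0 v n \<longrightarrow> quasi C 0 w m \<longrightarrow> d (v 0) (w 0) \<le> C \<longrightarrow> d (v n) (w m) \<le> C \<longrightarrow>
        (\<forall>i\<le>n. \<exists>j\<le>m. d (v i) (w j) \<le> K)"
      by (rule quasi_stability[OF geodesic_ex]) (use C_ge_1 in simp_all)
    then show ?thesis using that by blast
  qed
  define k0 where "k0 = nat \<lceil>C * K\<rceil>"
  have "ldist (wval (take t u)) (wval (take t v)) \<le> 2 * k0 + 2"
    if u: "geod u" and v: "geod v" and near: "ldist (wval u) (wval v) \<le> 1" for u v t
  proof -
    have L: "u \<in> lists \<Lambda>" "v \<in> lists \<Lambda>" using u v geod_lists by auto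
    have cl: "wval u \<in> carrier G" "wval v \<in> carrier G" using L wval_closed by auto
    have luv: "length v \<le> length u + 1" "length u \<le> length v + 1"
      using len_diff[OF cl] len_diff[OF cl(2,1)] near ldist_sym[OF cl] geod_len[OF u] geod_len[OF v] by linarith+
    show ?thesis
    proof (cases "t \<le> length u \<and> t \<le> length v")
      case False
      \<comment> \<open>The lengths differ by at most 1, so a time beyond one end is at or beyond
        the other.\<close>
      then have "take t u = u" "take t v = v" using luv by auto
      then show ?thesis using near by simp
    next
      case True
      have "C * real (ldist (wval u) (wval v)) \<le> C * 1" using near C_ge_1 by (intro mult_left_mono) auto
      then have e: "d (wval u) (wval v) \<le> C" using d_le[OF cl] by linarith
      have z: "d (wval []) (wval []) \<le> C" using dist_refl C_ge_1 by simp
      obtain j where j: "j \<le> length v" "d (wval (take t u)) (wval (take j v)) \<le> K"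
      proof -
        have "\<exists>j\<le>length v. d (wval (take t u)) (wval (take j v)) \<le> K"
          by (rule K(2)[OF geod_quasi[OF u] geod_quasi[OF v]]) (use e z True in simp_all)
        then show ?thesis using that by blast
      qed
      have "C * d (wval (take t u)) (wval (take j v)) \<le> C * K" using j C_ge_1 by (intro mult_left_mono) auto
      then have "real (ldist (wval (take t u)) (wval (take j v))) \<le> C * K"
        using ldist_le[OF take_closed(1)[OF L(1)] take_closed(1)[OF L(2)], of t j] by linarith
      then have dj: "ldist (wval (take t u)) (wval (take j v)) \<le> k0" unfolding k0_def by linarith
      have "j \<le> t + k0" "t \<le> j + k0"
        using len_diff[OF take_closed(1)[OF L(1), of t] take_closed(1)[OF L(2), of j]]
          len_diff[OF take_closed(1)[OF L(2), of j] take_closed(1)[OF L(1), of t]] dj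
          ldist_sym[OF take_closed(1)[OF L(1), of t] take_closed(1)[OF L(2), of j]]
          len_take[OF u, of t] len_take[OF v, of j] True j(1)
        by linarith+
      moreover have "ldist (wval (take j v)) (wval (take t v)) \<le> max (t - j) (j - t)"
      proof (cases "j \<le> t")
        case True
        then show ?thesis using geod_segment[OF v, of j t] \<open>t \<le> length u \<and> t \<le> length v\<close> by simp
      next
        case False
        then show ?thesis using geod_segment[OF v, of t j] j
          ldist_sym[OF take_closed(1)[OF L(2)] take_closed(1)[OF L(2)], of j t] by simp
      qed
      moreover have "ldist (wval (take t u)) (wval (take t v)) \<le>
          ldist (wval (take t u)) (wval (take j v)) + ldist (wval (take j v)) (wval (take t v))"
        using take_closed(1)[OF L(1)] take_closed(1)[OF L(2)] by (intro ldist_triangle)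
      ultimately show ?thesis using dj by linarith
    qed
  qed
  then show ?thesis by (intro exI[of _ "2 * k0 + 2"]) simp
qed

text \<open>A segment of a path through an automaton can be completed to an accepted word by words of
  bounded length. So the lower bound on the displacement passes from accepted words to segments.\<close>

lemma automaton_quasi:
  assumes fin: "finite mI" "finite mT" and mT: "mT \<subseteq> UNIV \<times> \<Lambda> \<times> UNIV"
    and qi: "\<And>w p q. p \<in> mI \<Longrightarrow> q \<in> mA \<Longrightarrow> path mT p w q \<Longrightarrow> real (length w) \<le> l * real (len (wval w)) + \<mu>"
    and l: "1 \<le> l" "0 \<le> \<mu>"
  shows "\<exists>M\<ge>0. \<forall>w p q. p \<in> mI \<longrightarrow> path mT p w q \<longrightarrow> (\<exists>qa\<in>mA. \<exists>e. path mT q e qa) \<longrightarrow>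
    quasi (l * C) M (\<lambda>i. wval (take i w)) (length w)"
proof -
  define Q where "Q = mI \<union> (\<lambda>(q, a, q'). q') ` mT"
  have finQ: "finite Q" using fin by (simp add: Q_def)
  have in_Q: "q \<in> Q" if w: "p \<in> mI" "path mT p w q" for p w q
  proof (cases w rule: rev_cases)
    case Nil
    then show ?thesis using w by (simp add: Q_def)
  next
    case (snoc u a)
    then obtain r where "(r, a, q) \<in> mT" using w(2) path_snoc by blast
    from imageI[OF this, of "\<lambda>(q, a, q'). q'"] show ?thesis by (simp add: Q_def)
  qed
  obtain E1 where E1: "\<forall>q\<in>Q. (\<exists>n. \<exists>u. length u = n \<and> (\<exists>p\<in>mI. path mT p u q)) \<longrightarrow>
      (\<exists>n\<le>E1. \<exists>u. length u = n \<and> (\<exists>p\<in>mI. path mT p u q))"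
    using finite_bounded_choice[OF finQ, of "\<lambda>q n. \<exists>u. length u = n \<and> (\<exists>p\<in>mI. path mT p u q)"] by blast
  obtain E2 where E2: "\<forall>q\<in>Q. (\<exists>n. \<exists>u. length u = n \<and> (\<exists>qa\<in>mA. path mT q u qa)) \<longrightarrow>
      (\<exists>n\<le>E2. \<exists>u. length u = n \<and> (\<exists>qa\<in>mA. path mT q u qa))"
    using finite_bounded_choice[OF finQ, of "\<lambda>q n. \<exists>u. length u = n \<and> (\<exists>qa\<in>mA. path mT q u qa)"] by blast
  \<comment> \<open>The completing words have at most \<open>E1\<close> and \<open>E2\<close>
    letters, so they change the displacement of the segment by at most
    \<open>E1 + E2\<close>.\<close>
  define M where "M = l * (real E1 + real E2) + \<mu>"
  have M0: "0 \<le> M" using l by (simp add: M_def)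
  have quasi: "quasi (l * C) M (\<lambda>i. wval (take i w)) (length w)"
    if p: "p \<in> mI" and w: "path mT p w q" and co: "\<exists>qa\<in>mA. \<exists>e. path mT q e qa" for w p q
  proof -
    have wL: "w \<in> lists \<Lambda>" using path_lists[OF w mT] .
    have seg: "real j - real i \<le> l * C * d (wval (take i w)) (wval (take j w)) + M" if ij: "i \<le> j" "j \<le> length w" for i j
    proof -
      define s where "s = drop i (take j w)"
      have tj: "take j w = take i w @ s"
      proof -
        have "take i (take j w) = take i w" using ij by (simp add: min_def)
        then show ?thesis unfolding s_def using append_take_drop_id[of i "take j w"] by simp
      qed
      have ls: "length s = j - i" using ij by (simp add: s_def)
      have "w = take i w @ s @ drop j w" using tj append_take_drop_id[of j w] by simp
      then have "path mT p (take i w @ s @ drop j w) q" using w by simp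
      then obtain qi qj where q: "path mT p (take i w) qi" "path mT qi s qj" "path mT qj (drop j w) q"
        unfolding path_append by blast
      have "path mT p (take i w @ s) qj" using q path_append by blast
      then have QQ: "qi \<in> Q" "qj \<in> Q" using in_Q[OF p] q(1) by blast+
      obtain u p' where u: "length u \<le> E1" "p' \<in> mI" "path mT p' u qi"
        using E1 QQ(1) p q(1) by blast
      obtain qa e where "qa \<in> mA" "path mT q e qa" using co by blast
      then have "path mT qj (drop j w @ e) qa" using q(3) path_append by blast
      then obtain v qa' where v: "length v \<le> E2" "qa' \<in> mA" "path mT qj v qa'"
        using E2 QQ(2) \<open>qa \<in> mA\<close> by blast
      have usv: "path mT p' (u @ s @ v) qa'" using u(3) q(2) v(3) unfolding path_append by blast
      have Ls: "u \<in> lists \<Lambda>" "s \<in> lists \<Lambda>" "v \<in> lists \<Lambda>"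
        using path_lists[OF usv mT] by auto
      have "len (wval (u @ s @ v)) \<le> len (wval u) + (len (wval s) + len (wval v))"
        using len_mult[of "wval u" "wval s \<otimes> wval v"] len_mult[of "wval s" "wval v"]
          wval_closed[OF Ls(1)] wval_closed[OF Ls(2)] wval_closed[OF Ls(3)]
          wval_append[OF Ls(1), of "s @ v"] wval_append[OF Ls(2,3)] Ls by simp
      also have "\<dots> \<le> E1 + (len (wval s) + E2)"
        using len_le[OF Ls(1)] len_le[OF Ls(3)] u(1) v(1) by linarith
      finally have "real (len (wval (u @ s @ v))) \<le> real (E1 + (len (wval s) + E2))" by (simp only: of_nat_le_iff)
      then have "l * real (len (wval (u @ s @ v))) \<le> l * (real E1 + (real (len (wval s)) + real E2))"
        using l by (intro mult_left_mono) auto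
      moreover have "real (length (u @ s @ v)) \<le> l * real (len (wval (u @ s @ v))) + \<mu>"
        using qi[OF u(2) v(2) usv] .
      moreover have "real j - real i \<le> real (length (u @ s @ v))" using ls ij by simp
      ultimately have "real j - real i \<le> l * real (len (wval s)) + M"
        unfolding M_def by (simp add: algebra_simps)
      moreover have "len (wval s) = ldist (wval (take i w)) (wval (take j w))"
        unfolding tj wval_append[OF take_closed(2)[OF wL] Ls(2)]
        using ldist_mult_right[OF take_closed(1)[OF wL] wval_closed[OF Ls(2)]] by simp
      moreover have "l * real (ldist (wval (take i w)) (wval (take j w))) \<le> l * (C * d (wval (take i w)) (wval (take j w)))"
        using ldist_le[OF take_closed(1)[OF wL] take_closed(1)[OF wL]] l by (intro mult_left_mono) auto
      ultimately show ?thesis by (simp add: mult.assoc)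
    qed
    show ?thesis
      unfolding quasi_def
    proof (intro conjI allI impI)
      show "wval (take i w) \<in> carrier G" for i using take_closed(1)[OF wL] .
      show "d (wval (take i w)) (wval (take (Suc i) w)) \<le> l * C" if "i < length w" for i
      proof -
        have "1 * C \<le> l * C" using l C_ge_1 by (intro mult_right_mono) auto
        then show ?thesis using take_step[OF wL that] by linarith
      qed
      fix i j assume ij: "i \<le> length w" "j \<le> length w"
      show "\<bar>real i - real j\<bar> \<le> l * C * d (wval (take i w)) (wval (take j w)) + M"
      proof (cases "i \<le> j")
        case True
        then show ?thesis using seg[OF True ij(2)] by simp
      next
        case False
        then show ?thesis using seg[of j i] ij dist_sym[OF take_closed(1)[OF wL] take_closed(1)[OF wL], of i j] by simp
      qed
    qed
  qed
  then show ?thesis using M0 by blast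
qed

text \<open>The geodesic word is quasi-geodesic with constants \<open>C\<close> and 0, the automaton
  path with \<open>l * C\<close> and \<open>M\<close>; the weaker constants serve for both.\<close>

lemma matching_ex:
  assumes fin: "finite mI" "finite mT" and mT: "mT \<subseteq> UNIV \<times> \<Lambda> \<times> UNIV"
    and qi: "\<And>w p q. p \<in> mI \<Longrightarrow> q \<in> mA \<Longrightarrow> path mT p w q \<Longrightarrow> real (length w) \<le> l * real (len (wval w)) + \<mu>"
    and l: "1 \<le> l" "0 \<le> \<mu>"
  shows "\<exists>R. \<forall>v p w q. geod v \<longrightarrow> p \<in> mI \<longrightarrow> path mT p w q \<longrightarrow> (\<exists>qa\<in>mA. \<exists>e. path mT q e qa) \<longrightarrow> wval v = wval w \<longrightarrow>
      (\<exists>J. J (length v) = length w \<and> (\<forall>i<length v. J i \<le> J (Suc i)) \<and>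
        (\<forall>j\<le>J 0. ldist (wval []) (wval (take j w)) \<le> R) \<and>
        (\<forall>i<length v. \<forall>j. J i \<le> j \<longrightarrow> j \<le> J (Suc i) \<longrightarrow> ldist (wval (take (Suc i) v)) (wval (take j w)) \<le> R))"
proof -
  obtain M where M: "M \<ge> 0" "\<And>w p q. p \<in> mI \<Longrightarrow> path mT p w q \<Longrightarrow> \<exists>qa\<in>mA. \<exists>e. path mT q e qa \<Longrightarrow>
      quasi (l * C) M (\<lambda>i. wval (take i w)) (length w)"
  proof -
    have "\<exists>M\<ge>0. \<forall>w p q. p \<in> mI \<longrightarrow> path mT p w q \<longrightarrow> (\<exists>qa\<in>mA. \<exists>e. path mT q e qa) \<longrightarrow>
      quasi (l * C) M (\<lambda>i. wval (take i w)) (length w)"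
      by (rule automaton_quasi[OF assms])
    then obtain M where M: "M \<ge> 0" and qM: "\<forall>w p q. p \<in> mI \<longrightarrow> path mT p w q \<longrightarrow> (\<exists>qa\<in>mA. \<exists>e. path mT q e qa) \<longrightarrow>
      quasi (l * C) M (\<lambda>i. wval (take i w)) (length w)" by (elim exE conjE)
    show ?thesis by (rule that[OF M qM[rule_format]])
  qed
  have lC: "1 \<le> l * C" "C \<le> l * C"
  proof -
    have "1 * C \<le> l * C" using l C_ge_1 by (intro mult_right_mono) auto
    then show "C \<le> l * C" "1 \<le> l * C" using C_ge_1 by linarith+
  qed
  obtain K where K: "K \<ge> 0" "\<And>v n w m. quasi (l * C) M v n \<Longrightarrow> quasi (l * C) M w m \<Longrightarrow> v 0 = w 0 \<Longrightarrow> v n = w m \<Longrightarrow>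
    (\<exists>J. J n = m \<and> (\<forall>i<n. J i \<le> J (Suc i)) \<and> (\<forall>j\<le>J 0. d (v 0) (w j) \<le> K) \<and>
      (\<forall>i<n. \<forall>j. J i \<le> j \<longrightarrow> j \<le> J (Suc i) \<longrightarrow> d (v (Suc i)) (w j) \<le> K))"
  proof -
    have "\<exists>K\<ge>0. \<forall>v n w m. quasi (l * C) M v n \<longrightarrow> quasi (l * C) M w m \<longrightarrow> v 0 = w 0 \<longrightarrow> v n = w m \<longrightarrow>
      (\<exists>J. J n = m \<and> (\<forall>i<n. J i \<le> J (Suc i)) \<and> (\<forall>j\<le>J 0. d (v 0) (w j) \<le> K) \<and>
        (\<forall>i<n. \<forall>j. J i \<le> j \<longrightarrow> j \<le> J (Suc i) \<longrightarrow> d (v (Suc i)) (w j) \<le> K))"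
      by (rule quasi_monotone_matching[OF geodesic_ex lC(1) M(1)])
    then obtain K where K: "K \<ge> 0" and qK: "\<forall>v n w m. quasi (l * C) M v n \<longrightarrow> quasi (l * C) M w m \<longrightarrow> v 0 = w 0 \<longrightarrow> v n = w m \<longrightarrow>
      (\<exists>J. J n = m \<and> (\<forall>i<n. J i \<le> J (Suc i)) \<and> (\<forall>j\<le>J 0. d (v 0) (w j) \<le> K) \<and>
        (\<forall>i<n. \<forall>j. J i \<le> j \<longrightarrow> j \<le> J (Suc i) \<longrightarrow> d (v (Suc i)) (w j) \<le> K))" by (elim exE conjE)
    show ?thesis by (rule that[OF K qK[rule_format]])
  qed
  define R where "R = nat \<lceil>C * K\<rceil>"
  have R: "ldist g h \<le> R" if "g \<in> carrier G" "h \<in> carrier G" "d g h \<le> K" for g h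
  proof -
    have "C * d g h \<le> C * K" using that(3) C_ge_1 by (intro mult_left_mono) auto
    then have "real (ldist g h) \<le> C * K" using ldist_le[OF that(1,2)] by linarith
    then show ?thesis unfolding R_def by linarith
  qed
  have match: "\<exists>J. J (length v) = length w \<and> (\<forall>i<length v. J i \<le> J (Suc i)) \<and>
        (\<forall>j\<le>J 0. ldist (wval []) (wval (take j w)) \<le> R) \<and>
        (\<forall>i<length v. \<forall>j. J i \<le> j \<longrightarrow> j \<le> J (Suc i) \<longrightarrow> ldist (wval (take (Suc i) v)) (wval (take j w)) \<le> R)"
    if v: "geod v" and p: "p \<in> mI" and w: "path mT p w q" and co: "\<exists>qa\<in>mA. \<exists>e. path mT q e qa" and vw: "wval v = wval w"
    for v p w q
  proof -
    have L: "v \<in> lists \<Lambda>" "w \<in> lists \<Lambda>" using geod_lists[OF v] path_lists[OF w mT] by auto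
    have "quasi (l * C) M (\<lambda>i. wval (take i v)) (length v)" by (rule quasi_mono[OF geod_quasi[OF v] lC(2) M(1)])
    from K(2)[OF this M(2)[OF p w co]]
    have "\<exists>J. J (length v) = length w \<and> (\<forall>i<length v. J i \<le> J (Suc i)) \<and>
      (\<forall>j\<le>J 0. d (wval (take 0 v)) (wval (take j w)) \<le> K) \<and>
      (\<forall>i<length v. \<forall>j. J i \<le> j \<longrightarrow> j \<le> J (Suc i) \<longrightarrow> d (wval (take (Suc i) v)) (wval (take j w)) \<le> K)"
      using vw by simp
    then obtain J where J: "J (length v) = length w" "\<forall>i<length v. J i \<le> J (Suc i)"
      "\<forall>j\<le>J 0. d (wval (take 0 v)) (wval (take j w)) \<le> K"
      "\<forall>i<length v. \<forall>j. J i \<le> j \<longrightarrow> j \<le> J (Suc i) \<longrightarrow> d (wval (take (Suc i) v)) (wval (take j w)) \<le> K"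
      by blast
    have "ldist (wval []) (wval (take j w)) \<le> R" if "j \<le> J 0" for j
      using R[of "wval []" "wval (take j w)"] J(3) that take_closed(1)[OF L(2)] by simp
    moreover have "ldist (wval (take (Suc i) v)) (wval (take j w)) \<le> R"
      if "i < length v" "J i \<le> j" "j \<le> J (Suc i)" for i j
      using R[OF take_closed(1)[OF L(1)] take_closed(1)[OF L(2)]] J(4) that by blast
    ultimately show ?thesis using J(1,2) by blast
  qed
  show ?thesis by (intro exI[of _ R] allI impI) (erule (4) match)
qed

end

text \<open>Applied to the word length of another generating set, this compares two word
  metrics.\<close>

lemma (in word_group) subadditive_le_len:
  fixes f :: "'a \<Rightarrow> nat"
  assumes "f \<one> = 0" and sub: "\<And>g h. g \<in> carrier G \<Longrightarrow> h \<in> carrier G \<Longrightarrow> f (g \<otimes> h) \<le> f g + f h"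
  shows "\<exists>C. \<forall>g\<in>carrier G. f g \<le> C * len g"
proof -
  define C where "C = (\<Sum>a\<in>\<Lambda>. f (\<l> a))"
  have le: "f (\<l> a) \<le> C" if "a \<in> \<Lambda>" for a
    unfolding C_def using that finite_letters by (intro member_le_sum) auto
  have word: "f (wval w) \<le> C * length w" if "w \<in> lists \<Lambda>" for w
    using that
  proof (induction w)
    case Nil
    then show ?case using assms(1) by simp
  next
    case (Cons a w)
    have a: "a \<in> \<Lambda>" "w \<in> lists \<Lambda>" using Cons.hyps by auto
    have "f (\<l> a \<otimes> wval w) \<le> f (\<l> a) + f (wval w)" using a by (intro sub) auto
    then show ?case using le[OF a(1)] Cons.IH by (simp add: wval_Cons)
  qed
  have "f g \<le> C * len g" if g: "g \<in> carrier G" for g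
  proof -
    obtain w where w: "geod w" "wval w = g" using geod_ex[OF g] by blast
    show ?thesis using word[OF geod_lists[OF w(1)]] geod_len[OF w(1)] w(2) by simp
  qed
  then show ?thesis by blast
qed

section \<open>Automata over the generators\<close>

fun swap :: "'a + 'a \<Rightarrow> 'a + 'a" where
  "swap (Inl s) = Inr s"
| "swap (Inr s) = Inl s"

definition letters :: "'a set \<Rightarrow> ('a \<Rightarrow> nat) \<Rightarrow> nat set" where
  "letters S c = letter_code c ` (S <+> S)"

definition letter_of :: "'a set \<Rightarrow> ('a \<Rightarrow> nat) \<Rightarrow> nat \<Rightarrow> 'a + 'a" where
  "letter_of S c = inv_into (S <+> S) (letter_code c)"

definition val_of :: "('a, 'b) monoid_scheme \<Rightarrow> 'a set \<Rightarrow> ('a \<Rightarrow> nat) \<Rightarrow> nat \<Rightarrow> 'a" where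
  "val_of G S c a = letter_val G (letter_of S c a)"

definition inv_of :: "'a set \<Rightarrow> ('a \<Rightarrow> nat) \<Rightarrow> nat \<Rightarrow> nat" where
  "inv_of S c a = letter_code c (swap (letter_of S c a))"

definition code_trans :: "('a \<Rightarrow> nat) \<Rightarrow> ('a + 'a) automaton \<Rightarrow> (nat \<times> nat \<times> nat) set" where
  "code_trans c M = (\<lambda>(p, x, q). (p, letter_code c x, q)) ` transitions M"

lemma letter_of_code:
  assumes "inj_on c S" "x \<in> S <+> S"
  shows "letter_of S c (letter_code c x) = x"
proof -
  have "inj_on (letter_code c) (S <+> S)"
    using assms(1) by (auto simp: letter_code_def sum_encode_eq intro!: inj_onI dest: inj_onD)
  then show ?thesis unfolding letter_of_def using assms(2) by (rule inv_into_f_f)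
qed

locale coded_generators = group G for G :: "('a, 'b) monoid_scheme" (structure) +
  fixes S :: "'a set" and c :: "'a \<Rightarrow> nat"
  assumes generating: "finite_generating_set G S" and inj_c: "inj_on c S"
begin

lemma S_carrier: "s \<in> S \<Longrightarrow> s \<in> carrier G" and finite_S: "finite S" and generate_S: "generate G S = carrier G"
  using generating unfolding finite_generating_set_def by blast+

lemma letter_val_closed: "x \<in> S <+> S \<Longrightarrow> letter_val G x \<in> carrier G"
proof -
  assume x: "x \<in> S <+> S"
  show ?thesis
  proof (cases x)
    case (Inl s)
    then have "s \<in> S" using x by blast
    then show ?thesis using Inl S_carrier by simp
  next
    case (Inr s)
    then have "s \<in> S" using x by blast
    then show ?thesis using Inr S_carrier by simp
  qed
qed

lemma val_of_code: "x \<in> S <+> S \<Longrightarrow> val_of G S c (letter_code c x) = letter_val G x"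
  unfolding val_of_def by (simp only: letter_of_code[OF inj_c])

lemma foldr_code:
  "w \<in> lists (S <+> S) \<Longrightarrow> foldr (\<lambda>a g. val_of G S c a \<otimes> g) (map (letter_code c) w) \<one> = word_val G w"
  by (induction w rule: lists.induct) (simp_all add: val_of_code)

lemma word_val_closed: "w \<in> lists (S <+> S) \<Longrightarrow> word_val G w \<in> carrier G"
  by (induction w rule: lists.induct) (simp_all add: letter_val_closed)

lemma word_val_append:
  "u \<in> lists (S <+> S) \<Longrightarrow> v \<in> lists (S <+> S) \<Longrightarrow> word_val G (u @ v) = word_val G u \<otimes> word_val G v"
proof (induction u rule: lists.induct)
  case Nil
  then show ?case using word_val_closed by simp
next
  case (Cons x u)
  then show ?case using word_val_closed[of u] word_val_closed[of v] letter_val_closed[of x] by (simp add: m_assoc)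
qed

lemma word_ex:
  assumes "g \<in> carrier G"
  shows "\<exists>w\<in>lists (S <+> S). word_val G w = g"
proof -
  have "g \<in> generate G S" using assms generate_S by simp
  then show ?thesis
  proof (induction rule: generate.induct)
    case one
    have "word_val G [] = \<one>" by simp
    then show ?case by blast
  next
    case (incl h)
    then have "word_val G [Inl h] = h" "[Inl h] \<in> lists (S <+> S)" using S_carrier by auto
    then show ?case by blast
  next
    case (inv h)
    then have "word_val G [Inr h] = inv h" "[Inr h] \<in> lists (S <+> S)" using S_carrier by auto
    then show ?case by blast
  next
    case (eng h1 h2)
    then obtain u v where uv: "u \<in> lists (S <+> S)" "word_val G u = h1" "v \<in> lists (S <+> S)" "word_val G v = h2" by blast
    have "word_val G (u @ v) = h1 \<otimes> h2" using word_val_append[OF uv(1,3)] uv(2,4) by simp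
    moreover have "u @ v \<in> lists (S <+> S)" using uv(1,3) by simp
    ultimately show ?case by blast
  qed
qed

lemma val_of_closed: "a \<in> letters S c \<Longrightarrow> val_of G S c a \<in> carrier G"
proof -
  assume "a \<in> letters S c"
  then obtain x where x: "x \<in> S <+> S" "a = letter_code c x" unfolding letters_def by blast
  show ?thesis unfolding x(2) val_of_code[OF x(1)] by (rule letter_val_closed[OF x(1)])
qed

lemma swap_closed: "x \<in> S <+> S \<Longrightarrow> swap x \<in> S <+> S"
  by (erule PlusE) (simp_all add: InlI InrI)

lemma letter_val_swap: "x \<in> S <+> S \<Longrightarrow> letter_val G (swap x) = inv (letter_val G x)"
  by (erule PlusE) (simp_all add: S_carrier)

lemma inv_of_letters:
  assumes "a \<in> letters S c"
  shows "inv_of S c a \<in> letters S c" "val_of G S c (inv_of S c a) = inv (val_of G S c a)"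
proof -
  obtain x where x: "x \<in> S <+> S" "a = letter_code c x" using assms unfolding letters_def by blast
  have i: "inv_of S c a = letter_code c (swap x)" unfolding inv_of_def x(2) letter_of_code[OF inj_c x(1)] ..
  show "inv_of S c a \<in> letters S c" unfolding i letters_def by (rule imageI[OF swap_closed[OF x(1)]])
  show "val_of G S c (inv_of S c a) = inv (val_of G S c a)"
    unfolding i val_of_code[OF swap_closed[OF x(1)]] unfolding x(2) val_of_code[OF x(1)]
    by (rule letter_val_swap[OF x(1)])
qed

lemma word_group_letters: "word_group G (letters S c) (val_of G S c) (inv_of S c)"
proof (rule word_group.intro[OF group_axioms word_group_axioms.intro])
  show "finite (letters S c)" using finite_S unfolding letters_def by (intro finite_imageI finite_Plus)
  show "val_of G S c a \<in> carrier G" if "a \<in> letters S c" for a using val_of_closed[OF that] .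
  show "inv_of S c a \<in> letters S c" if "a \<in> letters S c" for a using inv_of_letters(1)[OF that] .
  show "val_of G S c (inv_of S c a) = inv (val_of G S c a)" if "a \<in> letters S c" for a using inv_of_letters(2)[OF that] .
  show "\<exists>w\<in>lists (letters S c). foldr (\<lambda>a g. val_of G S c a \<otimes> g) w \<one> = g" if g: "g \<in> carrier G" for g
  proof -
    obtain w where w: "w \<in> lists (S <+> S)" "word_val G w = g" using word_ex[OF g] by blast
    have "map (letter_code c) w \<in> lists (letters S c)" unfolding letters_def lists_image by (rule imageI[OF w(1)])
    then show ?thesis using foldr_code[OF w(1)] w(2) by blast
  qed
qed

sublocale word_group G "letters S c" "val_of G S c" "inv_of S c"
  by (rule word_group_letters)

lemma wval_code: "w \<in> lists (S <+> S) \<Longrightarrow> wval (map (letter_code c) w) = word_val G w"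
  unfolding wval_def by (rule foldr_code)

lemma lists_letters: "lists (letters S c) = map (letter_code c) ` lists (S <+> S)"
  unfolding letters_def by (rule lists_image)

lemma len_word_length: "len g = word_length G S g"
proof -
  have eq: "(\<exists>u\<in>map (letter_code c) ` lists (S <+> S). length u = n \<and> wval u = g) \<longleftrightarrow>
      (\<exists>w\<in>lists (S <+> S). length w = n \<and> wval (map (letter_code c) w) = g)" for n
    by simp
  have "(\<exists>u\<in>lists (letters S c). length u = n \<and> wval u = g) \<longleftrightarrow> (\<exists>w\<in>lists (S <+> S). length w = n \<and> word_val G w = g)" for n
    unfolding lists_letters eq by (intro bex_cong) (simp_all add: wval_code)
  then show ?thesis unfolding len_def word_length_def by simp
qed

lemma word_dist_ldist: "word_dist G S g h = real (ldist g h)"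
  unfolding word_dist_def ldist_def len_word_length ..

lemma hyperbolic_space_word_dist:
  assumes "gromov_hyperbolic (carrier G) (word_dist G S)"
  shows "\<exists>\<delta>. hyperbolic_space (carrier G) (word_dist G S) \<delta>"
proof -
  obtain \<delta> where \<delta>: "\<delta> \<ge> 0" "\<And>p x y z. p \<in> carrier G \<Longrightarrow> x \<in> carrier G \<Longrightarrow> y \<in> carrier G \<Longrightarrow> z \<in> carrier G \<Longrightarrow>
     gromov_product (word_dist G S) p x z \<ge>
       min (gromov_product (word_dist G S) p x y) (gromov_product (word_dist G S) p y z) - \<delta>"
    using assms unfolding gromov_hyperbolic_def by blast
  have "hyperbolic_space (carrier G) (word_dist G S) (\<delta> + 1)"
  proof unfold_locales
    show "1 \<le> \<delta> + 1" using \<delta>(1) by simp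
    show "word_dist G S x x = 0" if "x \<in> carrier G" for x using that by (simp add: word_dist_ldist)
    show "0 \<le> word_dist G S x y" for x y by (simp add: word_dist_ldist)
    show "word_dist G S x y = word_dist G S y x" if "x \<in> carrier G" "y \<in> carrier G" for x y
      unfolding word_dist_ldist using ldist_sym[OF that] by simp
    show "word_dist G S x z \<le> word_dist G S x y + word_dist G S y z"
      if "x \<in> carrier G" "y \<in> carrier G" "z \<in> carrier G" for x y z
      unfolding word_dist_ldist using ldist_triangle[OF that] by linarith
    show "min (gromov_product (word_dist G S) p x y) (gromov_product (word_dist G S) p y z) - (\<delta> + 1)
        \<le> gromov_product (word_dist G S) p x z"
      if "p \<in> carrier G" "x \<in> carrier G" "y \<in> carrier G" "z \<in> carrier G" for p x y z
      using \<delta>(2)[OF that] by linarith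
  qed
  then show ?thesis by blast
qed

text \<open>A geodesic word for the quotient of \<open>g\<close> and \<open>h\<close>, translated by
  \<open>g\<close>.\<close>

lemma geodesic_word_dist:
  assumes H: "hyperbolic_space (carrier G) (word_dist G S) \<delta>" and gh: "g \<in> carrier G" "h \<in> carrier G"
  shows "\<exists>\<gamma> n. hyperbolic_space.geodesic (carrier G) (word_dist G S) \<gamma> n \<and> \<gamma> 0 = g \<and> \<gamma> n = h"
proof -
  obtain u where u: "geod u" "wval u = inv g \<otimes> h" using geod_ex[of "inv g \<otimes> h"] gh by blast
  have L: "u \<in> lists (letters S c)" using geod_lists[OF u(1)] .
  have cl: "wval (take t u) \<in> carrier G" for t
    using L set_take_subset[of t u] by (intro wval_closed) (auto simp: lists_eq_set)
  let ?\<gamma> = "\<lambda>i. g \<otimes> wval (take i u)"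
  have *: "word_dist G S (?\<gamma> i) (?\<gamma> j) = real j - real i" if "i \<le> j" "j \<le> length u" for i j
    unfolding word_dist_ldist ldist_left[OF gh(1) cl cl] geod_segment[OF u(1) that] using that by simp
  have "word_dist G S (?\<gamma> i) (?\<gamma> j) = \<bar>real i - real j\<bar>" if ij: "i \<le> length u" "j \<le> length u" for i j
  proof (cases "i \<le> j")
    case True
    then show ?thesis using *[OF True ij(2)] by simp
  next
    case False
    have "word_dist G S (?\<gamma> i) (?\<gamma> j) = word_dist G S (?\<gamma> j) (?\<gamma> i)"
      unfolding word_dist_ldist using ldist_sym[of "?\<gamma> i" "?\<gamma> j"] gh cl by simp
    then show ?thesis using *[of j i] False ij by simp
  qed
  then have "hyperbolic_space.geodesic (carrier G) (word_dist G S) ?\<gamma> (length u)"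
    unfolding hyperbolic_space.geodesic_def[OF H] using gh(1) cl by simp
  moreover have "?\<gamma> 0 = g" "?\<gamma> (length u) = h" using gh u(2) by (simp_all add: mult_inv_cancel)
  ultimately show ?thesis by blast
qed

lemma path_run:
  assumes M: "transitions M \<subseteq> UNIV \<times> (S <+> S) \<times> UNIV" and "w \<in> lists (S <+> S)"
  shows "path (code_trans c M) p (map (letter_code c) w) q \<longleftrightarrow> run M p w q"
  using assms(2)
proof (induction w arbitrary: p rule: lists.induct)
  case Nil
  then show ?case by simp
next
  case (Cons x w)
  have "(p, letter_code c x, r) \<in> code_trans c M \<longleftrightarrow> (p, x, r) \<in> transitions M" for r
  proof
    assume "(p, letter_code c x, r) \<in> code_trans c M"
    then obtain y where y: "(p, y, r) \<in> transitions M" "letter_code c x = letter_code c y"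
      unfolding code_trans_def by auto
    have "y \<in> S <+> S" using subsetD[OF M y(1)] by blast
    then have "letter_of S c (letter_code c y) = y" by (rule letter_of_code[OF inj_c])
    then have "x = y" using letter_of_code[OF inj_c Cons.hyps(1)] unfolding y(2) by simp
    then show "(p, x, r) \<in> transitions M" using y(1) by simp
  next
    assume "(p, x, r) \<in> transitions M"
    from imageI[OF this, of "\<lambda>(p, x, q). (p, letter_code c x, q)"]
    show "(p, letter_code c x, r) \<in> code_trans c M" unfolding code_trans_def by simp
  qed
  then show ?case unfolding list.map path.simps run.simps Cons.IH by blast
qed

lemma finite_automaton_transitions: "finite_automaton (S <+> S) M \<Longrightarrow> transitions M \<subseteq> UNIV \<times> (S <+> S) \<times> UNIV"
  unfolding finite_automaton_def by blast

lemma run_lists: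
  assumes M: "transitions M \<subseteq> UNIV \<times> (S <+> S) \<times> UNIV"
  shows "run M p w q \<Longrightarrow> w \<in> lists (S <+> S)"
proof (induction w arbitrary: p)
  case Nil
  show ?case by (rule lists.Nil)
next
  case (Cons x w)
  from Cons.prems obtain r where r: "(p, x, r) \<in> transitions M" "run M r w q" unfolding run.simps by blast
  have "x \<in> S <+> S" using subsetD[OF M r(1)] by blast
  then show ?case using Cons.IH[OF r(2)] by (rule lists.Cons)
qed

lemma code_trans_letters:
  "transitions M \<subseteq> UNIV \<times> (S <+> S) \<times> UNIV \<Longrightarrow> code_trans c M \<subseteq> UNIV \<times> letters S c \<times> UNIV"
proof
  fix y assume M: "transitions M \<subseteq> UNIV \<times> (S <+> S) \<times> UNIV" and "y \<in> code_trans c M"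
  then obtain p x q where y: "(p, x, q) \<in> transitions M" "y = (p, letter_code c x, q)" unfolding code_trans_def by auto
  have "x \<in> S <+> S" using subsetD[OF M y(1)] by blast
  then show "y \<in> UNIV \<times> letters S c \<times> UNIV" unfolding y(2) letters_def by blast
qed

lemma language_code:
  assumes M: "transitions M \<subseteq> UNIV \<times> (S <+> S) \<times> UNIV"
  shows "map (letter_code c) ` language M = {u. \<exists>p\<in>initial M. \<exists>q\<in>accepting M. path (code_trans c M) p u q}"
proof (rule subset_antisym; rule subsetI)
  fix u assume "u \<in> map (letter_code c) ` language M"
  then obtain w p q where w: "u = map (letter_code c) w" "p \<in> initial M" "q \<in> accepting M" "run M p w q"
    unfolding language_def by blast
  then have "path (code_trans c M) p u q" unfolding w(1) path_run[OF M run_lists[OF M w(4)]] by simp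
  then show "u \<in> {u. \<exists>p\<in>initial M. \<exists>q\<in>accepting M. path (code_trans c M) p u q}" using w by blast
next
  fix u assume "u \<in> {u. \<exists>p\<in>initial M. \<exists>q\<in>accepting M. path (code_trans c M) p u q}"
  then obtain p q where u: "p \<in> initial M" "q \<in> accepting M" "path (code_trans c M) p u q" by blast
  have "u \<in> lists (letters S c)" using path_lists[OF u(3) code_trans_letters[OF M]] .
  then obtain w where w: "u = map (letter_code c) w" "w \<in> lists (S <+> S)" unfolding lists_letters by blast
  have "run M p w q" using u(3) unfolding w(1) path_run[OF M w(2)] .
  then show "u \<in> map (letter_code c) ` language M" unfolding w(1) language_def using u by blast
qed

lemma language_lists: "transitions M \<subseteq> UNIV \<times> (S <+> S) \<times> UNIV \<Longrightarrow> language M \<subseteq> lists (S <+> S)"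
proof
  fix w assume M: "transitions M \<subseteq> UNIV \<times> (S <+> S) \<times> UNIV" and "w \<in> language M"
  then obtain p q where "run M p w q" unfolding language_def by blast
  then show "w \<in> lists (S <+> S)" by (rule run_lists[OF M])
qed

lemma word_val_language:
  assumes M: "transitions M \<subseteq> UNIV \<times> (S <+> S) \<times> UNIV"
  shows "word_val G ` language M = wval ` {u. \<exists>p\<in>initial M. \<exists>q\<in>accepting M. path (code_trans c M) p u q}"
  unfolding language_code[OF M, symmetric] image_image
proof (rule image_cong[OF refl])
  fix w assume "w \<in> language M"
  then have "w \<in> lists (S <+> S)" using language_lists[OF M] by blast
  then show "word_val G w = wval (map (letter_code c) w)" by (rule wval_code[symmetric])
qed

section \<open>Automata as numbers\<close>

lemma finite_transitions: "finite_automaton (S <+> S) M \<Longrightarrow> finite (transitions M)"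
proof -
  assume "finite_automaton (S <+> S) M"
  then have sub: "transitions M \<subseteq> states M \<times> (S <+> S) \<times> states M" and fin: "finite (states M)"
    unfolding finite_automaton_def by blast+
  have "finite (states M \<times> (S <+> S) \<times> states M)" by (intro finite_cartesian_product finite_Plus fin finite_S)
  with sub show ?thesis by (rule finite_subset)
qed

lemma automaton_code_sets:
  assumes "finite_automaton (S <+> S) M"
  shows "\<exists>s i a t. automaton_code c M = list_encode [s, i, a, t] \<and> set_decode s = states M \<and> set_decode i = initial M \<and>
    set_decode a = accepting M \<and> set3 t = code_trans c M"
proof -
  let ?f = "\<lambda>(p, x, q). list_encode [p, letter_code c x, q]"
  have fin: "finite (states M)" "finite (initial M)" "finite (accepting M)"
    using assms unfolding finite_automaton_def by (auto intro: finite_subset)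
  have f: "finite (?f ` transitions M)" using finite_transitions[OF assms] by simp
  have "set3 (set_encode (?f ` transitions M)) = code_trans c M"
    unfolding set3_def set_encode_inverse[OF f] code_trans_def
    by (auto simp: image_iff list_encode_eq simp del: list_encode.simps) force+
  then show ?thesis
    using fin set_encode_inverse unfolding automaton_code_def by blast
qed

text \<open>A converse to \<open>automaton_code_sets\<close>: a search returns a mere number, which
  has to be recognised as the code of an automaton.\<close>

lemma decode_automaton:
  assumes triples: "\<And>x. x \<in> set_decode t \<Longrightarrow> \<exists>p l q. x = list_encode [p, l, q]"
    and sub: "set_decode i \<subseteq> set_decode s" "set_decode a \<subseteq> set_decode s"
      "set3 t \<subseteq> set_decode s \<times> letters S c \<times> set_decode s"
  shows "\<exists>N. automaton_code c N = list_encode [s, i, a, t] \<and> finite_automaton (S <+> S) N \<and>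
    initial N = set_decode i \<and> accepting N = set_decode a \<and> code_trans c N = set3 t"
proof -
  define \<tau> where "\<tau> = {(p, x, q). x \<in> S <+> S \<and> (p, letter_code c x, q) \<in> set3 t}"
  define N where "N = \<lparr>states = set_decode s, initial = set_decode i, accepting = set_decode a, transitions = \<tau>\<rparr>"
  have ct: "code_trans c N = set3 t"
  proof (rule subset_antisym; rule subsetI)
    fix y assume "y \<in> code_trans c N"
    then show "y \<in> set3 t" unfolding code_trans_def N_def \<tau>_def by auto
  next
    fix y assume y: "y \<in> set3 t"
    obtain p l q where plq: "y = (p, l, q)" by (cases y) blast
    have "l \<in> letters S c" using y sub(3) plq by blast
    then obtain x where x: "x \<in> S <+> S" "l = letter_code c x" unfolding letters_def by blast
    then have "(p, x, q) \<in> \<tau>" using y plq unfolding \<tau>_def by simp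
    from imageI[OF this, of "\<lambda>(p, x, q). (p, letter_code c x, q)"]
    show "y \<in> code_trans c N" unfolding code_trans_def N_def plq x(2) by simp
  qed
  have "(\<lambda>(p, x, q). list_encode [p, letter_code c x, q]) ` \<tau> = set_decode t"
  proof -
    have "(\<lambda>(p, x, q). list_encode [p, letter_code c x, q]) ` \<tau> = (\<lambda>(p, l, q). list_encode [p, l, q]) ` code_trans c N"
      unfolding code_trans_def N_def automaton.simps image_image by (intro image_cong) auto
    also have "\<dots> = (\<lambda>(p, l, q). list_encode [p, l, q]) ` set3 t" unfolding ct ..
    also have "\<dots> = set_decode t"
    proof (rule subset_antisym; rule subsetI)
      fix y assume "y \<in> (\<lambda>(p, l, q). list_encode [p, l, q]) ` set3 t"
      then show "y \<in> set_decode t" unfolding set3_def by auto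
    next
      fix y assume y: "y \<in> set_decode t"
      then obtain p l q where plq: "y = list_encode [p, l, q]" using triples by blast
      then have "(p, l, q) \<in> set3 t" using y unfolding set3_def by simp
      from imageI[OF this, of "\<lambda>(p, l, q). list_encode [p, l, q]"]
      show "y \<in> (\<lambda>(p, l, q). list_encode [p, l, q]) ` set3 t" unfolding plq by simp
    qed
    finally show ?thesis .
  qed
  then have "automaton_code c N = list_encode [s, i, a, t]"
    unfolding automaton_code_def N_def automaton.simps by simp
  moreover have "finite_automaton (S <+> S) N"
    using sub unfolding finite_automaton_def N_def automaton.simps \<tau>_def by auto
  moreover have "initial N = set_decode i" "accepting N = set_decode a" by (simp_all add: N_def)
  ultimately show ?thesis using ct by blast
qed

end

section \<open>Passing between generating sets, and certificates over the given one\<close>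

lemma coded_generators_ex:
  fixes G :: "('a, 'b) monoid_scheme"
  assumes "group G" "finite_generating_set G S"
  shows "\<exists>c. coded_generators G S c"
proof -
  have "finite S" using assms(2) unfolding finite_generating_set_def by blast
  from finite_imp_inj_to_nat_seg[OF this] obtain c :: "'a \<Rightarrow> nat" where c: "inj_on c S" by blast
  have "coded_generators G S c"
    by (rule coded_generators.intro[OF assms(1) coded_generators_axioms.intro[OF assms(2) c]])
  then show ?thesis by (rule exI[where P = "coded_generators G S" and x = c])
qed

lemma word_length_le:
  fixes G :: "('a, 'b) monoid_scheme"
  assumes "group G" "finite_generating_set G S" "finite_generating_set G T"
  shows "\<exists>C. \<forall>g\<in>carrier G. word_length G T g \<le> C * word_length G S g"
proof -
  obtain c where c: "coded_generators G S c" using coded_generators_ex[OF assms(1,2)] by blast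
  obtain d where d: "coded_generators G T d" using coded_generators_ex[OF assms(1,3)] by blast
  interpret S: coded_generators G S c by (rule c)
  interpret T: coded_generators G T d by (rule d)
  have "\<exists>C. \<forall>g\<in>carrier G. T.len g \<le> C * S.len g"
    by (rule S.subadditive_le_len[where f = T.len, OF T.len_one T.len_mult])
  then show ?thesis unfolding S.len_word_length T.len_word_length .
qed

lemma hyperbolic_word_group_ex:
  fixes G :: "('a, 'b) monoid_scheme"
  assumes hyp: "hyperbolic_group G" and cg: "coded_generators G S c"
  shows "\<exists>d \<delta> C. hyperbolic_word_group G (letters S c) (val_of G S c) (inv_of S c) d \<delta> C"
proof -
  interpret S: coded_generators G S c by (rule cg)
  obtain S0 where S0: "finite_generating_set G S0" "gromov_hyperbolic (carrier G) (word_dist G S0)"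
    using hyp unfolding hyperbolic_group_def by blast
  obtain c0 where c0: "coded_generators G S0 c0" using coded_generators_ex[OF S.is_group S0(1)] by (elim exE)
  interpret S0: coded_generators G S0 c0 by (rule c0)
  obtain \<delta> where H: "hyperbolic_space (carrier G) (word_dist G S0) \<delta>"
    using S0.hyperbolic_space_word_dist[OF S0(2)] by (elim exE)
  obtain C1 where C1: "\<And>g. g \<in> carrier G \<Longrightarrow> S0.len g \<le> C1 * S.len g"
    using word_length_le[OF S.is_group S.generating S0(1)] unfolding S.len_word_length S0.len_word_length by blast
  obtain C2 where C2: "\<And>g. g \<in> carrier G \<Longrightarrow> S.len g \<le> C2 * S0.len g"
    using word_length_le[OF S.is_group S0(1) S.generating] unfolding S.len_word_length S0.len_word_length by blast
  define C where "C = real (max 1 (max C1 C2))"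
  have le: "real (S0.len g) \<le> C * real (S.len g)" "real (S.len g) \<le> C * real (S0.len g)" if g: "g \<in> carrier G" for g
  proof -
    have "C1 * S.len g \<le> max 1 (max C1 C2) * S.len g" "C2 * S0.len g \<le> max 1 (max C1 C2) * S0.len g"
      by (intro mult_right_mono; simp)+
    then have "S0.len g \<le> max 1 (max C1 C2) * S.len g" "S.len g \<le> max 1 (max C1 C2) * S0.len g"
      using C1[OF g] C2[OF g] by linarith+
    then show "real (S0.len g) \<le> C * real (S.len g)" "real (S.len g) \<le> C * real (S0.len g)"
      unfolding C_def of_nat_mult[symmetric] of_nat_le_iff by blast+
  qed
  have "hyperbolic_word_group G (letters S c) (val_of G S c) (inv_of S c) (word_dist G S0) \<delta> C"
  proof (rule hyperbolic_word_group.intro[OF S.word_group_letters H hyperbolic_word_group_axioms.intro])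
    show "1 \<le> C" by (simp add: C_def)
    fix g h assume gh: "g \<in> carrier G" "h \<in> carrier G"
    then have x: "inv\<^bsub>G\<^esub> g \<otimes>\<^bsub>G\<^esub> h \<in> carrier G" by simp
    show "word_dist G S0 g h \<le> C * real (S.ldist g h)"
      unfolding S0.word_dist_ldist S0.ldist_def S.ldist_def by (rule le(1)[OF x])
    show "real (S.ldist g h) \<le> C * word_dist G S0 g h"
      unfolding S0.word_dist_ldist S0.ldist_def S.ldist_def by (rule le(2)[OF x])
    show "\<exists>\<gamma> n. hyperbolic_space.geodesic (carrier G) (word_dist G S0) \<gamma> n \<and> \<gamma> 0 = g \<and> \<gamma> n = h"
      by (rule S0.geodesic_word_dist[OF H gh])
  qed
  then show ?thesis by (intro exI)
qed

lemma cone_coded_group_ex: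
  fixes G :: "('a, 'b) monoid_scheme"
  assumes hyp: "hyperbolic_group G" and cg: "coded_generators G S c"
  shows "\<exists>k B \<kappa>. cone_coded_group G (letters S c) (val_of G S c) (inv_of S c) k B (Suc k) \<kappa>"
proof -
  interpret S: coded_generators G S c by (rule cg)
  obtain d \<delta> C where h: "hyperbolic_word_group G (letters S c) (val_of G S c) (inv_of S c) d \<delta> C"
    using hyperbolic_word_group_ex[OF assms] by (elim exE)
  interpret h: hyperbolic_word_group G "letters S c" "val_of G S c" "inv_of S c" d \<delta> C by (rule h)
  obtain k where k: "k \<ge> 2" "\<forall>u v t. S.geod u \<longrightarrow> S.geod v \<longrightarrow> S.ldist (S.wval u) (S.wval v) \<le> 1 \<longrightarrow>
      S.ldist (S.wval (take t u)) (S.wval (take t v)) \<le> k"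
    using h.fellow_travel_ex by (elim exE conjE)
  have ft: "fellow_travel_group G (letters S c) (val_of G S c) (inv_of S c) k"
    by (rule fellow_travel_group.intro[OF S.word_group_letters fellow_travel_group_axioms.intro[OF k(2)[rule_format]]])
  interpret F: fellow_travel_group G "letters S c" "val_of G S c" "inv_of S c" k by (rule ft)
  obtain B0 where B0: "\<forall>a\<in>letters S c. a < B0"
    using S.finite_letters finite_nat_set_iff_bounded by blast
  \<comment> \<open>Every letter \<open>a\<close> needs the digit \<open>Suc a\<close>, and the base
    must be at least 2 even without letters.\<close>
  define B where "B = B0 + 2"
  have dg: "digit_group G (letters S c) (val_of G S c) (inv_of S c) k B (Suc k)"
  proof (rule digit_group.intro[OF ft digit_group_axioms.intro])
    show "2 \<le> k" by (rule k(1))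
    show "Suc k = Suc k" ..
    show "2 \<le> B" by (simp add: B_def)
    show "Suc a < B" if "a \<in> letters S c" for a using B0 that by (fastforce simp: B_def)
  qed
  obtain f :: "nat list set \<Rightarrow> nat" where f: "inj_on f (S.cone ` carrier G)"
    using finite_imp_inj_to_nat_seg[OF F.finite_cones] by blast
  \<comment> \<open>Shifted by 1 to reserve 0 for the cone type of the identity.\<close>
  define \<kappa> where "\<kappa> X = (if X = S.cone \<one>\<^bsub>G\<^esub> then 0 else Suc (f X))" for X
  have "inj_on \<kappa> (S.cone ` carrier G)"
    using f unfolding \<kappa>_def inj_on_def by simp
  moreover have "\<kappa> (S.cone \<one>\<^bsub>G\<^esub>) = 0" by (simp add: \<kappa>_def)
  ultimately have "cone_coded_group G (letters S c) (val_of G S c) (inv_of S c) k B (Suc k) \<kappa>"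
    by (intro cone_coded_group.intro[OF dg] cone_coded_group_axioms.intro)
  then show ?thesis by (intro exI)
qed

text \<open>The embedding is given in the metric of \<open>T\<close> and used in that of
  \<open>S\<close>. The factor \<open>C + 1\<close> keeps the multiplicative constant at least 1
  even if \<open>C\<close> is 0.\<close>

lemma qi_embedded_len:
  fixes G :: "('a, 'b) monoid_scheme"
  assumes cg: "coded_generators G S c" and T: "finite_generating_set G T"
    and L: "L \<subseteq> lists (S <+> S)" and qi: "qi_embedded G T L"
  shows "\<exists>l \<mu>. 1 \<le> l \<and> 0 \<le> \<mu> \<and> (\<forall>w\<in>L. real (length w) \<le> l * real (word_length G S (word_val G w)) + \<mu>)"
proof -
  interpret S: coded_generators G S c by (rule cg)
  obtain C where C: "\<And>g. g \<in> carrier G \<Longrightarrow> word_length G T g \<le> C * word_length G S g"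
    using word_length_le[OF S.is_group S.generating T] by blast
  obtain l m where lm: "1 \<le> l" "0 \<le> m"
    "\<And>w. w \<in> L \<Longrightarrow> real (word_length G T (word_val G w)) \<ge> 1 / l * real (length w) - m"
    using qi unfolding qi_embedded_def by blast
  have "real (length w) \<le> l * real (C + 1) * real (word_length G S (word_val G w)) + l * m" if w: "w \<in> L" for w
  proof -
    have g: "word_val G w \<in> carrier G" using w L S.word_val_closed by blast
    have "real (word_length G T (word_val G w)) \<le> real (C * word_length G S (word_val G w))"
      unfolding of_nat_le_iff by (rule C[OF g])
    also have "\<dots> \<le> real (C + 1) * real (word_length G S (word_val G w))" by (simp add: algebra_simps)
    finally have "1 / l * real (length w) \<le> real (C + 1) * real (word_length G S (word_val G w)) + m"
      using lm(3)[OF w] by linarith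
    then have "l * (1 / l * real (length w)) \<le> l * (real (C + 1) * real (word_length G S (word_val G w)) + m)"
      using lm(1) by (intro mult_left_mono) auto
    then show ?thesis using lm(1) by (simp add: algebra_simps)
  qed
  moreover have "1 * 1 \<le> l * real (C + 1)" using lm(1) by (intro mult_mono) auto
  ultimately show ?thesis using lm(1,2) by (intro exI[of _ "l * real (C + 1)"] exI[of _ "l * m"]) simp
qed

lemma qi_embedded_geod:
  fixes G :: "('a, 'b) monoid_scheme"
  assumes cg: "coded_generators G S c" and T: "finite_generating_set G T"
    and L: "\<And>w. w \<in> L \<Longrightarrow> word_val G w \<in> carrier G \<and> word_length G S (word_val G w) = length w"
  shows "qi_embedded G T L"
proof -
  interpret S: coded_generators G S c by (rule cg)
  obtain C where C: "\<And>g. g \<in> carrier G \<Longrightarrow> word_length G S g \<le> C * word_length G T g"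
    using word_length_le[OF S.is_group T S.generating] by blast
  have "real (word_length G T (word_val G w)) \<ge> 1 / real (C + 1) * real (length w) - 0" if w: "w \<in> L" for w
  proof -
    have "length w \<le> C * word_length G T (word_val G w)" using C L[OF w] by force
    also have "\<dots> \<le> (C + 1) * word_length G T (word_val G w)" by simp
    finally have "real (length w) \<le> real (C + 1) * real (word_length G T (word_val G w))"
      unfolding of_nat_mult[symmetric] of_nat_le_iff .
    then show ?thesis by (simp add: divide_le_eq mult.commute)
  qed
  then show ?thesis unfolding qi_embedded_def
    by (intro exI[of _ "real (C + 1)"] exI[of _ "0::real"]) simp
qed

text \<open>This applies to whatever the search returns, which may differ from the certificate whose
  existence makes it halt.\<close>

lemma certificate_words:
  fixes G :: "('a, 'b) monoid_scheme" and M :: "('a + 'a) automaton"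
  assumes cg: "coded_generators G S c" and cc: "cone_coded_group G (letters S c) (val_of G S c) (inv_of S c) k B (Suc k) \<kappa>"
    and T: "finite_generating_set G T" and M: "finite_automaton (S <+> S) M"
    and K: "B ^ Suc k \<le> K" "\<And>x y z. (x, y, z) \<in> cone_coded_group.D G (letters S c) (val_of G S c) \<kappa> \<Longrightarrow> x < K \<and> y < K \<and> z < K"
    and cert: "cone_coded_group.cert_num G (letters S c) (val_of G S c) (inv_of S c) B (Suc k) \<kappa> K n e (automaton_code c M)"
  shows "\<exists>N. automaton_code c N = n \<and> finite_automaton (S <+> S) N \<and> qi_embedded G T (language N) \<and>
    represents G (language N) (carrier G - word_val G ` language M)"
proof -
  interpret S: coded_generators G S c by (rule cg)
  interpret cc: cone_coded_group G "letters S c" "val_of G S c" "inv_of S c" k B "Suc k" \<kappa> by (rule cc)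
  let ?m = "automaton_code c M"
  obtain mS mI mA mT where m: "?m = list_encode [mS, mI, mA, mT]" "set_decode mS = states M" "set_decode mI = initial M"
    "set_decode mA = accepting M" "set3 mT = code_trans c M"
    using S.automaton_code_sets[OF M] by blast
  obtain mS' mI' mA' mT' aS aF aT \<phi> z u where p: "?m = list_encode [mS', mI', mA', mT']"
      "n = list_encode [aS, Suc 0, aF, aT]"
      "\<forall>x<Suc n. x \<in> set_decode aT \<longrightarrow> (\<exists>s<Suc n. \<exists>b<Suc n. \<exists>t<Suc n. x = list_encode [s, b, t])"
      "e = list_encode [\<phi>, z, u]"
      "cc.certificate (n + e + ?m + K) (set_decode mI') (set_decode mA') (set3 mT')
         (set_decode aS) (set_decode aF) (set3 aT) (set4 \<phi>) (set3 z) (set_decode u)"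
    using cert unfolding cc.cert_num_def by (elim exE conjE)
  have eqs: "mI' = mI" "mA' = mA" "mT' = mT" using m(1) p(1) by (simp_all add: list_encode_eq del: list_encode.simps)
  have mT: "transitions M \<subseteq> UNIV \<times> (S <+> S) \<times> UNIV" by (rule S.finite_automaton_transitions[OF M])
  have small: "mI < ?m" "mA < ?m" "mT < ?m" "aS < n" "aF < n" "aT < n" "\<phi> < e" "z < e"
    using list_encode_ge[of _ "[mS, mI, mA, mT]"] list_encode_ge[of _ "[aS, Suc 0, aF, aT]"]
      list_encode_ge[of _ "[\<phi>, z, u]"] unfolding m(1) p(2,4) by (simp_all del: list_encode.simps)
  let ?W = "n + e + ?m + K"
  interpret C: certified_group G "letters S c" "val_of G S c" "inv_of S c" k B "Suc k" \<kappa> ?W "set_decode mI"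
    "set_decode mA" "set3 mT" "set_decode aS" "set_decode aF" "set3 aT" "set4 \<phi>" "set3 z" "set_decode u"
  proof (rule certified_group.intro[OF cc certified_group_axioms.intro])
    show "cc.certificate ?W (set_decode mI) (set_decode mA) (set3 mT)
         (set_decode aS) (set_decode aF) (set3 aT) (set4 \<phi>) (set3 z) (set_decode u)"
      using p(5) unfolding eqs .
    show "s < ?W \<and> q < ?W \<and> n' < ?W \<and> r < ?W" if "(s, q, n', r) \<in> set4 \<phi>" for s q n' r
      using set4_less[OF that] small by linarith
    show "s < ?W \<and> b < ?W \<and> t < ?W" if "(s, b, t) \<in> set3 aT" for s b t using set3_less[OF that] small by linarith
    show "s < ?W \<and> b < ?W \<and> t < ?W" if "(s, b, t) \<in> set3 z" for s b t using set3_less[OF that] small by linarith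
    show "s < ?W \<and> b < ?W \<and> t < ?W" if "(s, b, t) \<in> set3 mT" for s b t using set3_less[OF that] small by linarith
    show "q < ?W" if "q \<in> set_decode mI" for q using set_decode_less[OF that] small by linarith
    show "q < ?W" if "q \<in> set_decode mA" for q using set_decode_less[OF that] small by linarith
    show "q < ?W" if "q \<in> set_decode aS" for q using set_decode_less[OF that] small by linarith
    show "q < ?W" if "q \<in> set_decode aF" for q using set_decode_less[OF that] small by linarith
    show "s < ?W \<and> b < ?W \<and> t < ?W" if "(s, b, t) \<in> cc.D" for s b t using K(2)[OF that] by linarith
    show "B ^ Suc k \<le> ?W" using K(1) by linarith
    show "set3 mT \<subseteq> UNIV \<times> letters S c \<times> UNIV" unfolding m(5) by (rule S.code_trans_letters[OF mT])
  qed
  have one: "set_decode (Suc 0) = {0}"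
    using set_encode_inverse[of "{0}"] by (simp add: set_encode_def)
  have "\<exists>N. automaton_code c N = list_encode [aS, Suc 0, aF, aT] \<and> finite_automaton (S <+> S) N \<and>
    initial N = set_decode (Suc 0) \<and> accepting N = set_decode aF \<and> code_trans c N = set3 aT"
  proof (rule S.decode_automaton)
    show "\<exists>p l q. x = list_encode [p, l, q]" if x: "x \<in> set_decode aT" for x
    proof -
      have "x < Suc n" using set_decode_less[OF x] small by linarith
      then show ?thesis using p(3) x by blast
    qed
    show "set_decode (Suc 0) \<subseteq> set_decode aS" unfolding one using C.zero_state(1) by blast
    show "set_decode aF \<subseteq> set_decode aS" using C.accepting_iff by blast
    show "set3 aT \<subseteq> set_decode aS \<times> letters S c \<times> set_decode aS"
    proof
      fix x assume x: "x \<in> set3 aT"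
      obtain s b t where sbt: "x = (s, b, t)" by (cases x) blast
      have "s \<in> set_decode aS" "t \<in> set_decode aS" using C.Tr_states x unfolding sbt by blast+
      moreover have "b \<in> letters S c" using C.Tr_letters x unfolding sbt by blast
      ultimately show "x \<in> set_decode aS \<times> letters S c \<times> set_decode aS" unfolding sbt by blast
    qed
  qed
  then obtain N where N: "automaton_code c N = n" "finite_automaton (S <+> S) N"
    "initial N = {0}" "accepting N = set_decode aF" "code_trans c N = set3 aT"
    unfolding one p(2) by (elim exE conjE)
  have NT: "transitions N \<subseteq> UNIV \<times> (S <+> S) \<times> UNIV" by (rule S.finite_automaton_transitions[OF N(2)])
  have "qi_embedded G T (language N)"
  proof (rule qi_embedded_geod[OF cg T])
    fix w assume w: "w \<in> language N"
    have wL: "w \<in> lists (S <+> S)" using w S.language_lists[OF NT] by blast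
    have "map (letter_code c) w \<in> map (letter_code c) ` language N" using w by (rule imageI)
    then obtain q where "path (set3 aT) 0 (map (letter_code c) w) q"
      unfolding S.language_code[OF NT] N(3,5) by blast
    then have "S.geod (map (letter_code c) w)" using C.path_geod by blast
    then have "S.len (S.wval (map (letter_code c) w)) = length w" using S.geod_len by fastforce
    then show "word_val G w \<in> carrier G \<and> word_length G S (word_val G w) = length w"
      unfolding S.wval_code[OF wL] S.len_word_length using S.word_val_closed[OF wL] by blast
  qed
  moreover have "represents G (language N) (carrier G - word_val G ` language M)"
  proof -
    have "word_val G ` language N = S.wval ` {v. \<exists>s\<in>set_decode aF. path (set3 aT) 0 v s}"
      unfolding S.word_val_language[OF NT] N(3,4,5) by simp
    also have "\<dots> = carrier G - (\<Union>q\<in>set_decode mA. cc.reach (set_decode mI) (set3 mT) q)"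
      by (rule C.certificate_sound)
    also have "(\<Union>q\<in>set_decode mA. cc.reach (set_decode mI) (set3 mT) q) = word_val G ` language M"
      unfolding S.word_val_language[OF mT] cc.reach_def m(3,4,5) by blast
    finally show ?thesis unfolding represents_def .
  qed
  ultimately show ?thesis using N(1,2) by blast
qed

section \<open>Computing complements and unions\<close>

text \<open>Here the embedding of the input is used: it yields the radius \<open>R\<close> of the
  matching, from which \<open>matched_automaton\<close> builds a certificate.\<close>

lemma cert_num_ex:
  fixes G :: "('a, 'b) monoid_scheme" and M :: "('a + 'a) automaton"
  assumes hyp: "hyperbolic_group G" and cg: "coded_generators G S c"
    and cc: "cone_coded_group G (letters S c) (val_of G S c) (inv_of S c) k B (Suc k) \<kappa>"
    and T: "finite_generating_set G T" and M: "finite_automaton (S <+> S) M" and qi: "qi_embedded G T (language M)"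
  shows "\<exists>n e. cone_coded_group.cert_num G (letters S c) (val_of G S c) (inv_of S c) B (Suc k) \<kappa> K n e (automaton_code c M)"
proof -
  interpret S: coded_generators G S c by (rule cg)
  obtain d \<delta> C where h: "hyperbolic_word_group G (letters S c) (val_of G S c) (inv_of S c) d \<delta> C"
    using hyperbolic_word_group_ex[OF hyp cg] by (elim exE)
  interpret h: hyperbolic_word_group G "letters S c" "val_of G S c" "inv_of S c" d \<delta> C by (rule h)
  interpret cc: cone_coded_group G "letters S c" "val_of G S c" "inv_of S c" k B "Suc k" \<kappa> by (rule cc)
  have MT: "transitions M \<subseteq> UNIV \<times> (S <+> S) \<times> UNIV" by (rule S.finite_automaton_transitions[OF M])
  have code_letters: "code_trans c M \<subseteq> UNIV \<times> letters S c \<times> UNIV" by (rule S.code_trans_letters[OF MT])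
  have finI: "finite (initial M)" "finite (accepting M)"
    using M unfolding finite_automaton_def by (meson finite_subset)+
  have finT: "finite (code_trans c M)" unfolding code_trans_def using S.finite_transitions[OF M] by (rule finite_imageI)
  obtain l \<mu> where l: "1 \<le> l" "0 \<le> \<mu>"
    "\<forall>w\<in>language M. real (length w) \<le> l * real (word_length G S (word_val G w)) + \<mu>"
    using qi_embedded_len[OF cg T S.language_lists[OF MT] qi] by (elim exE conjE)
  have len: "real (length u) \<le> l * real (S.len (S.wval u)) + \<mu>"
    if "p \<in> initial M" "q \<in> accepting M" "path (code_trans c M) p u q" for u p q
  proof -
    have "u \<in> map (letter_code c) ` language M" unfolding S.language_code[OF MT] using that by blast
    then obtain w where w: "w \<in> language M" "u = map (letter_code c) w" by blast
    have wL: "w \<in> lists (S <+> S)" using w(1) S.language_lists[OF MT] by blast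
    show ?thesis using l(3) w(1) unfolding w(2) S.wval_code[OF wL] S.len_word_length length_map by blast
  qed
  obtain R where R: "\<forall>v p w q. S.geod v \<longrightarrow> p \<in> initial M \<longrightarrow> path (code_trans c M) p w q \<longrightarrow>
      (\<exists>qa\<in>accepting M. \<exists>e. path (code_trans c M) q e qa) \<longrightarrow> S.wval v = S.wval w \<longrightarrow>
      (\<exists>J. J (length v) = length w \<and> (\<forall>i<length v. J i \<le> J (Suc i)) \<and>
        (\<forall>j\<le>J 0. S.ldist (S.wval []) (S.wval (take j w)) \<le> R) \<and>
        (\<forall>i<length v. \<forall>j. J i \<le> j \<longrightarrow> j \<le> J (Suc i) \<longrightarrow> S.ldist (S.wval (take (Suc i) v)) (S.wval (take j w)) \<le> R))"
  proof -
    have "\<exists>R. \<forall>v p w q. S.geod v \<longrightarrow> p \<in> initial M \<longrightarrow> path (code_trans c M) p w q \<longrightarrow>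
      (\<exists>qa\<in>accepting M. \<exists>e. path (code_trans c M) q e qa) \<longrightarrow> S.wval v = S.wval w \<longrightarrow>
      (\<exists>J. J (length v) = length w \<and> (\<forall>i<length v. J i \<le> J (Suc i)) \<and>
        (\<forall>j\<le>J 0. S.ldist (S.wval []) (S.wval (take j w)) \<le> R) \<and>
        (\<forall>i<length v. \<forall>j. J i \<le> j \<longrightarrow> j \<le> J (Suc i) \<longrightarrow> S.ldist (S.wval (take (Suc i) v)) (S.wval (take j w)) \<le> R))"
      by (rule h.matching_ex[OF finI(1) finT code_letters _ l(1,2)]) (erule (2) len)
    then show ?thesis by (elim exE) (rule that)
  qed
  interpret A: matched_automaton G "letters S c" "val_of G S c" "inv_of S c" k B "Suc k" \<kappa>
    "initial M" "accepting M" "code_trans c M" R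
    by (rule matched_automaton.intro[OF cc matched_automaton_axioms.intro[OF finI(1) finT code_letters R[rule_format]]])
  obtain mS mI mA mT where m: "automaton_code c M = list_encode [mS, mI, mA, mT]" "set_decode mS = states M"
    "set_decode mI = initial M" "set_decode mA = accepting M" "set3 mT = code_trans c M"
    using S.automaton_code_sets[OF M] by (elim exE conjE)
  have finU: "finite A.U"
    by (rule finite_subset[of _ "A.Q \<union> accepting M"]) (use A.finite_Q finI(2) in \<open>auto simp: A.U_def\<close>)
  obtain aT where aT: "set3 aT = A.Tr" "\<forall>w\<in>set_decode aT. \<exists>x y z. w = list_encode [x, y, z]"
    using set3_surj[OF A.finite_Tr] by (elim exE conjE)
  obtain \<phi> where \<phi>: "set4 \<phi> = A.\<Phi>" using set4_surj[OF A.finite_Phi] by (elim exE)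
  obtain z where z: "set3 z = A.Z" using set3_surj[OF A.finite_Z] by (elim exE conjE)
  define aS aF u where "aS = set_encode A.St" and "aF = set_encode A.F" and "u = set_encode A.U"
  have decidable: "set_decode aS = A.St" "set_decode aF = A.F" "set_decode u = A.U"
    unfolding aS_def aF_def u_def using set_encode_inverse A.finite_St A.finite_F finU by blast+
  define n e where "n = list_encode [aS, Suc 0, aF, aT]" and "e = list_encode [\<phi>, z, u]"
  let ?m = "automaton_code c M"
  have small: "mS < ?m" "mI < ?m" "mA < ?m" "mT < ?m" "aS < n" "aF < n" "aT < n" "\<phi> < e" "z < e" "u < e"
    using list_encode_ge[of _ "[mS, mI, mA, mT]"] list_encode_ge[of _ "[aS, Suc 0, aF, aT]"]
      list_encode_ge[of _ "[\<phi>, z, u]"] unfolding m(1) n_def e_def by (simp_all del: list_encode.simps)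
  have cert: "cc.certificate (n + e + ?m + K) (set_decode mI) (set_decode mA) (set3 mT)
         (set_decode aS) (set_decode aF) (set3 aT) (set4 \<phi>) (set3 z) (set_decode u)"
    unfolding m(3,4,5) decidable aT(1) \<phi> z
  proof (rule A.certificate_complete)
    show "s < n + e + ?m + K \<and> q < n + e + ?m + K \<and> n' < n + e + ?m + K \<and> r < n + e + ?m + K"
      if "(s, q, n', r) \<in> A.\<Phi>" for s q n' r
      using set4_less[of s q n' r \<phi>] that small unfolding \<phi> by linarith
    show "s < n + e + ?m + K \<and> b < n + e + ?m + K \<and> t < n + e + ?m + K" if "(s, b, t) \<in> A.Tr" for s b t
      using set3_less[of s b t aT] that small unfolding aT(1) by linarith
  qed
  have triples: "\<forall>x<Suc n. x \<in> set_decode aT \<longrightarrow> (\<exists>s<Suc n. \<exists>b<Suc n. \<exists>t<Suc n. x = list_encode [s, b, t])"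
  proof (intro allI impI)
    fix x assume "x < Suc n" and x: "x \<in> set_decode aT"
    obtain s b t where sbt: "x = list_encode [s, b, t]" using aT(2) x by blast
    then have "(s, b, t) \<in> set3 aT" using x unfolding set3_def by simp
    from set3_less[OF this] have "s < Suc n" "b < Suc n" "t < Suc n" using small by linarith+
    then show "\<exists>s<Suc n. \<exists>b<Suc n. \<exists>t<Suc n. x = list_encode [s, b, t]" using sbt by blast
  qed
  have "cc.cert_num K n e ?m"
    unfolding cc.cert_num_def
    by (rule exI[of _ mS], rule conjI[OF less_SucI[OF small(1)]], rule exI[of _ mI], rule conjI[OF less_SucI[OF small(2)]],
        rule exI[of _ mA], rule conjI[OF less_SucI[OF small(3)]], rule exI[of _ mT], rule conjI[OF less_SucI[OF small(4)]],
        rule conjI[OF m(1)], rule exI[of _ aS], rule conjI[OF less_SucI[OF small(5)]],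
        rule exI[of _ aF], rule conjI[OF less_SucI[OF small(6)]], rule exI[of _ aT], rule conjI[OF less_SucI[OF small(7)]],
        rule conjI[OF n_def], rule conjI[OF triples],
        rule exI[of _ \<phi>], rule conjI[OF less_SucI[OF small(8)]], rule exI[of _ z], rule conjI[OF less_SucI[OF small(9)]],
        rule exI[of _ u], rule conjI[OF less_SucI[OF small(10)]], rule conjI[OF e_def], rule cert)
  then show ?thesis by (intro exI)
qed

lemma complement_program:
  fixes G :: "('a, 'b) monoid_scheme"
  assumes hyp: "hyperbolic_group G" and cg: "coded_generators G S c" and T: "finite_generating_set G T"
  shows "\<exists>prog. \<forall>M :: ('a + 'a) automaton. finite_automaton (S <+> S) M \<longrightarrow> qi_embedded G T (language M) \<longrightarrow>
    (\<exists>N. computes prog [automaton_code c M] (automaton_code c N) \<and> finite_automaton (S <+> S) N \<and>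
      qi_embedded G T (language N) \<and> represents G (language N) (carrier G - word_val G ` language M))"
proof -
  obtain k B \<kappa> where cc: "cone_coded_group G (letters S c) (val_of G S c) (inv_of S c) k B (Suc k) \<kappa>"
    using cone_coded_group_ex[OF hyp cg] by (elim exE)
  interpret cc: cone_coded_group G "letters S c" "val_of G S c" "inv_of S c" k B "Suc k" \<kappa> by (rule cc)
  obtain D0 where D0: "set3 D0 = cc.D" using set3_surj[OF cc.finite_D] by (elim exE conjE)
  \<comment> \<open>\<open>D0\<close> exceeds all numbers in the table \<open>D\<close>, and
    \<open>B ^ Suc k\<close> bounds the displacements in the other tables.\<close>
  define K where "K = B ^ Suc k + D0"
  have K: "x < K \<and> y < K \<and> z < K" if "(x, y, z) \<in> cc.D" for x y z
    using set3_less[of x y z D0] that unfolding D0 K_def by (simp add: trans_less_add2)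
  have K1: "B ^ Suc k \<le> K" by (simp add: K_def)
  obtain h where h: "\<forall>xs. length xs = Suc 0 \<longrightarrow> (\<exists>n e. cc.cert_num K n e (hd xs)) \<longrightarrow>
      (\<exists>n. computes h xs n \<and> (\<exists>e. cc.cert_num K n e (hd xs)))"
    using computable_search[of "Suc 0" "\<lambda>n e xs. cc.cert_num K n e (hd xs)", OF cc.decidable_cert_num] by (elim exE)
  have "\<exists>N. computes h [automaton_code c M] (automaton_code c N) \<and> finite_automaton (S <+> S) N \<and>
      qi_embedded G T (language N) \<and> represents G (language N) (carrier G - word_val G ` language M)"
    if M: "finite_automaton (S <+> S) M" and qi: "qi_embedded G T (language M)" for M :: "('a + 'a) automaton"
  proof -
    have "\<exists>n e. cc.cert_num K n e (automaton_code c M)" by (rule cert_num_ex[OF hyp cg cc T M qi])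
    then obtain n e where n: "computes h [automaton_code c M] n" "cc.cert_num K n e (automaton_code c M)"
      using h[rule_format, of "[automaton_code c M]"] by auto
    have "\<exists>N. automaton_code c N = n \<and> finite_automaton (S <+> S) N \<and> qi_embedded G T (language N) \<and>
      represents G (language N) (carrier G - word_val G ` language M)"
      by (rule certificate_words[OF cg cc T M K1 _ n(2)]) (rule K)
    then obtain N where N: "automaton_code c N = n" "finite_automaton (S <+> S) N" "qi_embedded G T (language N)"
      "represents G (language N) (carrier G - word_val G ` language M)"
      by (elim exE conjE)
    then show ?thesis using n(1) by (intro exI[of _ N]) simp
  qed
  then show ?thesis by (intro exI[of _ h]) simp
qed

section \<open>Disjoint unions of automata, on even and odd states\<close>

definition mix :: "nat \<Rightarrow> nat \<Rightarrow> nat \<Rightarrow> nat \<Rightarrow> bool" where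
  "mix W a b s \<longleftrightarrow> (\<forall>x<W. x \<in> set_decode s \<longleftrightarrow>
     (\<exists>p<W. x = 2 * p \<and> p \<in> set_decode a) \<or> (\<exists>p<W. x = Suc (2 * p) \<and> p \<in> set_decode b))"

definition mix3 :: "nat \<Rightarrow> nat \<Rightarrow> nat \<Rightarrow> nat \<Rightarrow> bool" where
  "mix3 W a b s \<longleftrightarrow> (\<forall>p<W. \<forall>l<W. \<forall>q<W. (p, l, q) \<in> set3 s \<longleftrightarrow>
     (\<exists>p'<W. \<exists>q'<W. p = 2 * p' \<and> q = 2 * q' \<and> (p', l, q') \<in> set3 a) \<or>
     (\<exists>p'<W. \<exists>q'<W. p = Suc (2 * p') \<and> q = Suc (2 * q') \<and> (p', l, q') \<in> set3 b))"

text \<open>The union is described by a decidable relation and then searched for, so that no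
  arithmetic on codes has to be programmed. The bound \<open>n + 2 * (m1 + m2)\<close> also exceeds
  the doubled states.\<close>

definition union_num :: "nat \<Rightarrow> nat \<Rightarrow> nat \<Rightarrow> bool" where
  "union_num n m1 m2 \<longleftrightarrow> (\<exists>s1<m1. \<exists>i1<m1. \<exists>a1<m1. \<exists>t1<m1. m1 = list_encode [s1, i1, a1, t1] \<and>
     (\<exists>s2<m2. \<exists>i2<m2. \<exists>a2<m2. \<exists>t2<m2. m2 = list_encode [s2, i2, a2, t2] \<and>
     (\<exists>s<n. \<exists>i<n. \<exists>a<n. \<exists>t<n. n = list_encode [s, i, a, t] \<and>
       mix (n + 2 * (m1 + m2)) s1 s2 s \<and> mix (n + 2 * (m1 + m2)) i1 i2 i \<and> mix (n + 2 * (m1 + m2)) a1 a2 a \<and>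
       mix3 (n + 2 * (m1 + m2)) t1 t2 t \<and>
       (\<forall>x<n. x \<in> set_decode t \<longrightarrow> (\<exists>p<n. \<exists>l<n. \<exists>q<n. x = list_encode [p, l, q])))))"

lemma decidable_union_num:
  "decidable (Suc (Suc (Suc (Suc 0)))) (\<lambda>ys. union_num (hd ys) (hd (tl (tl ys))) (hd (tl (tl (tl ys)))))"
  unfolding union_num_def mix_def mix3_def
  by (rule decidable_all decidable_ex decidable_conj decidable_disj decidable_imp decidable_iff decidable_eq decidable_set3 decidable_mem computable_intros)+

lemma bounded_image_iff:
  fixes W :: nat
  assumes "\<And>p. p \<in> A \<Longrightarrow> p < W"
  shows "(\<exists>p<W. x = f p \<and> p \<in> A) \<longleftrightarrow> x \<in> f ` A"
  using assms by blast

lemma bounded_set_eq_iff: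
  fixes W :: nat
  assumes "\<And>x. x \<in> A \<Longrightarrow> x < W" "\<And>x. x \<in> B \<Longrightarrow> x < W"
  shows "(\<forall>x<W. x \<in> A \<longleftrightarrow> x \<in> B) \<longleftrightarrow> A = B"
  using assms by blast

lemma bounded_ex2_iff:
  fixes W :: nat
  assumes "\<And>p q. P p q \<Longrightarrow> p < W \<and> q < W"
  shows "(\<exists>p'<W. \<exists>q'<W. p = f p' \<and> q = f q' \<and> P p' q') \<longleftrightarrow> (\<exists>p' q'. p = f p' \<and> q = f q' \<and> P p' q')"
  using assms by blast

lemma bounded_triples_eq_iff:
  fixes W :: nat
  assumes A: "\<And>p l q. (p, l, q) \<in> A \<Longrightarrow> p < W \<and> l < W \<and> q < W"
    and B: "\<And>p l q. (p, l, q) \<in> B \<Longrightarrow> p < W \<and> l < W \<and> q < W"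
  shows "(\<forall>p<W. \<forall>l<W. \<forall>q<W. (p, l, q) \<in> A \<longleftrightarrow> (p, l, q) \<in> B) \<longleftrightarrow> A = B"
proof
  assume H: "\<forall>p<W. \<forall>l<W. \<forall>q<W. (p, l, q) \<in> A \<longleftrightarrow> (p, l, q) \<in> B"
  have "(p, l, q) \<in> A \<longleftrightarrow> (p, l, q) \<in> B" for p l q
    using H A[of p l q] B[of p l q] by blast
  then show "A = B" by (auto simp: set_eq_iff)
qed simp

lemma mix_iff:
  assumes "s < n" "a < m1" "b < m2"
  shows "mix (n + 2 * (m1 + m2)) a b s \<longleftrightarrow> set_decode s = (\<lambda>p. 2 * p) ` set_decode a \<union> (\<lambda>p. Suc (2 * p)) ` set_decode b"
proof -
  define W where "W = n + 2 * (m1 + m2)"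
  have W: "2 * m1 \<le> W" "2 * m2 \<le> W" "n \<le> W"
    unfolding W_def by (simp_all add: distrib_left)
  have s: "x < W" if "x \<in> set_decode s" for x
    using set_decode_less[OF that] assms W by linarith
  have a1: "p < W" if "p \<in> set_decode a" for p
    using set_decode_less[OF that] assms W by linarith
  have a2: "2 * p < W" if "p \<in> set_decode a" for p
    using set_decode_less[OF that] assms W by linarith
  have b1: "p < W" if "p \<in> set_decode b" for p
    using set_decode_less[OF that] assms W by linarith
  have b2: "Suc (2 * p) < W" if "p \<in> set_decode b" for p
    using set_decode_less[OF that] assms W by linarith
  have A: "(\<exists>p<W. x = 2 * p \<and> p \<in> set_decode a) \<longleftrightarrow> x \<in> (\<lambda>p. 2 * p) ` set_decode a" for x
    by (rule bounded_image_iff[where f = "\<lambda>p. 2 * p"]) (erule a1)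
  have B: "(\<exists>p<W. x = Suc (2 * p) \<and> p \<in> set_decode b) \<longleftrightarrow> x \<in> (\<lambda>p. Suc (2 * p)) ` set_decode b" for x
    by (rule bounded_image_iff[where f = "\<lambda>p. Suc (2 * p)"]) (erule b1)
  have "mix W a b s \<longleftrightarrow> (\<forall>x<W. x \<in> set_decode s \<longleftrightarrow> x \<in> (\<lambda>p. 2 * p) ` set_decode a \<union> (\<lambda>p. Suc (2 * p)) ` set_decode b)"
    by (simp only: mix_def Un_iff A B)
  also have "\<dots> \<longleftrightarrow> set_decode s = (\<lambda>p. 2 * p) ` set_decode a \<union> (\<lambda>p. Suc (2 * p)) ` set_decode b"
  proof (rule bounded_set_eq_iff[OF s])
    fix x assume "x \<in> (\<lambda>p. 2 * p) ` set_decode a \<union> (\<lambda>p. Suc (2 * p)) ` set_decode b"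
    then show "x < W" by (elim UnE imageE) (simp_all add: a2 b2)
  qed
  finally show ?thesis unfolding W_def .
qed

definition mix_trans :: "(nat \<times> nat \<times> nat) set \<Rightarrow> (nat \<times> nat \<times> nat) set \<Rightarrow> (nat \<times> nat \<times> nat) set" where
  "mix_trans A B = (\<lambda>(p, l, q). (2 * p, l, 2 * q)) ` A \<union> (\<lambda>(p, l, q). (Suc (2 * p), l, Suc (2 * q))) ` B"

lemma mix_trans_iff: "(p, l, q) \<in> mix_trans A B \<longleftrightarrow>
    (\<exists>p' q'. p = 2 * p' \<and> q = 2 * q' \<and> (p', l, q') \<in> A) \<or>
    (\<exists>p' q'. p = Suc (2 * p') \<and> q = Suc (2 * q') \<and> (p', l, q') \<in> B)"
  unfolding mix_trans_def Un_iff image_iff by (intro disj_cong) force+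

lemma mix3_iff:
  assumes "s < n" "a < m1" "b < m2"
  shows "mix3 (n + 2 * (m1 + m2)) a b s \<longleftrightarrow> set3 s = mix_trans (set3 a) (set3 b)"
proof -
  define W where "W = n + 2 * (m1 + m2)"
  have W: "2 * m1 \<le> W" "2 * m2 \<le> W" "n \<le> W"
    unfolding W_def by (simp_all add: distrib_left)
  have s: "p < W \<and> l < W \<and> q < W" if "(p, l, q) \<in> set3 s" for p l q
    using set3_less[OF that] assms W by linarith
  have a1: "p < W \<and> q < W" if "(p, l, q) \<in> set3 a" for p l q
    using set3_less[OF that] assms W by linarith
  have a2: "2 * p < W \<and> l < W \<and> 2 * q < W" if "(p, l, q) \<in> set3 a" for p l q
    using set3_less[OF that] assms W by linarith
  have b1: "p < W \<and> q < W" if "(p, l, q) \<in> set3 b" for p l q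
    using set3_less[OF that] assms W by linarith
  have b2: "Suc (2 * p) < W \<and> l < W \<and> Suc (2 * q) < W" if "(p, l, q) \<in> set3 b" for p l q
    using set3_less[OF that] assms W by linarith
  have e: "(\<exists>p'<W. \<exists>q'<W. p = 2 * p' \<and> q = 2 * q' \<and> (p', l, q') \<in> set3 a) \<longleftrightarrow>
      (\<exists>p' q'. p = 2 * p' \<and> q = 2 * q' \<and> (p', l, q') \<in> set3 a)"
    "(\<exists>p'<W. \<exists>q'<W. p = Suc (2 * p') \<and> q = Suc (2 * q') \<and> (p', l, q') \<in> set3 b) \<longleftrightarrow>
      (\<exists>p' q'. p = Suc (2 * p') \<and> q = Suc (2 * q') \<and> (p', l, q') \<in> set3 b)" for p l q
    by (rule bounded_ex2_iff[where P = "\<lambda>p q. (p, l, q) \<in> set3 a" and f = "\<lambda>p. 2 * p"], erule a1)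
      (rule bounded_ex2_iff[where P = "\<lambda>p q. (p, l, q) \<in> set3 b" and f = "\<lambda>p. Suc (2 * p)"], erule b1)
  have bound: "p < W \<and> l < W \<and> q < W" if "(p, l, q) \<in> mix_trans (set3 a) (set3 b)" for p l q
    using that unfolding mix_trans_iff
  proof (elim disjE exE conjE)
    fix p' q' assume p: "p = 2 * p'" "q = 2 * q'" "(p', l, q') \<in> set3 a"
    show ?thesis using a2[OF p(3)] unfolding p(1,2) .
  next
    fix p' q' assume p: "p = Suc (2 * p')" "q = Suc (2 * q')" "(p', l, q') \<in> set3 b"
    show ?thesis using b2[OF p(3)] unfolding p(1,2) .
  qed
  have "mix3 W a b s \<longleftrightarrow> (\<forall>p<W. \<forall>l<W. \<forall>q<W. (p, l, q) \<in> set3 s \<longleftrightarrow> (p, l, q) \<in> mix_trans (set3 a) (set3 b))"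
    unfolding mix3_def e mix_trans_iff by (rule refl)
  also have "\<dots> \<longleftrightarrow> set3 s = mix_trans (set3 a) (set3 b)"
    by (rule bounded_triples_eq_iff[OF s bound])
  finally show ?thesis unfolding W_def .
qed

text \<open>The parity of the state is constant along a path, so the two automata do not
  interact.\<close>

lemma mix_trans_path:
  "path (mix_trans A B) (2 * p) w q \<longleftrightarrow> (\<exists>q'. q = 2 * q' \<and> path A p w q')"
  "path (mix_trans A B) (Suc (2 * p)) w q \<longleftrightarrow> (\<exists>q'. q = Suc (2 * q') \<and> path B p w q')"
proof (induction w arbitrary: p)
  case Nil
  {
    case 1
    show ?case by auto
  next
    case 2
    show ?case by auto
  }
next
  case (Cons l w)
  have odd: "2 * x \<noteq> Suc (2 * y)" "Suc (2 * y) \<noteq> 2 * x" for x y :: nat by presburger+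
  have even_step: "(2 * p, l, r) \<in> mix_trans A B \<longleftrightarrow> (\<exists>r'. r = 2 * r' \<and> (p, l, r') \<in> A)" for p r
    unfolding mix_trans_iff using odd by auto
  have odd_step: "(Suc (2 * p), l, r) \<in> mix_trans A B \<longleftrightarrow> (\<exists>r'. r = Suc (2 * r') \<and> (p, l, r') \<in> B)" for p r
    unfolding mix_trans_iff using odd by auto
  {
    case 1
    show ?case unfolding path.simps even_step using Cons.IH(1) by blast
  next
    case 2
    show ?case unfolding path.simps odd_step using Cons.IH(2) by blast
  }
qed

lemma (in coded_generators) language_iff:
  assumes M: "transitions M \<subseteq> UNIV \<times> (S <+> S) \<times> UNIV"
  shows "w \<in> language M \<longleftrightarrow> w \<in> lists (S <+> S) \<and>
    (\<exists>p\<in>initial M. \<exists>q\<in>accepting M. path (code_trans c M) p (map (letter_code c) w) q)"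
proof
  assume w: "w \<in> language M"
  have wL: "w \<in> lists (S <+> S)" using language_lists[OF M] w by blast
  then show "w \<in> lists (S <+> S) \<and>
    (\<exists>p\<in>initial M. \<exists>q\<in>accepting M. path (code_trans c M) p (map (letter_code c) w) q)"
    unfolding path_run[OF M wL] using w unfolding language_def by blast
next
  assume w: "w \<in> lists (S <+> S) \<and>
    (\<exists>p\<in>initial M. \<exists>q\<in>accepting M. path (code_trans c M) p (map (letter_code c) w) q)"
  then have wL: "w \<in> lists (S <+> S)" by blast
  show "w \<in> language M" using w unfolding path_run[OF M wL] language_def by blast
qed

lemma union_program:
  fixes G :: "('a, 'b) monoid_scheme"
  assumes cg: "coded_generators G S c"
  shows "\<exists>prog. \<forall>M1 M2 :: ('a + 'a) automaton. finite_automaton (S <+> S) M1 \<longrightarrow> finite_automaton (S <+> S) M2 \<longrightarrow>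
    (\<exists>N. computes prog [automaton_code c M1, automaton_code c M2] (automaton_code c N) \<and>
      finite_automaton (S <+> S) N \<and> language N = language M1 \<union> language M2)"
proof -
  interpret S: coded_generators G S c by (rule cg)
  \<comment> \<open>The witness \<open>e\<close> is a dummy: the relation \<open>union_num\<close>
    determines acceptability of the output by itself.\<close>
  obtain h where h: "\<forall>xs. length xs = Suc (Suc 0) \<longrightarrow> (\<exists>n e :: nat. union_num n (hd xs) (hd (tl xs))) \<longrightarrow>
      (\<exists>n. computes h xs n \<and> (\<exists>e :: nat. union_num n (hd xs) (hd (tl xs))))"
    using computable_search[of "Suc (Suc 0)" "\<lambda>n e xs. union_num n (hd xs) (hd (tl xs))", OF decidable_union_num] by (elim exE)
  have "\<exists>N. computes h [automaton_code c M1, automaton_code c M2] (automaton_code c N) \<and>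
      finite_automaton (S <+> S) N \<and> language N = language M1 \<union> language M2"
    if M1: "finite_automaton (S <+> S) M1" and M2: "finite_automaton (S <+> S) M2" for M1 M2 :: "('a + 'a) automaton"
  proof -
    let ?m1 = "automaton_code c M1" and ?m2 = "automaton_code c M2"
    note T1 = S.finite_automaton_transitions[OF M1] and T2 = S.finite_automaton_transitions[OF M2]
    obtain s1 i1 a1 t1 where m1: "?m1 = list_encode [s1, i1, a1, t1]" "set_decode s1 = states M1"
      "set_decode i1 = initial M1" "set_decode a1 = accepting M1" "set3 t1 = code_trans c M1"
      using S.automaton_code_sets[OF M1] by (elim exE conjE)
    obtain s2 i2 a2 t2 where m2: "?m2 = list_encode [s2, i2, a2, t2]" "set_decode s2 = states M2"
      "set_decode i2 = initial M2" "set_decode a2 = accepting M2" "set3 t2 = code_trans c M2"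
      using S.automaton_code_sets[OF M2] by (elim exE conjE)
    have less: "s1 < ?m1" "i1 < ?m1" "a1 < ?m1" "t1 < ?m1" "s2 < ?m2" "i2 < ?m2" "a2 < ?m2" "t2 < ?m2"
      using list_encode_ge[of _ "[s1, i1, a1, t1]"] list_encode_ge[of _ "[s2, i2, a2, t2]"] unfolding m1(1) m2(1)
      by (simp_all del: list_encode.simps)
    define mx where "mx a b = set_encode ((\<lambda>p. 2 * p) ` set_decode a \<union> (\<lambda>p. Suc (2 * p)) ` set_decode b)" for a b
    have mx: "set_decode (mx a b) = (\<lambda>p. 2 * p) ` set_decode a \<union> (\<lambda>p. Suc (2 * p)) ` set_decode b" for a b
      unfolding mx_def by (rule set_encode_inverse) simp
    have "finite (mix_trans (set3 t1) (set3 t2))"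
      unfolding mix_trans_def m1(5) m2(5) code_trans_def
      by (intro finite_UnI finite_imageI S.finite_transitions M1 M2)
    from set3_surj[OF this] obtain t where t: "set3 t = mix_trans (set3 t1) (set3 t2)"
      "\<forall>w\<in>set_decode t. \<exists>x y z. w = list_encode [x, y, z]" by (elim exE conjE)
    define n where "n = list_encode [mx s1 s2, mx i1 i2, mx a1 a2, t]"
    have nless: "mx s1 s2 < n" "mx i1 i2 < n" "mx a1 a2 < n" "t < n"
      using list_encode_ge[of _ "[mx s1 s2, mx i1 i2, mx a1 a2, t]"] unfolding n_def by (simp_all del: list_encode.simps)
    have triples: "\<forall>x<n. x \<in> set_decode t \<longrightarrow> (\<exists>p<n. \<exists>l<n. \<exists>q<n. x = list_encode [p, l, q])"
    proof (intro allI impI)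
      fix x assume "x < n" and x: "x \<in> set_decode t"
      obtain p l q where plq: "x = list_encode [p, l, q]" using t(2) x by blast
      then have "(p, l, q) \<in> set3 t" using x unfolding set3_def by simp
      from set3_less[OF this] have "p < n" "l < n" "q < n" using nless(4) by linarith+
      then show "\<exists>p<n. \<exists>l<n. \<exists>q<n. x = list_encode [p, l, q]" using plq by blast
    qed
    have "union_num n ?m1 ?m2"
      unfolding union_num_def
      by (rule exI[of _ s1], rule conjI[OF less(1)], rule exI[of _ i1], rule conjI[OF less(2)],
          rule exI[of _ a1], rule conjI[OF less(3)], rule exI[of _ t1], rule conjI[OF less(4)], rule conjI[OF m1(1)],
          rule exI[of _ s2], rule conjI[OF less(5)], rule exI[of _ i2], rule conjI[OF less(6)],
          rule exI[of _ a2], rule conjI[OF less(7)], rule exI[of _ t2], rule conjI[OF less(8)], rule conjI[OF m2(1)],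
          rule exI[of _ "mx s1 s2"], rule conjI[OF nless(1)], rule exI[of _ "mx i1 i2"], rule conjI[OF nless(2)],
          rule exI[of _ "mx a1 a2"], rule conjI[OF nless(3)], rule exI[of _ t], rule conjI[OF nless(4)], rule conjI[OF n_def],
          intro conjI mix_iff[THEN iffD2] mix3_iff[THEN iffD2] less nless mx t(1) triples)
    then have "\<exists>n (e :: nat). union_num n (hd [?m1, ?m2]) (hd (tl [?m1, ?m2]))" unfolding list.sel by blast
    then have "\<exists>n. computes h [?m1, ?m2] n \<and> (\<exists>e :: nat. union_num n (hd [?m1, ?m2]) (hd (tl [?m1, ?m2])))"
      by (intro h[THEN spec, THEN mp, THEN mp]) simp
    then obtain n' where n': "computes h [?m1, ?m2] n'" "union_num n' ?m1 ?m2" unfolding list.sel by blast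
    obtain s1' i1' a1' t1' s2' i2' a2' t2' s i a tr where u: "?m1 = list_encode [s1', i1', a1', t1']"
       "?m2 = list_encode [s2', i2', a2', t2']" "s < n'" "i < n'" "a < n'" "tr < n'" "n' = list_encode [s, i, a, tr]"
       "mix (n' + 2 * (?m1 + ?m2)) s1' s2' s" "mix (n' + 2 * (?m1 + ?m2)) i1' i2' i" "mix (n' + 2 * (?m1 + ?m2)) a1' a2' a"
       "mix3 (n' + 2 * (?m1 + ?m2)) t1' t2' tr"
       "\<forall>x<n'. x \<in> set_decode tr \<longrightarrow> (\<exists>p<n'. \<exists>l<n'. \<exists>q<n'. x = list_encode [p, l, q])"
      using n'(2) unfolding union_num_def by (elim exE conjE)
    have eqs: "s1' = s1" "i1' = i1" "a1' = a1" "t1' = t1" "s2' = s2" "i2' = i2" "a2' = a2" "t2' = t2"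
      using m1(1) u(1) m2(1) u(2) by (simp_all add: list_encode_eq del: list_encode.simps)
    let ?E = "\<lambda>p :: nat. 2 * p" and ?O = "\<lambda>p :: nat. Suc (2 * p)"
    have sets: "set_decode s = ?E ` states M1 \<union> ?O ` states M2" "set_decode i = ?E ` initial M1 \<union> ?O ` initial M2"
      "set_decode a = ?E ` accepting M1 \<union> ?O ` accepting M2" "set3 tr = mix_trans (code_trans c M1) (code_trans c M2)"
      using mix_iff[THEN iffD1, OF u(3) less(1,5) u(8)[unfolded eqs]] mix_iff[THEN iffD1, OF u(4) less(2,6) u(9)[unfolded eqs]]
        mix_iff[THEN iffD1, OF u(5) less(3,7) u(10)[unfolded eqs]] mix3_iff[THEN iffD1, OF u(6) less(4,8) u(11)[unfolded eqs]]
      unfolding m1(2-5) m2(2-5) by blast+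
    have sub: "initial M \<subseteq> states M" "accepting M \<subseteq> states M" "code_trans c M \<subseteq> states M \<times> letters S c \<times> states M"
      if "finite_automaton (S <+> S) M" for M :: "('a + 'a) automaton"
    proof -
      show "initial M \<subseteq> states M" "accepting M \<subseteq> states M" using that unfolding finite_automaton_def by blast+
      show "code_trans c M \<subseteq> states M \<times> letters S c \<times> states M"
      proof
        fix y assume "y \<in> code_trans c M"
        then obtain p x q where y: "(p, x, q) \<in> transitions M" "y = (p, letter_code c x, q)" unfolding code_trans_def by auto
        have "(p, x, q) \<in> states M \<times> (S <+> S) \<times> states M" using that y(1) unfolding finite_automaton_def by blast
        then show "y \<in> states M \<times> letters S c \<times> states M" unfolding y(2) letters_def by blast
      qed
    qed
    have "\<exists>N. automaton_code c N = list_encode [s, i, a, tr] \<and> finite_automaton (S <+> S) N \<and>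
      initial N = set_decode i \<and> accepting N = set_decode a \<and> code_trans c N = set3 tr"
    proof (rule S.decode_automaton)
      show "\<exists>p l q. x = list_encode [p, l, q]" if x: "x \<in> set_decode tr" for x
      proof -
        have "x < n'" using set_decode_less[OF x] u(6) by linarith
        then show ?thesis using u(12) x by blast
      qed
      show "set_decode i \<subseteq> set_decode s" unfolding sets using sub(1)[OF M1] sub(1)[OF M2] by blast
      show "set_decode a \<subseteq> set_decode s" unfolding sets using sub(2)[OF M1] sub(2)[OF M2] by blast
      show "set3 tr \<subseteq> set_decode s \<times> letters S c \<times> set_decode s"
      proof
        fix y assume y: "y \<in> set3 tr"
        obtain p l q where plq: "y = (p, l, q)" by (cases y) blast
        from y[unfolded plq sets(4) mix_trans_iff] show "y \<in> set_decode s \<times> letters S c \<times> set_decode s"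
        proof (elim disjE exE conjE)
          fix p' q' assume e: "p = 2 * p'" "q = 2 * q'" "(p', l, q') \<in> code_trans c M1"
          then have "p' \<in> states M1" "q' \<in> states M1" "l \<in> letters S c" using sub(3)[OF M1] by blast+
          then show ?thesis unfolding plq sets(1) e(1,2) by blast
        next
          fix p' q' assume e: "p = Suc (2 * p')" "q = Suc (2 * q')" "(p', l, q') \<in> code_trans c M2"
          then have "p' \<in> states M2" "q' \<in> states M2" "l \<in> letters S c" using sub(3)[OF M2] by blast+
          then show ?thesis unfolding plq sets(1) e(1,2) by blast
        qed
      qed
    qed
    then obtain N where N: "automaton_code c N = n'" "finite_automaton (S <+> S) N" "initial N = ?E ` initial M1 \<union> ?O ` initial M2"
      "accepting N = ?E ` accepting M1 \<union> ?O ` accepting M2" "code_trans c N = mix_trans (code_trans c M1) (code_trans c M2)"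
      unfolding sets u(7)[symmetric] by (elim exE conjE)
    have even: "2 * q \<in> accepting N \<longleftrightarrow> q \<in> accepting M1" and odd: "Suc (2 * q) \<in> accepting N \<longleftrightarrow> q \<in> accepting M2" for q
    proof -
      have parity: "2 * x \<noteq> Suc (2 * y)" "Suc (2 * y) \<noteq> 2 * x" for x y :: nat by presburger+
      show "2 * q \<in> accepting N \<longleftrightarrow> q \<in> accepting M1" "Suc (2 * q) \<in> accepting N \<longleftrightarrow> q \<in> accepting M2"
        unfolding N(4) Un_iff image_iff using parity by simp_all
    qed
    have "(\<exists>p\<in>initial N. \<exists>q\<in>accepting N. path (code_trans c N) p x q) \<longleftrightarrow>
      (\<exists>p\<in>initial M1. \<exists>q\<in>accepting M1. path (code_trans c M1) p x q) \<or>
      (\<exists>p\<in>initial M2. \<exists>q\<in>accepting M2. path (code_trans c M2) p x q)" for x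
    proof -
      have 1: "(\<exists>q\<in>accepting N. path (code_trans c N) (2 * p) x q) \<longleftrightarrow> (\<exists>q\<in>accepting M1. path (code_trans c M1) p x q)" for p
        unfolding N(5) mix_trans_path(1) using even by blast
      have 2: "(\<exists>q\<in>accepting N. path (code_trans c N) (Suc (2 * p)) x q) \<longleftrightarrow> (\<exists>q\<in>accepting M2. path (code_trans c M2) p x q)" for p
        unfolding N(5) mix_trans_path(2) using odd by blast
      show ?thesis unfolding N(3) bex_Un bex_simps 1 2 ..
    qed
    then have "language N = language M1 \<union> language M2"
      unfolding set_eq_subset subset_iff Un_iff
        S.language_iff[OF T1] S.language_iff[OF T2] S.language_iff[OF S.finite_automaton_transitions[OF N(2)]] by blast
    then show ?thesis using n'(1) N(1,2) by blast
  qed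
  then show ?thesis by (intro exI[of _ h]) simp
qed

lemma qi_embedded_Un:
  assumes "qi_embedded G T L1" "qi_embedded G T L2"
  shows "qi_embedded G T (L1 \<union> L2)"
proof -
  obtain l1 m1 where 1: "1 \<le> l1" "0 \<le> m1" "\<And>w. w \<in> L1 \<Longrightarrow> real (word_length G T (word_val G w)) \<ge> 1 / l1 * real (length w) - m1"
    using assms(1) unfolding qi_embedded_def by blast
  obtain l2 m2 where 2: "1 \<le> l2" "0 \<le> m2" "\<And>w. w \<in> L2 \<Longrightarrow> real (word_length G T (word_val G w)) \<ge> 1 / l2 * real (length w) - m2"
    using assms(2) unfolding qi_embedded_def by blast
  define l m where "l = max l1 l2" and "m = max m1 m2"
  have mono: "1 / l * x - m \<le> 1 / l' * x - m'" if "1 \<le> l'" "l' \<le> l" "m' \<le> m" "0 \<le> x" for x l' m'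
  proof -
    have "1 / l \<le> 1 / l'" using that(1,2) by (simp add: frac_le)
    then have "1 / l * x \<le> 1 / l' * x" using that(4) by (rule mult_right_mono)
    then show ?thesis using that(3) by linarith
  qed
  have "real (word_length G T (word_val G w)) \<ge> 1 / l * real (length w) - m" if "w \<in> L1 \<union> L2" for w
  proof (cases "w \<in> L1")
    case True
    have "1 / l * real (length w) - m \<le> 1 / l1 * real (length w) - m1" by (rule mono) (simp_all add: 1 l_def m_def)
    then show ?thesis using 1(3)[OF True] by linarith
  next
    case False
    then have w: "w \<in> L2" using that by blast
    have "1 / l * real (length w) - m \<le> 1 / l2 * real (length w) - m2" by (rule mono) (simp_all add: 2 l_def m_def)
    then show ?thesis using 2(3)[OF w] by linarith
  qed
  moreover have "1 \<le> l" "0 \<le> m" using 1(1,2) by (simp_all add: l_def m_def)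
  ultimately show ?thesis unfolding qi_embedded_def by blast
qed

theorem corollary9p6:
  fixes G :: "('a, 'b) monoid_scheme" and S T :: "'a set" and c :: "'a \<Rightarrow> nat"
  assumes "hyperbolic_group G"
    and "finite_generating_set G S"
    and "finite_generating_set G T"
    and "inj_on c S"
  shows "algebra (carrier G) {R. qi_embeddable_rational G S T R} \<and>
    (\<exists>union_prog inter_prog compl_prog.
      (\<forall>M1 M2 R1 R2.
        finite_automaton (S <+> S) M1 \<and> qi_embedded G T (language M1) \<and>
          represents G (language M1) R1 \<and>
        finite_automaton (S <+> S) M2 \<and> qi_embedded G T (language M2) \<and>
          represents G (language M2) R2 \<longrightarrow>
        (\<exists>N. computes union_prog [automaton_code c M1, automaton_code c M2] (automaton_code c N) \<and>
          finite_automaton (S <+> S) N \<and> qi_embedded G T (language N) \<and>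
          represents G (language N) (R1 \<union> R2)) \<and>
        (\<exists>N. computes inter_prog [automaton_code c M1, automaton_code c M2] (automaton_code c N) \<and>
          finite_automaton (S <+> S) N \<and> qi_embedded G T (language N) \<and>
          represents G (language N) (R1 \<inter> R2)) \<and>
        (\<exists>N. computes compl_prog [automaton_code c M1] (automaton_code c N) \<and>
          finite_automaton (S <+> S) N \<and> qi_embedded G T (language N) \<and>
          represents G (language N) (carrier G - R1))))"
proof -
  have G: "group G" using assms(1) unfolding hyperbolic_group_def by blast
  have cg: "coded_generators G S c"
    by (rule coded_generators.intro[OF G coded_generators_axioms.intro[OF assms(2,4)]])
  interpret S: coded_generators G S c by (rule cg)
  let ?A = "\<lambda>M. finite_automaton (S <+> S) M \<and> qi_embedded G T (language M)"
  let ?V = "\<lambda>M. word_val G ` language M"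
  obtain P where P0: "\<forall>M :: ('a + 'a) automaton. finite_automaton (S <+> S) M \<longrightarrow> qi_embedded G T (language M) \<longrightarrow>
    (\<exists>N. computes P [automaton_code c M] (automaton_code c N) \<and> finite_automaton (S <+> S) N \<and>
      qi_embedded G T (language N) \<and> represents G (language N) (carrier G - word_val G ` language M))"
    using complement_program[OF assms(1) cg assms(3)] by (elim exE)
  have P: "\<exists>N. computes P [automaton_code c M] (automaton_code c N) \<and> ?A N \<and> ?V N = carrier G - ?V M" if "?A M" for M
    using P0 that unfolding represents_def by blast
  obtain U where U0: "\<forall>M1 M2 :: ('a + 'a) automaton. finite_automaton (S <+> S) M1 \<longrightarrow> finite_automaton (S <+> S) M2 \<longrightarrow>
    (\<exists>N. computes U [automaton_code c M1, automaton_code c M2] (automaton_code c N) \<and>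
      finite_automaton (S <+> S) N \<and> language N = language M1 \<union> language M2)"
    using union_program[OF cg] by (elim exE)
  have U: "\<exists>N. computes U [automaton_code c M1, automaton_code c M2] (automaton_code c N) \<and> ?A N \<and> ?V N = ?V M1 \<union> ?V M2"
    if A: "?A M1" "?A M2" for M1 M2
  proof -
    obtain N where N: "computes U [automaton_code c M1, automaton_code c M2] (automaton_code c N)"
      "finite_automaton (S <+> S) N" "language N = language M1 \<union> language M2"
      using U0 A by blast
    have "qi_embedded G T (language N)" unfolding N(3) using A by (intro qi_embedded_Un) blast+
    moreover have "?V N = ?V M1 \<union> ?V M2" unfolding N(3) image_Un ..
    ultimately show ?thesis using N(1,2) by blast
  qed
  define Q where "Q = Comp P [Comp U [Comp P [Proj 0], Comp P [Proj 1]]]"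
  \<comment> \<open>Complements are taken in \<open>carrier G\<close>, so De Morgan requires the
    represented subsets to lie in it.\<close>
  have V: "?V M \<subseteq> carrier G" if "?A M" for M
  proof (rule image_subsetI)
    fix w assume "w \<in> language M"
    moreover have "language M \<subseteq> lists (S <+> S)"
      using that by (intro S.language_lists S.finite_automaton_transitions) blast
    ultimately show "word_val G w \<in> carrier G" by (intro S.word_val_closed) blast
  qed
  have Q: "\<exists>N. computes Q [automaton_code c M1, automaton_code c M2] (automaton_code c N) \<and> ?A N \<and> ?V N = ?V M1 \<inter> ?V M2"
    if A: "?A M1" "?A M2" for M1 M2
  proof -
    let ?xs = "[automaton_code c M1, automaton_code c M2]"
    obtain N1 where N1: "computes P [automaton_code c M1] (automaton_code c N1)" "?A N1" "?V N1 = carrier G - ?V M1"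
      using P[OF A(1)] by (elim exE conjE) blast
    obtain N2 where N2: "computes P [automaton_code c M2] (automaton_code c N2)" "?A N2" "?V N2 = carrier G - ?V M2"
      using P[OF A(2)] by (elim exE conjE) blast
    obtain N3 where N3: "computes U [automaton_code c N1, automaton_code c N2] (automaton_code c N3)" "?A N3" "?V N3 = ?V N1 \<union> ?V N2"
      using U[OF N1(2) N2(2)] by (elim exE conjE) blast
    obtain N where N: "computes P [automaton_code c N3] (automaton_code c N)" "?A N" "?V N = carrier G - ?V N3"
      using P[OF N3(2)] by (elim exE conjE) blast
    have p: "computes (Proj 0) ?xs (automaton_code c M1)" "computes (Proj 1) ?xs (automaton_code c M2)"
      using computes.proj[of 0 ?xs] computes.proj[of 1 ?xs] by simp_all
    have "computes (Comp P [Proj 0]) ?xs (automaton_code c N1)"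
      using p(1) by (intro computes.comp[OF _ N1(1)]) simp
    moreover have "computes (Comp P [Proj 1]) ?xs (automaton_code c N2)"
      using p(2) by (intro computes.comp[OF _ N2(1)]) simp
    ultimately have "computes (Comp U [Comp P [Proj 0], Comp P [Proj 1]]) ?xs (automaton_code c N3)"
      by (intro computes.comp[OF _ N3(1)]) simp
    then have "computes Q ?xs (automaton_code c N)"
      unfolding Q_def by (intro computes.comp[OF _ N(1)]) simp
    moreover have "?V N = ?V M1 \<inter> ?V M2" unfolding N(3) N3(3) N1(3) N2(3) using V[OF A(1)] V[OF A(2)] by blast
    ultimately show ?thesis using N(2) by blast
  qed
  have rat: "qi_embeddable_rational G S T R \<longleftrightarrow> (\<exists>M. ?A M \<and> ?V M = R)" for R
    unfolding qi_embeddable_rational_def regular_language_def represents_def by blast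
  have alg: "algebra (carrier G) {R. qi_embeddable_rational G S T R}"
    unfolding algebra_iff_Un
  proof (intro conjI ballI)
    show "{R. qi_embeddable_rational G S T R} \<subseteq> Pow (carrier G)" unfolding rat using V by blast
    let ?E = "\<lparr>states = {}, initial = {}, accepting = {}, transitions = {}\<rparr> :: ('a + 'a) automaton"
    have "language ?E = {}" "finite_automaton (S <+> S) ?E" by (simp_all add: language_def finite_automaton_def)
    moreover have "qi_embedded G T {}"
      unfolding qi_embedded_def by (intro exI[of _ "1::real"] exI[of _ "0::real"]) simp
    ultimately have "?A ?E \<and> ?V ?E = {}" by simp
    then show "{} \<in> {R. qi_embeddable_rational G S T R}" unfolding rat mem_Collect_eq by blast
    show "carrier G - R \<in> {R. qi_embeddable_rational G S T R}" if "R \<in> {R. qi_embeddable_rational G S T R}" for R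
      using that P unfolding rat mem_Collect_eq by blast
    show "R \<union> R' \<in> {R. qi_embeddable_rational G S T R}"
      if "R \<in> {R. qi_embeddable_rational G S T R}" "R' \<in> {R. qi_embeddable_rational G S T R}" for R R'
      using that U unfolding rat mem_Collect_eq by blast
  qed
  have progs: "\<forall>M1 M2 R1 R2.
        finite_automaton (S <+> S) M1 \<and> qi_embedded G T (language M1) \<and>
          represents G (language M1) R1 \<and>
        finite_automaton (S <+> S) M2 \<and> qi_embedded G T (language M2) \<and>
          represents G (language M2) R2 \<longrightarrow>
        (\<exists>N. computes U [automaton_code c M1, automaton_code c M2] (automaton_code c N) \<and>
          finite_automaton (S <+> S) N \<and> qi_embedded G T (language N) \<and>
          represents G (language N) (R1 \<union> R2)) \<and>
        (\<exists>N. computes Q [automaton_code c M1, automaton_code c M2] (automaton_code c N) \<and>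
          finite_automaton (S <+> S) N \<and> qi_embedded G T (language N) \<and>
          represents G (language N) (R1 \<inter> R2)) \<and>
        (\<exists>N. computes P [automaton_code c M1] (automaton_code c N) \<and>
          finite_automaton (S <+> S) N \<and> qi_embedded G T (language N) \<and>
          represents G (language N) (carrier G - R1))"
  proof (intro allI impI)
    fix M1 M2 R1 R2
    assume a: "finite_automaton (S <+> S) M1 \<and> qi_embedded G T (language M1) \<and>
          represents G (language M1) R1 \<and>
        finite_automaton (S <+> S) M2 \<and> qi_embedded G T (language M2) \<and>
          represents G (language M2) R2"
    then have A: "?A M1" "?A M2" and R: "R1 = ?V M1" "R2 = ?V M2" unfolding represents_def by blast+
    show "(\<exists>N. computes U [automaton_code c M1, automaton_code c M2] (automaton_code c N) \<and>
          finite_automaton (S <+> S) N \<and> qi_embedded G T (language N) \<and>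
          represents G (language N) (R1 \<union> R2)) \<and>
        (\<exists>N. computes Q [automaton_code c M1, automaton_code c M2] (automaton_code c N) \<and>
          finite_automaton (S <+> S) N \<and> qi_embedded G T (language N) \<and>
          represents G (language N) (R1 \<inter> R2)) \<and>
        (\<exists>N. computes P [automaton_code c M1] (automaton_code c N) \<and>
          finite_automaton (S <+> S) N \<and> qi_embedded G T (language N) \<and>
          represents G (language N) (carrier G - R1))"
    proof (intro conjI)
      show "\<exists>N. computes U [automaton_code c M1, automaton_code c M2] (automaton_code c N) \<and>
          finite_automaton (S <+> S) N \<and> qi_embedded G T (language N) \<and> represents G (language N) (R1 \<union> R2)"
        unfolding represents_def R using U[OF A] by blast
      show "\<exists>N. computes Q [automaton_code c M1, automaton_code c M2] (automaton_code c N) \<and>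
          finite_automaton (S <+> S) N \<and> qi_embedded G T (language N) \<and> represents G (language N) (R1 \<inter> R2)"
        unfolding represents_def R using Q[OF A] by blast
      show "\<exists>N. computes P [automaton_code c M1] (automaton_code c N) \<and>
          finite_automaton (S <+> S) N \<and> qi_embedded G T (language N) \<and> represents G (language N) (carrier G - R1)"
        unfolding represents_def R using P[OF A(1)] by blast
    qed
  qed
  show ?thesis
    by (rule conjI[OF alg], rule exI[of _ U], rule exI[of _ Q], rule exI[of _ P], rule progs)
qed

end
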